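(* Let $A,B\in\mathbb{C}^{n\times n}$ with $A^{\mathsf H}=A$, $B^{\mathsf T}=B$, and $H=\begin{bmatrix}A&B\\ -\overline{B}&-\overline{A}\end{bmatrix}$. Let $\alpha>0$ be such that $\alpha I_{2n}-H$, $\alpha I_n-A$, $R\equiv I_n-(\alpha I_n-\overline{A})^{-1}\overline{B}(\alpha I_n-A)^{-1}B$ and $E_\alpha$ are nonsingular, and let $\{E_k\}$, $\{F_k\}$ be the sequences generated by the doubling iteration (defined in the context), with $1\notin\sigma(F_k)$ for all $k\ge0$. Assume that the partial multiplicities (sizes of the Jordan blocks) of $H$ associated with its purely imaginary eigenvalues are all even, and let $H$ have the eigen-decomposition $$H\,[X,W_\omega,\Pi\overline{X},Z_\omega]=[X,W_\omega,\Pi\overline{X},Z_\omega]\,\widetilde S$$ described in the context. Write $X=\begin{bmatrix}X_1\\ X_2\end{bmatrix}$ with $X_1,X_2\in\mathbb{C}^{n\times n_1}$, and let $\Psi_{11},\Psi_{21}$ be as defined in the context. If $[X_1,\Psi_{11}]\in\mathbb{C}^{n\times n}$ is nonsingular, then $$\lim_{k\to\infty}E_k=0,\qquad \lim_{k\to\infty}F_k=-[X_2,\Psi_{21}]\,[X_1,\Psi_{11}]^{-1},$$ both converging linearly.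
   Context: $\overline{(\cdot)}$ denotes entrywise complex conjugate, $\sigma(\cdot)$ the set of singular values, $\Pi=\begin{bmatrix}0&I_n\\ I_n&0\end{bmatrix}$, $\bigoplus$ a block diagonal sum, $e_i$ the $i$th column of the identity, and $J_p(\mu)$ the $p\times p$ (upper triangular) Jordan block with eigenvalue $\mu$. Doubling iteration: $E_0=E_\alpha\equiv I_n+2\alpha\overline{R}^{-1}(A-\alpha I_n)^{-1}$, $F_0=F_\alpha\equiv-2\alpha(\overline{A}-\alpha I_n)^{-1}\overline{B}\,\overline{R}^{-1}(A-\alpha I_n)^{-1}$, and for $k\ge0$, $E_{k+1}=E_k(I_n-\overline{F}_kF_k)^{-1}E_k$, $F_{k+1}=F_k+\overline{E}_kF_k(I_n-\overline{F}_kF_k)^{-1}E_k$; it is well defined when $1\notin\sigma(F_k)$ for all $k$. Eigen-decomposition: let $\mathrm{i}\omega_1,\dots,\mathrm{i}\omega_q$ be the distinct purely imaginary eigenvalues of $H$, with Jordan blocks $J_{2p_{r,j}}(\mathrm{i}\omega_j)$, $r=1,\dots,l_j$, $j=1,\dots,q$. There are $W_{r,j},Z_{r,j}\in\mathbb{C}^{2n\times p_{r,j}}$ with $H[W_{r,j},Z_{r,j}]=[W_{r,j},Z_{r,j}]J_{2p_{r,j}}(\mathrm{i}\omega_j)$, where the columns of $[W_{r,j},Z_{r,j}]$, over all $r,j$, form Jordan bases for the invariant subspace of all purely imaginary eigenvalues. Put $W_\omega=[W_{1,1},\dots,W_{l_1,1},\dots,W_{1,q},\dots,W_{l_q,q}]$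 and $Z_\omega=[Z_{1,1},\dots,Z_{l_1,1},\dots,Z_{1,q},\dots,Z_{l_q,q}]$. The columns of $X\in\mathbb{C}^{2n\times n_1}$ span the invariant subspace of $H$ for the eigenvalues with negative real part, $HX=XS$ with $S\in\mathbb{C}^{n_1\times n_1}$ (so the spectrum of $S$ lies in the open left half plane), $n_1+\sum_{j=1}^q\sum_{r=1}^{l_j}p_{r,j}=n$, and $[X,W_\omega,\Pi\overline X,Z_\omega]$ is nonsingular. With $J_\omega=\bigoplus_{j=1}^q\bigoplus_{r=1}^{l_j}J_{p_{r,j}}(\mathrm{i}\omega_j)$ and $\Omega_\omega=\bigoplus_{j=1}^q\bigoplus_{r=1}^{l_j}e_{p_{r,j}}e_1^{\mathsf T}$, $$\widetilde S=\begin{bmatrix}S&&&\\ &J_\omega&&\Omega_\omega\\ &&-\overline{S}&\\ &&&J_\omega\end{bmatrix}.$$ Matrices $\Psi_{11},\Psi_{21}$: for each $r,j$ let $Q_{r,j}$ be nonsingular with $J_{2p_{r,j}}(\mathrm{i}\omega_j+\alpha)\,[J_{2p_{r,j}}(\mathrm{i}\omega_j-\alpha)]^{-1}=Q_{r,j}\,J_{2p_{r,j}}(\mathrm{e}^{\mathrm{i}\theta_j})\,Q_{r,j}^{-1}$ (a Jordan decomposition, $\mathrm{e}^{\mathrm{i}\theta_j}=(\mathrm{i}\omega_j+\alpha)/(\mathrm{i}\omega_j-\alpha)$). Partition $Q_{r,j}=\begin{bmatrix}Q^{(11)}_{r,j}&Q^{(12)}_{r,j}\\ Q^{(21)}_{r,j}&Q^{(22)}_{r,j}\end{bmatrix}$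 into $p_{r,j}\times p_{r,j}$ blocks and put $Q^{(s't')}=\bigoplus_{j=1}^q\bigoplus_{r=1}^{l_j}Q^{(s't')}_{r,j}$. Write $W_\omega=\begin{bmatrix}W_{1,\omega}\\ W_{2,\omega}\end{bmatrix}$, $Z_\omega=\begin{bmatrix}Z_{1,\omega}\\ Z_{2,\omega}\end{bmatrix}$ with blocks having $n$ rows. Then $$\Psi_{11}=W_{1,\omega}Q^{(11)}+Z_{1,\omega}Q^{(21)},\qquad \Psi_{21}=W_{2,\omega}Q^{(11)}+Z_{2,\omega}Q^{(21)}.$$ "Converging linearly" means the norm of the error at step $k$ is at most $C\rho^{k}$ for some constants $C>0$, $0<\rho<1$. *)

theory Defs
  imports
    Complex_Main
    "Jordan_Normal_Form.Jordan_Normal_Form_Existence"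
    "Jordan_Normal_Form.Gauss_Jordan_Elimination"
    "Jordan_Normal_Form.Schur_Decomposition"
    "Jordan_Normal_Form.Matrix_Kernel"
    "Jordan_Normal_Form.Spectral_Radius"
begin

abbreviation mat_cnj :: "complex mat \<Rightarrow> complex mat" where
  "mat_cnj \<equiv> map_mat cnj"

text \<open>Only meaningful for a nonsingular (square) argument.\<close>

definition minv :: "complex mat \<Rightarrow> complex mat" where
  "minv M = the (mat_inverse M)"

definition hconcat :: "nat \<Rightarrow> complex mat list \<Rightarrow> complex mat" where
  "hconcat nr Ms = mat_of_cols nr (concat (map cols Ms))"

text \<open>For a family indexed by \<open>r = 1..l j\<close> and \<open>j = 1..q\<close>: the list
  \<open>f 1 1, ..., f (l 1) 1, ..., f 1 q, ..., f (l q) q\<close>.\<close>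

definition block_list :: "nat \<Rightarrow> (nat \<Rightarrow> nat) \<Rightarrow> (nat \<Rightarrow> nat \<Rightarrow> 'a) \<Rightarrow> 'a list" where
  "block_list q l f = concat (map (\<lambda>j. map (\<lambda>r. f r j) [1..<l j + 1]) [1..<q + 1])"

definition singular_values :: "complex mat \<Rightarrow> real set" where
  "singular_values M = {s. 0 \<le> s \<and> eigenvalue (mat_adjoint M * M) (complex_of_real (s\<^sup>2))}"

definition Pi_mat :: "nat \<Rightarrow> complex mat" where
  "Pi_mat n = four_block_mat (0\<^sub>m n n) (1\<^sub>m n) (1\<^sub>m n) (0\<^sub>m n n)"

definition H_mat :: "complex mat \<Rightarrow> complex mat \<Rightarrow> complex mat" where
  "H_mat A B = four_block_mat A B (- mat_cnj B) (- mat_cnj A)"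

definition R_mat :: "nat \<Rightarrow> complex mat \<Rightarrow> complex mat \<Rightarrow> real \<Rightarrow> complex mat" where
  "R_mat n A B \<alpha> = 1\<^sub>m n - minv (complex_of_real \<alpha> \<cdot>\<^sub>m 1\<^sub>m n - mat_cnj A) * mat_cnj B
      * minv (complex_of_real \<alpha> \<cdot>\<^sub>m 1\<^sub>m n - A) * B"

definition E_alpha :: "nat \<Rightarrow> complex mat \<Rightarrow> complex mat \<Rightarrow> real \<Rightarrow> complex mat" where
  "E_alpha n A B \<alpha> = 1\<^sub>m n + complex_of_real (2 * \<alpha>) \<cdot>\<^sub>m
      (minv (mat_cnj (R_mat n A B \<alpha>)) * minv (A - complex_of_real \<alpha> \<cdot>\<^sub>m 1\<^sub>m n))"

definition F_alpha :: "nat \<Rightarrow> complex mat \<Rightarrow> complex mat \<Rightarrow> real \<Rightarrow> complex mat" where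
  "F_alpha n A B \<alpha> = complex_of_real (- 2 * \<alpha>) \<cdot>\<^sub>m
      (minv (mat_cnj A - complex_of_real \<alpha> \<cdot>\<^sub>m 1\<^sub>m n) * mat_cnj B
        * minv (mat_cnj (R_mat n A B \<alpha>)) * minv (A - complex_of_real \<alpha> \<cdot>\<^sub>m 1\<^sub>m n))"

primrec doubling :: "nat \<Rightarrow> complex mat \<Rightarrow> complex mat \<Rightarrow> real \<Rightarrow> nat \<Rightarrow> complex mat \<times> complex mat" where
  "doubling n A B \<alpha> 0 = (E_alpha n A B \<alpha>, F_alpha n A B \<alpha>)"
| "doubling n A B \<alpha> (Suc k) =
    (let (E, F) = doubling n A B \<alpha> k;
         T = minv (1\<^sub>m n - mat_cnj F * F)
     in (E * T * E, F + mat_cnj E * F * T * E))"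

definition doubling_E :: "nat \<Rightarrow> complex mat \<Rightarrow> complex mat \<Rightarrow> real \<Rightarrow> nat \<Rightarrow> complex mat" where
  "doubling_E n A B \<alpha> k = fst (doubling n A B \<alpha> k)"

definition doubling_F :: "nat \<Rightarrow> complex mat \<Rightarrow> complex mat \<Rightarrow> real \<Rightarrow> nat \<Rightarrow> complex mat" where
  "doubling_F n A B \<alpha> k = snd (doubling n A B \<alpha> k)"

text \<open>The invariant subspace of \<open>M\<close> for its eigenvalues in \<open>L\<close>: the span of all generalized
  eigenvectors for elements of \<open>L\<close> (an element that is not an eigenvalue contributes only \<open>0\<close>).\<close>

definition spectral_subspace :: "complex mat \<Rightarrow> complex set \<Rightarrow> complex vec set" where
  "spectral_subspace M L =
     LinearCombinations.module.span class_ring (module_vec TYPE(complex) (dim_row M))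
       (\<Union>\<mu>\<in>L. \<Union>k. mat_kernel (char_matrix M \<mu> ^\<^sub>m k))"

definition cols_form_basis :: "complex mat \<Rightarrow> complex vec set \<Rightarrow> bool" where
  "cols_form_basis M U \<longleftrightarrow>
     distinct (cols M)
     \<and> \<not> LinearCombinations.module.lin_dep class_ring (module_vec TYPE(complex) (dim_row M)) (set (cols M))
     \<and> vec_space.col_space (dim_row M) M = U"

text \<open>The \<open>p \<times> p\<close> matrix $e_p e_1^T$, with its single 1 in the bottom left corner.\<close>

definition corner_mat :: "nat \<Rightarrow> complex mat" where
  "corner_mat p = mat_of_cols p [unit_vec p (p - 1)] * mat_of_rows p [unit_vec p 0]"

definition S_tilde :: "complex mat \<Rightarrow> complex mat \<Rightarrow> complex mat \<Rightarrow> complex mat" where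
  "S_tilde S J \<Omega> =
     (let s = dim_row S; m = dim_row J in
      four_block_mat
        (diag_block_mat [S, J]) (diag_block_mat [0\<^sub>m s s, \<Omega>])
        (0\<^sub>m (s + m) (s + m)) (diag_block_mat [- mat_cnj S, J]))"

text \<open>The Frobenius norm; all matrix norms are equivalent here, since dimensions are fixed along
  each sequence.\<close>

definition frob_norm :: "complex mat \<Rightarrow> real" where
  "frob_norm M = sqrt (\<Sum>i<dim_row M. \<Sum>j<dim_col M. (cmod (M $$ (i, j)))\<^sup>2)"

definition mat_tendsto :: "(nat \<Rightarrow> complex mat) \<Rightarrow> complex mat \<Rightarrow> bool" where
  "mat_tendsto M L \<longleftrightarrow>
     (\<forall>k. M k \<in> carrier_mat (dim_row L) (dim_col L))
     \<and> (\<forall>i<dim_row L. \<forall>j<dim_col L. (\<lambda>k. M k $$ (i, j)) \<longlonglongrightarrow> L $$ (i, j))"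

definition converges_linearly :: "(nat \<Rightarrow> complex mat) \<Rightarrow> complex mat \<Rightarrow> bool" where
  "converges_linearly M L \<longleftrightarrow>
     mat_tendsto M L
     \<and> (\<exists>C \<rho>. 0 < C \<and> 0 < \<rho> \<and> \<rho> < 1 \<and> (\<forall>k. frob_norm (M k - L) \<le> C * \<rho> ^ k))"

end

theory Submission
  imports Defs "HOL-Computational_Algebra.Polynomial_FPS"
begin

text \<open>
  Let \<open>C = (H + \<alpha>I)(H - \<alpha>I)\<^sup>-\<^sup>1\<close> be the Cayley transform of \<open>H\<close>. The doubling iteration is repeated squaring of \<open>C\<close>
  in disguise: for every \<open>k\<close>, with a bar for conjugation,
  \<open>[E\<^sub>k, 0; F\<^sub>k, I] = [I, bar F\<^sub>k; 0, bar E\<^sub>k] C^(2^k)\<close>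
  (\<open>initial_pair\<close> for \<open>k = 0\<close>, \<open>doubling_step\<close> for the induction). The induction also
  carries along that \<open>E\<^sub>k\<close> is Hermitian and \<open>F\<^sub>k\<close> is symmetric. The symmetry turns the condition on the
  singular values of \<open>F\<^sub>k\<close> into the invertibility of \<open>I - bar F\<^sub>k F\<^sub>k\<close>, so every step makes sense.

  Applied to a matrix with blocks \<open>X\<^sub>1, X\<^sub>2\<close> that \<open>C^(2^k)\<close> maps to \<open>Z\<^sub>1, Z\<^sub>2\<close>, the relation reads
  \<open>E\<^sub>k X\<^sub>1 = Z\<^sub>1 + bar F\<^sub>k Z\<^sub>2\<close> and \<open>F\<^sub>k X\<^sub>1 + X\<^sub>2 = bar E\<^sub>k Z\<^sub>2\<close>. Suppose that the blocks \<open>X\<^sub>1, X\<^sub>2\<close> depend on \<open>k\<close>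
  and tend to \<open>U\<^sub>1, U\<^sub>2\<close>, that \<open>Z\<^sub>1, Z\<^sub>2\<close> tend to \<open>0\<close>, both geometrically, and that \<open>U\<^sub>1\<close> is
  nonsingular. Then \<open>X\<^sub>1\<close> is eventually invertible with a bounded inverse, the two equations bound \<open>E\<^sub>k\<close>
  and \<open>F\<^sub>k\<close> in terms of each other, and they give \<open>E\<^sub>k \<longrightarrow> 0\<close> and \<open>F\<^sub>k \<longrightarrow> - U\<^sub>2 U\<^sub>1\<^sup>-\<^sup>1\<close>
  (\<open>pencil_relation_limit\<close>). So it suffices that every column of \<open>[X, \<Psi>]\<close>, with \<open>\<Psi>\<close> the matrix with
  blocks \<open>\<Psi>\<^sub>1\<^sub>1, \<Psi>\<^sub>2\<^sub>1\<close>, is a geometric limit of vectors \<open>x\<^sub>k\<close> with \<open>C^(2^k) x\<^sub>k \<longrightarrow> 0\<close>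
  geometrically: the predicate \<open>nearly_annihilated\<close>.

  For the columns of \<open>X\<close> this is clear with constant \<open>x\<^sub>k\<close>: the Cayley transform sends the left half plane
  into the open unit disc. For a Jordan block of size \<open>2p\<close> with an imaginary eigenvalue, the eigenvalue \<open>\<lambda>\<close>
  of the transformed block is on the unit circle and the powers \<open>J^N\<close> are unbounded. The first \<open>p\<close> unit vectors are
  nevertheless nearly annihilated (\<open>jordan_block_nearly_annihilated\<close>): a correction of
  size \<open>O(1/N)\<close> in the last \<open>p\<close> coordinates of \<open>e\<^sub>t\<close> makes the first \<open>p\<close> coordinates of the image
  vanish, and the others are then \<open>O(1/N)\<close>. After scaling the \<open>i\<close>-th coordinate by \<open>N^i\<close>, the linear system for the
  correction converges to the one with matrix \<open>1/(p + j - i)!\<close>, which is nonsingular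
  (\<open>inverse_factorial_toeplitz_nonsingular\<close>). With \<open>N = 2^k\<close>, an error \<open>O(1/N)\<close> is geometric in \<open>k\<close>.
\<close>

section \<open>Geometric decay of sequences\<close>

text \<open>The bound is required only from some index on, because the inverses that occur below exist only from some
  index on. Over all indices it holds with a larger constant, see \<open>decays_bound\<close> below.\<close>

definition decays :: "(nat \<Rightarrow> 'a::real_normed_vector) \<Rightarrow> bool" where
  "decays f \<longleftrightarrow> (\<exists>C r. 0 < r \<and> r < 1 \<and> (\<forall>\<^sub>F k in sequentially. norm (f k) \<le> C * r ^ k))"

lemma decays_dominated:
  assumes g: "decays g" and fg: "\<forall>\<^sub>F k in sequentially. norm (f k) \<le> c * norm (g k)"
  shows "decays f"
proof -
  obtain C r where r: "0 < r" "r < 1" and C: "\<forall>\<^sub>F k in sequentially. norm (g k) \<le> C * r ^ k"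
    using g unfolding decays_def by blast
  have "\<forall>\<^sub>F k in sequentially. norm (f k) \<le> (\<bar>c\<bar> * C) * r ^ k"
    using fg C
  proof eventually_elim
    case (elim k)
    have "norm (f k) \<le> \<bar>c\<bar> * norm (g k)"
      using elim(1) mult_right_mono[OF abs_ge_self[of c] norm_ge_zero[of "g k"]] by linarith
    also have "\<dots> \<le> \<bar>c\<bar> * (C * r ^ k)" using elim(2) by (rule mult_left_mono) simp
    finally show ?case by (simp add: mult_ac)
  qed
  with r show ?thesis unfolding decays_def by blast
qed

lemma decays_zero [simp]: "decays (\<lambda>k. 0)"
  unfolding decays_def by (rule exI[of _ 0], rule exI[of _ "1/2"]) auto

lemma decays_norm_iff: "decays (\<lambda>k. norm (f k)) \<longleftrightarrow> decays f"
  unfolding decays_def by simp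

lemma decays_minus_iff [simp]: "decays (\<lambda>k. - f k) \<longleftrightarrow> decays f"
  unfolding decays_def by simp

lemma decays_add:
  assumes "decays f" "decays g"
  shows "decays (\<lambda>k. f k + g k)"
proof -
  obtain C r where r: "0 < r" "r < 1" and C: "\<forall>\<^sub>F k in sequentially. norm (f k) \<le> C * r ^ k"
    using assms(1) unfolding decays_def by blast
  obtain D s where s: "0 < s" "s < 1" and D: "\<forall>\<^sub>F k in sequentially. norm (g k) \<le> D * s ^ k"
    using assms(2) unfolding decays_def by blast
  define t where "t = max r s"
  have "\<forall>\<^sub>F k in sequentially. norm (f k + g k) \<le> (\<bar>C\<bar> + \<bar>D\<bar>) * t ^ k"
    using C D
  proof eventually_elim
    case (elim k)
    have "C * r ^ k \<le> \<bar>C\<bar> * t ^ k" "D * s ^ k \<le> \<bar>D\<bar> * t ^ k"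
      using r s by (auto simp: t_def intro!: mult_mono power_mono)
    with elim norm_triangle_ineq[of "f k" "g k"] show ?case by (simp add: distrib_right)
  qed
  moreover have "0 < t" "t < 1" using r s by (auto simp: t_def)
  ultimately show ?thesis unfolding decays_def by blast
qed

lemma decays_sum:
  assumes "\<And>i. i \<in> I \<Longrightarrow> decays (f i)"
  shows "decays (\<lambda>k. \<Sum>i\<in>I. f i k)"
  using assms by (induction I rule: infinite_finite_induct) (auto intro: decays_add)

lemma decays_mult_bounded:
  fixes f g :: "nat \<Rightarrow> 'a::real_normed_field"
  assumes "decays g" "\<forall>\<^sub>F k in sequentially. norm (f k) \<le> c"
  shows "decays (\<lambda>k. f k * g k)"
  by (rule decays_dominated[OF assms(1), of _ c], rule eventually_mono[OF assms(2)])
     (simp add: norm_mult mult_right_mono)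

lemma decays_cmult:
  fixes f :: "nat \<Rightarrow> 'a::real_normed_field"
  shows "decays f \<Longrightarrow> decays (\<lambda>k. c * f k)"
  by (rule decays_mult_bounded[of _ _ "norm c"]) auto

lemma decays_tendsto_zero:
  assumes "decays f"
  shows "f \<longlonglongrightarrow> 0"
proof -
  obtain C r where r: "0 < r" "r < 1" and C: "\<forall>\<^sub>F k in sequentially. norm (f k) \<le> C * r ^ k"
    using assms unfolding decays_def by blast
  have "(\<lambda>k. C * r ^ k) \<longlonglongrightarrow> C * 0"
    using r by (intro tendsto_intros LIMSEQ_power_zero) auto
  then have "(\<lambda>k. norm (f k)) \<longlonglongrightarrow> 0"
    using tendsto_sandwich[OF _ C tendsto_const, of 0] by simp
  then show ?thesis by (simp add: tendsto_norm_zero_iff)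
qed

lemma decays_bound:
  assumes "decays f"
  obtains C r where "0 < C" "0 < r" "r < 1" "\<And>k. norm (f k) \<le> C * r ^ k"
proof -
  obtain C r where r: "0 < r" "r < 1" and C: "\<forall>\<^sub>F k in sequentially. norm (f k) \<le> C * r ^ k"
    using assms unfolding decays_def by blast
  obtain K where K: "\<And>k. k \<ge> K \<Longrightarrow> norm (f k) \<le> C * r ^ k"
    using C unfolding eventually_sequentially by blast
  define D where "D = 1 + \<bar>C\<bar> + (\<Sum>k<K. norm (f k) / r ^ k)"
  have "norm (f k) \<le> D * r ^ k" for k
  proof (cases "k < K")
    case True
    have "norm (f k) / r ^ k \<le> (\<Sum>k<K. norm (f k) / r ^ k)"
      using True r by (intro member_le_sum) auto
    then have "norm (f k) / r ^ k \<le> D" by (simp add: D_def)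
    then show ?thesis using r by (simp add: field_simps)
  next
    case False
    have "norm (f k) \<le> C * r ^ k" using K False by simp
    also have "\<dots> \<le> D * r ^ k"
    proof (rule mult_right_mono)
      have "0 \<le> (\<Sum>k<K. norm (f k) / r ^ k)" using r by (intro sum_nonneg) auto
      then show "C \<le> D" unfolding D_def by linarith
    qed (use r in simp)
    finally show ?thesis .
  qed
  moreover have "0 < D"
  proof -
    have "0 \<le> (\<Sum>k<K. norm (f k) / r ^ k)" using r by (intro sum_nonneg) auto
    then show ?thesis unfolding D_def by linarith
  qed
  ultimately show ?thesis using that r by blast
qed

lemma decays_inverse_two_power: "decays (\<lambda>k. 1 / 2 ^ k :: real)"
  unfolding decays_def
  by (rule exI[of _ 1], rule exI[of _ "1/2"]) (simp add: power_one_over)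

text \<open>Squaring makes the decay doubly exponential, but the weaker geometric rate is all that is kept.\<close>

lemma decays_power_two_power:
  assumes "0 < r" "r < 1"
  shows "decays (\<lambda>k. r ^ (2 ^ k) :: real)"
  unfolding decays_def
  using assms by (intro exI[of _ 1] exI[of _ r])
    (auto intro!: always_eventually power_decreasing simp: less_exp less_imp_le)

section \<open>Inverses along a convergent sequence of matrices\<close>

lemma det_tendsto:
  fixes M :: "nat \<Rightarrow> complex mat"
  assumes M: "\<And>k. M k \<in> carrier_mat n n" and L: "L \<in> carrier_mat n n"
    and lim: "\<And>i j. i < n \<Longrightarrow> j < n \<Longrightarrow> (\<lambda>k. M k $$ (i, j)) \<longlonglongrightarrow> L $$ (i, j)"
  shows "(\<lambda>k. det (M k)) \<longlonglongrightarrow> det L"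
  unfolding det_def'[OF M] det_def'[OF L]
  by (intro tendsto_sum tendsto_mult tendsto_const tendsto_prod lim)
     (auto dest: permutes_in_image)

text \<open>Cramer's rule: determinant and adjugate are polynomials in the entries, so the inverses converge entrywise
  to the inverse of \<open>L\<close>, and in particular they stay bounded.\<close>

lemma inverse_of_converging:
  fixes M :: "nat \<Rightarrow> complex mat"
  assumes M: "\<And>k. M k \<in> carrier_mat n n" and L: "L \<in> carrier_mat n n"
    and lim: "\<And>i j. i < n \<Longrightarrow> j < n \<Longrightarrow> (\<lambda>k. M k $$ (i, j)) \<longlonglongrightarrow> L $$ (i, j)"
    and nz: "det L \<noteq> 0"
  obtains K c where "\<And>k. K k \<in> carrier_mat n n"
    "\<forall>\<^sub>F k in sequentially. M k * K k = 1\<^sub>m n \<and> K k * M k = 1\<^sub>m n"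
    "\<forall>\<^sub>F k in sequentially. \<forall>i<n. \<forall>j<n. cmod (K k $$ (i, j)) \<le> c"
proof -
  define K where "K k = (1 / det (M k)) \<cdot>\<^sub>m adj_mat (M k)" for k
  define c where "c = (\<Sum>i<n. \<Sum>j<n. cmod ((1 / det L \<cdot>\<^sub>m adj_mat L) $$ (i, j)) + 1)"
  have dlim: "(\<lambda>k. det (M k)) \<longlonglongrightarrow> det L" by (rule det_tendsto[OF M L lim])
  have Kc: "K k \<in> carrier_mat n n" for k
    unfolding K_def using adj_mat(1)[OF M[of k]] by simp
  have "\<forall>\<^sub>F k in sequentially. det (M k) \<noteq> 0"
    using dlim nz by (rule tendsto_imp_eventually_ne)
  then have inv: "\<forall>\<^sub>F k in sequentially. M k * K k = 1\<^sub>m n \<and> K k * M k = 1\<^sub>m n"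
  proof eventually_elim
    case (elim k)
    note adj = adj_mat[OF M[of k]]
    have "M k * K k = (1 / det (M k)) \<cdot>\<^sub>m (M k * adj_mat (M k))"
      unfolding K_def by (rule mult_smult_distrib[OF M adj(1)])
    moreover have "K k * M k = (1 / det (M k)) \<cdot>\<^sub>m (adj_mat (M k) * M k)"
      unfolding K_def by (rule mult_smult_assoc_mat[OF adj(1) M])
    ultimately show ?case using elim adj by (auto intro!: eq_matI)
  qed
  have adjlim: "(\<lambda>k. adj_mat (M k) $$ (i, j)) \<longlonglongrightarrow> adj_mat L $$ (i, j)" if ij: "i < n" "j < n" for i j
  proof -
    have d: "dim_row (M k) = n" "dim_col (M k) = n" "dim_row L = n" "dim_col L = n" for k
      using M[of k] L by auto
    have "(\<lambda>k. det (mat_delete (M k) j i)) \<longlonglongrightarrow> det (mat_delete L j i)"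
    proof (rule det_tendsto[where n = "n - 1"])
      fix i' j' assume "i' < n - 1" "j' < n - 1"
      then show "(\<lambda>k. mat_delete (M k) j i $$ (i', j')) \<longlonglongrightarrow> mat_delete L j i $$ (i', j')"
        unfolding mat_delete_def d by (auto intro!: lim)
    qed (auto simp: mat_delete_def d)
    then show ?thesis
      using ij by (auto simp: adj_mat_def d cofactor_def intro!: tendsto_intros)
  qed
  have "\<forall>\<^sub>F k in sequentially. cmod (K k $$ (i, j)) \<le> c" if ij: "i < n" "j < n" for i j
  proof -
    have "(\<lambda>k. cmod (1 / det (M k) * adj_mat (M k) $$ (i, j)))
        \<longlonglongrightarrow> cmod (1 / det L * adj_mat L $$ (i, j))"
      using nz by (intro tendsto_intros dlim adjlim ij)
    from order_tendstoD(2)[OF this, of "cmod (1 / det L * adj_mat L $$ (i, j)) + 1"]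
    have ev: "\<forall>\<^sub>F k in sequentially. cmod (1 / det (M k) * adj_mat (M k) $$ (i, j))
        < cmod (1 / det L * adj_mat L $$ (i, j)) + 1" by simp
    let ?g = "\<lambda>i j. cmod ((1 / det L \<cdot>\<^sub>m adj_mat L) $$ (i, j)) + 1"
    have "?g i j \<le> (\<Sum>j<n. ?g i j)" using ij by (intro member_le_sum) auto
    also have "\<dots> \<le> c" unfolding c_def
      using ij by (intro member_le_sum[of i "{..<n}" "\<lambda>i. \<Sum>j<n. ?g i j"]) (simp, rule sum_nonneg, simp, simp)
    finally have le: "?g i j \<le> c" .
    have Mk: "K k $$ (i, j) = 1 / det (M k) * adj_mat (M k) $$ (i, j)" for k
      unfolding K_def using adj_mat(1)[OF M[of k]] ij by simp
    have gL: "(1 / det L \<cdot>\<^sub>m adj_mat L) $$ (i, j) = 1 / det L * adj_mat L $$ (i, j)"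
      using adj_mat(1)[OF L] ij by simp
    show ?thesis unfolding Mk using ev by eventually_elim (use le[unfolded gL] in linarith)
  qed
  then have "\<forall>\<^sub>F k in sequentially. \<forall>i\<in>{..<n}. \<forall>j\<in>{..<n}. cmod (K k $$ (i, j)) \<le> c"
    by (intro eventually_ball_finite ballI) auto
  then have "\<forall>\<^sub>F k in sequentially. \<forall>i<n. \<forall>j<n. cmod (K k $$ (i, j)) \<le> c"
    by (rule eventually_mono) auto
  with Kc inv that show thesis by blast
qed

section \<open>The Toeplitz matrix of inverse factorials\<close>

text \<open>A kernel vector is the coefficient vector of a polynomial \<open>V\<close> of degree less than \<open>p\<close> for which the coefficients
  \<open>p, ..., 2p - 1\<close> of \<open>e^x V\<close> vanish. Taking \<open>p\<close> derivatives, \<open>e^x (1 + D)^p V\<close> vanishes to order \<open>p\<close>. Hence so does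
  the polynomial \<open>(1 + D)^p V\<close>, whose degree is less than \<open>p\<close>, so it is zero. As \<open>1 + D\<close> is injective on polynomials,
  \<open>V = 0\<close>. This is the uniqueness of Pade approximants to the exponential function.\<close>

lemma inverse_factorial_toeplitz_nonsingular:
  "det (mat p p (\<lambda>(i, j). 1 / fact (p + j - i)) :: complex mat) \<noteq> 0"
proof
  let ?M = "mat p p (\<lambda>(i, j). 1 / fact (p + j - i)) :: complex mat"
  assume "det ?M = 0"
  then obtain v where v: "v \<in> carrier_vec p" "v \<noteq> 0\<^sub>v p" "?M *\<^sub>v v = 0\<^sub>v p"
    using det_0_iff_vec_prod_zero_field[of ?M p] by auto
  \<comment> \<open>The order of the entries is reversed, so that the matrix-vector product becomes a convolution with the
      coefficients of the exponential series.\<close>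
  define V where "V = poly_of_list (map (\<lambda>a. v $ (p - 1 - a)) [0..<p])"
  have cV: "coeff V a = (if a < p then v $ (p - 1 - a) else 0)" for a
    by (simp add: V_def nth_default_def)
  define g where "g = fps_exp 1 * fps_of_poly V"
  have g0: "fps_nth g m = 0" if m: "p \<le> m" "m < 2 * p" for m
  proof -
    define i where "i = 2 * p - 1 - m"
    have i: "i < p" "m = 2 * p - 1 - i" using m by (auto simp: i_def)
    have "fps_nth g m = (\<Sum>a = 0..m. fps_nth (fps_of_poly V) a * fps_nth (fps_exp 1) (m - a))"
      unfolding g_def by (subst mult.commute) (simp add: fps_mult_nth)
    also have "\<dots> = (\<Sum>a<p. v $ (p - 1 - a) * (1 / fact (m - a)))"
      using m by (intro sum.mono_neutral_cong_right) (auto simp: cV)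
    also have "\<dots> = (\<Sum>j<p. v $ j * (1 / fact (p + j - i)))"
    proof (rule sum.reindex_bij_witness[of _ "\<lambda>j. p - 1 - j" "\<lambda>j. p - 1 - j"])
      fix a assume "a \<in> {..<p}"
      then have "m - a = p + (p - 1 - a) - i" using i by auto
      then show "v $ (p - 1 - a) * (1 / fact (p + (p - 1 - a) - i)) = v $ (p - 1 - a) * (1 / fact (m - a))"
        by simp
    qed auto
    also have "\<dots> = (?M *\<^sub>v v) $ i"
      using i v(1) by (auto simp: scalar_prod_def lessThan_atLeast0 intro!: sum.cong)
    finally show ?thesis using i v(3) by simp
  qed
  \<comment> \<open>Differentiating \<open>e^x q\<close> yields \<open>e^x (q + q')\<close>.\<close>
  define D where "D q = q + pderiv q" for q :: "complex poly"
  have deriv: "(fps_deriv ^^ m) g = fps_exp 1 * fps_of_poly ((D ^^ m) V)" for m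
    by (induction m) (simp_all add: g_def D_def fps_of_poly_add fps_of_poly_pderiv algebra_simps)
  have shift: "fps_nth ((fps_deriv ^^ m) g) a = 0" if "p \<le> a + m" "a + m < 2 * p" for m a
    using that by (induction m arbitrary: a) (simp_all add: g0)
  have Ddeg: "degree ((D ^^ m) V) \<le> degree V" for m
    by (induction m) (auto simp: D_def intro!: degree_add_le order_trans[OF degree_pderiv_le])
  have Dinj: "q = 0" if "D q = 0" for q
  proof (rule ccontr)
    assume "q \<noteq> 0"
    then have "coeff q (degree q) \<noteq> 0" by simp
    moreover have "coeff (pderiv q) (degree q) = 0" by (simp add: coeff_pderiv coeff_eq_0)
    ultimately have "coeff (D q) (degree q) \<noteq> 0" by (simp add: D_def)
    with that show False by simp
  qed
  have Diter: "(D ^^ m) q = 0 \<Longrightarrow> q = 0" for m q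
    by (induction m) (auto dest: Dinj)
  have w: "fps_of_poly ((D ^^ p) V) = fps_exp (-1) * (fps_deriv ^^ p) g"
  proof -
    have "fps_exp (-1) * fps_exp 1 = (1 :: complex fps)"
      using fps_exp_add_mult[of "-1" "1 :: complex"] by simp
    then show ?thesis by (simp add: deriv mult.assoc[symmetric])
  qed
  have "coeff ((D ^^ p) V) a = 0" for a
  proof (cases "a < p")
    case True
    have "fps_nth (fps_of_poly ((D ^^ p) V)) a = 0"
      unfolding w fps_mult_nth using True by (auto intro!: sum.neutral shift)
    then show ?thesis by simp
  next
    case False
    have "degree V \<le> p - 1" by (intro degree_le) (auto simp: cV)
    with Ddeg[of p] False v have "degree ((D ^^ p) V) < a \<or> p = 0" by linarith
    moreover have "p \<noteq> 0" using v by auto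
    ultimately show ?thesis by (simp add: coeff_eq_0)
  qed
  then have "(D ^^ p) V = 0" by (simp add: poly_eq_iff)
  then have "V = 0" by (rule Diter)
  have "v $ i = 0" if "i < p" for i
    using cV[of "p - 1 - i"] that \<open>V = 0\<close> by simp
  with v show False by (auto intro: eq_vecI)
qed

text \<open>The entries of the powers of a Jordan block are binomial coefficients; this is their scaled limit.\<close>

lemma choose_div_power_tendsto: "(\<lambda>N. real (N choose m) / real N ^ m) \<longlonglongrightarrow> 1 / fact m"
proof (induction m)
  case 0
  then show ?case by simp
next
  case (Suc m)
  have quot: "(\<lambda>N. 1 - real m / real N) \<longlonglongrightarrow> 1 - 0"
    by (intro tendsto_intros lim_const_over_n)
  have "(\<lambda>N. (real (N choose m) / real N ^ m) * (1 - real m / real N) / real (Suc m))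
      \<longlonglongrightarrow> 1 / fact m * (1 - 0) / real (Suc m)"
    by (intro tendsto_intros Suc.IH quot) simp
  moreover have "\<forall>\<^sub>F N in sequentially. (real (N choose m) / real N ^ m) * (1 - real m / real N) / real (Suc m)
      = real (N choose Suc m) / real N ^ Suc m"
    using eventually_gt_at_top[of m]
  proof eventually_elim
    case (elim N)
    have "Suc m * (N choose Suc m) = (N - m) * (N choose m)"
      by (simp only: binomial_absorb_comp binomial_absorption)
    then have "real (Suc m) * real (N choose Suc m) = (real N - real m) * real (N choose m)"
      using elim by (metis less_imp_le of_nat_diff of_nat_mult)
    then have "real (N choose Suc m) = (real N - real m) * real (N choose m) / real (Suc m)"
      by (simp add: field_simps del: binomial_Suc_Suc)
    moreover have "1 - real m / real N = (real N - real m) / real N"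
      using elim by (simp add: diff_divide_distrib)
    ultimately show ?case by (simp add: mult_ac)
  qed
  ultimately show ?case
    by (rule Lim_transform_eventually[THEN tendsto_eq_rhs]) (simp add: field_simps)
qed

section \<open>Vectors that are nearly annihilated by repeated squaring\<close>

text \<open>The vectors annihilated by \<open>T\<close> in the limit of repeated squaring. For \<open>T\<close> with eigenvalues on the unit circle it is
  essential that \<open>x k\<close> may differ from \<open>v\<close>: the powers of \<open>T\<close> applied to \<open>v\<close> itself need not even be bounded.\<close>

definition nearly_annihilated :: "complex mat \<Rightarrow> complex vec \<Rightarrow> bool" where
  "nearly_annihilated T v \<longleftrightarrow> (\<exists>x. (\<forall>k. x k \<in> carrier_vec (dim_vec v))
      \<and> (\<forall>i<dim_vec v. decays (\<lambda>k. x k $ i - v $ i))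
      \<and> (\<forall>i<dim_vec v. decays (\<lambda>k. (T ^\<^sub>m (2 ^ k) *\<^sub>v x k) $ i)))"

lemma decays_mult_vec:
  assumes U: "(U :: complex mat) \<in> carrier_mat nr nc" and i: "i < nr" and x: "\<And>k. x k \<in> carrier_vec nc"
    and dec: "\<And>j. j < nc \<Longrightarrow> decays (\<lambda>k. x k $ j)"
  shows "decays (\<lambda>k. (U *\<^sub>v x k) $ i)"
proof -
  have "(U *\<^sub>v x k) $ i = (\<Sum>j<nc. U $$ (i, j) * x k $ j)" for k
    using U i x[of k] by (auto simp: scalar_prod_def lessThan_atLeast0 intro!: sum.cong)
  moreover have "decays (\<lambda>k. \<Sum>j<nc. U $$ (i, j) * x k $ j)"
    by (intro decays_sum decays_cmult dec) auto
  ultimately show ?thesis by simp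
qed

lemma pow_mat_intertwine:
  assumes C: "C \<in> carrier_mat N N" and U: "U \<in> carrier_mat N c" and T: "T \<in> carrier_mat c c"
    and CU: "C * U = U * (T :: complex mat)"
  shows "C ^\<^sub>m k * U = U * T ^\<^sub>m k"
proof (induction k)
  case 0
  then show ?case using C U T by simp
next
  case (Suc k)
  have Ck: "C ^\<^sub>m k \<in> carrier_mat N N" and Tk: "T ^\<^sub>m k \<in> carrier_mat c c"
    using C T by auto
  have "C ^\<^sub>m Suc k * U = C ^\<^sub>m k * (C * U)"
    using assoc_mult_mat[OF Ck C U] by simp
  also have "\<dots> = C ^\<^sub>m k * U * T"
    unfolding CU using assoc_mult_mat[OF Ck U T] by simp
  also have "\<dots> = U * T ^\<^sub>m Suc k"
    unfolding Suc.IH using assoc_mult_mat[OF U Tk T] by simp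
  finally show ?case .
qed

text \<open>This transports the analysis of small model matrices (a stable matrix, a Jordan block) to an invariant subspace
  of a large matrix.\<close>

lemma nearly_annihilated_intertwine:
  assumes C: "C \<in> carrier_mat N N" and U: "U \<in> carrier_mat N c" and T: "T \<in> carrier_mat c c"
    and CU: "C * U = U * T" and v: "v \<in> carrier_vec c" and nearly_annihilated: "nearly_annihilated T v"
  shows "nearly_annihilated C (U *\<^sub>v v)"
proof -
  obtain x where x: "\<And>k. x k \<in> carrier_vec c" "\<And>i. i < c \<Longrightarrow> decays (\<lambda>k. x k $ i - v $ i)"
      "\<And>i. i < c \<Longrightarrow> decays (\<lambda>k. (T ^\<^sub>m (2 ^ k) *\<^sub>v x k) $ i)"
    using nearly_annihilated v unfolding nearly_annihilated_def by auto
  have Tk: "T ^\<^sub>m k \<in> carrier_mat c c" and Ck: "C ^\<^sub>m k \<in> carrier_mat N N" for k using C T by auto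
  have "decays (\<lambda>k. (U *\<^sub>v x k) $ i - (U *\<^sub>v v) $ i)" if i: "i < N" for i
  proof -
    have "(U *\<^sub>v x k) $ i - (U *\<^sub>v v) $ i = (U *\<^sub>v (x k - v)) $ i" for k
      using mult_minus_distrib_mat_vec[OF U x(1) v, of k] U x(1)[of k] v i by simp
    moreover have "decays (\<lambda>k. (U *\<^sub>v (x k - v)) $ i)"
      using decays_mult_vec[OF U i, of "\<lambda>k. x k - v"] x v by auto
    ultimately show ?thesis by simp
  qed
  moreover have "decays (\<lambda>k. (C ^\<^sub>m (2 ^ k) *\<^sub>v (U *\<^sub>v x k)) $ i)" if i: "i < N" for i
  proof -
    have "C ^\<^sub>m m *\<^sub>v (U *\<^sub>v x k) = U *\<^sub>v (T ^\<^sub>m m *\<^sub>v x k)" for k m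
      using assoc_mult_mat_vec[OF Ck U x(1)] assoc_mult_mat_vec[OF U Tk x(1)]
        pow_mat_intertwine[OF C U T CU] by metis
    moreover have "decays (\<lambda>k. (U *\<^sub>v (T ^\<^sub>m (2 ^ k) *\<^sub>v x k)) $ i)"
      using decays_mult_vec[OF U i, of "\<lambda>k. T ^\<^sub>m (2 ^ k) *\<^sub>v x k"]
        mult_mat_vec_carrier[OF Tk x(1)] x(3) by auto
    ultimately show ?thesis by simp
  qed
  ultimately show ?thesis
    unfolding nearly_annihilated_def using U x(1) by (intro exI[of _ "\<lambda>k. U *\<^sub>v x k"]) auto
qed

lemma pow_mat_smult:
  assumes A: "(A :: complex mat) \<in> carrier_mat n n"
  shows "(c \<cdot>\<^sub>m A) ^\<^sub>m k = c ^ k \<cdot>\<^sub>m A ^\<^sub>m k"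
proof (induction k)
  case (Suc k)
  have Ak: "A ^\<^sub>m k \<in> carrier_mat n n" using A by auto
  have "(c \<cdot>\<^sub>m A) ^\<^sub>m Suc k = c \<cdot>\<^sub>m (c ^ k \<cdot>\<^sub>m (A ^\<^sub>m k * A))"
    using Suc A Ak by (simp add: mult_smult_distrib[OF smult_carrier_mat[OF Ak] A] mult_smult_assoc_mat[OF Ak A])
  also have "\<dots> = c ^ Suc k \<cdot>\<^sub>m A ^\<^sub>m Suc k"
    using A by (intro eq_matI) (auto simp: mult_ac)
  finally show ?case .
qed (use A in auto)

text \<open>Powers of a matrix with spectral radius less than \<open>1\<close> are bounded. Applying this to \<open>T / r\<close>, with \<open>r\<close> strictly between the
  spectral radius of \<open>T\<close> and \<open>1\<close>, yields decay like \<open>r^m\<close> for the \<open>m\<close>-th power.\<close>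

lemma pow_mat_decays:
  assumes T: "T \<in> carrier_mat n n" and ev: "\<And>\<mu>. eigenvalue T \<mu> \<Longrightarrow> cmod \<mu> < 1"
    and ij: "i < n" "j < n"
  shows "decays (\<lambda>k. (T ^\<^sub>m (2 ^ k)) $$ (i, j))"
proof -
  define s where "s = spectral_radius T"
  note mm = spectral_radius_mem_max[OF T]
  have "0 < n" using ij by simp
  then have s: "0 \<le> s" "s < 1"
    using mm(1) ev unfolding s_def spectrum_def by auto
  have le_s: "cmod \<mu> \<le> s" if "eigenvalue T \<mu>" for \<mu>
    using mm(2)[OF \<open>0 < n\<close>] that unfolding s_def spectrum_def by auto
  \<comment> \<open>Any number strictly between the spectral radius and \<open>1\<close> would do.\<close>
  define r where "r = (1 + s) / 2"
  have r: "0 < r" "s < r" "r < 1" using s by (auto simp: r_def)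
  define T' where "T' = complex_of_real (1 / r) \<cdot>\<^sub>m T"
  have T': "T' \<in> carrier_mat n n" using T by (simp add: T'_def)
  have TT': "T = complex_of_real r \<cdot>\<^sub>m T'"
    using T r unfolding T'_def by (intro eq_matI) auto
  have "cmod \<mu> < 1" if ev': "eigenvalue T' \<mu>" for \<mu>
  proof -
    obtain v where v: "v \<in> carrier_vec n" "v \<noteq> 0\<^sub>v n" "T' *\<^sub>v v = \<mu> \<cdot>\<^sub>v v"
      using ev' T' unfolding eigenvalue_def eigenvector_def by auto
    have "T *\<^sub>v v = complex_of_real r \<cdot>\<^sub>v (T' *\<^sub>v v)"
      by (subst TT') (use T' v(1) in \<open>auto intro!: eq_vecI simp: scalar_prod_def sum_distrib_left mult_ac\<close>)
    then have "eigenvalue T (complex_of_real r * \<mu>)"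
      unfolding eigenvalue_def eigenvector_def using v T
      by (intro exI[of _ v]) (auto simp: smult_smult_assoc)
    from le_s[OF this] have "r * cmod \<mu> \<le> s" using r by (simp add: norm_mult)
    then have "r * cmod \<mu> < r * 1" using r by linarith
    then show ?thesis using r by (metis mult_less_cancel_left_pos)
  qed
  then have "spectral_radius T' < 1"
    using spectral_radius_mem_max(1)[OF T' \<open>0 < n\<close>] unfolding spectrum_def by auto
  from spectral_radius_jnf_norm_bound_less_1_upper_triangular[OF T' this]
  obtain c where c: "\<And>k. norm_bound (T' ^\<^sub>m k) c" by auto
  have "cmod ((T ^\<^sub>m m) $$ (i, j)) \<le> c * r ^ m" for m
  proof -
    have T'm: "T' ^\<^sub>m m \<in> carrier_mat n n" using T' by auto
    have "(T ^\<^sub>m m) $$ (i, j) = complex_of_real r ^ m * (T' ^\<^sub>m m) $$ (i, j)"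
      unfolding TT' pow_mat_smult[OF T'] using ij carrier_matD[OF T'm] by simp
    moreover have "cmod ((T' ^\<^sub>m m) $$ (i, j)) \<le> c"
      using c[of m] ij carrier_matD[OF T'm] unfolding norm_bound_def by auto
    ultimately show ?thesis using r by (simp add: norm_mult norm_power mult.commute)
  qed
  then show ?thesis
    using r by (intro decays_dominated[OF decays_power_two_power[of r], of _ c]) auto
qed

lemma stable_nearly_annihilated:
  assumes T: "T \<in> carrier_mat n n" and ev: "\<And>\<mu>. eigenvalue T \<mu> \<Longrightarrow> cmod \<mu> < 1"
    and v: "v \<in> carrier_vec n"
  shows "nearly_annihilated T v"
proof -
  have "decays (\<lambda>k. (T ^\<^sub>m (2 ^ k) *\<^sub>v v) $ i)" if i: "i < n" for i
  proof -
    have "(T ^\<^sub>m (2 ^ k) *\<^sub>v v) $ i = (\<Sum>j<n. v $ j * (T ^\<^sub>m (2 ^ k)) $$ (i, j))" for k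
      using T i v by (auto simp: scalar_prod_def lessThan_atLeast0 mult.commute intro!: sum.cong)
    moreover have "decays (\<lambda>k. \<Sum>j<n. v $ j * (T ^\<^sub>m (2 ^ k)) $$ (i, j))"
      by (intro decays_sum decays_cmult pow_mat_decays[OF T ev i]) auto
    ultimately show ?thesis by simp
  qed
  then show ?thesis using v unfolding nearly_annihilated_def by (intro exI[of _ "\<lambda>_. v"]) auto
qed

text \<open>Write \<open>\<lambda>\<close> for the eigenvalue \<open>ev\<close>. With \<open>N = 2^k\<close>, the entry \<open>(i, j)\<close> of \<open>J^N\<close> is \<open>(N choose (j - i)) \<lambda>^(N - j + i)\<close>, of order \<open>N^(j - i)\<close>. Write
  \<open>x = e\<^sub>t - (0, v)\<close> with \<open>v\<close> in the last \<open>p\<close> coordinates and require that the first \<open>p\<close> coordinates of \<open>J^N x\<close> vanish.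
  With \<open>\<mu> = \<lambda>/N\<close> and \<open>v\<^sub>j = \<mu>^(p + j - t) y\<^sub>j\<close>, all powers of \<open>N\<close> and \<open>\<lambda>\<close> cancel and the condition becomes a linear system
  for \<open>y\<close> whose matrix tends to the nonsingular matrix \<open>1/(p + j - i)!\<close>. So \<open>y\<close> is bounded. Since \<open>t < p\<close>, every
  coordinate of \<open>v\<close> carries at least one factor \<open>\<mu>\<close>, and so does every remaining coordinate of \<open>J^N x\<close>.\<close>

lemma jordan_block_nearly_annihilated:
  assumes ev: "cmod ev = 1" and t: "t < p"
  shows "nearly_annihilated (jordan_block (2 * p) ev) (unit_vec (2 * p) t)"
proof -
  define N :: "nat \<Rightarrow> nat" where "N k = 2 ^ k" for k
  \<comment> \<open>The scaled binomial coefficients, which tend to inverse factorials.\<close>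
  define b :: "nat \<Rightarrow> nat \<Rightarrow> complex" where "b k m = of_nat (N k choose m) / of_nat (N k) ^ m" for k m
  have N0: "of_nat (N k) \<noteq> (0::complex)" "real (N k) > 0" for k by (simp_all add: N_def)
  define M where "M k = mat p p (\<lambda>(i, j). b k (p + j - i))" for k
  define L :: "complex mat" where "L = mat p p (\<lambda>(i, j). 1 / fact (p + j - i))"
  have blim: "(\<lambda>k. b k m) \<longlonglongrightarrow> 1 / fact m" for m
  proof -
    have "filterlim N at_top sequentially"
      unfolding N_def by (intro filterlim_subseq strict_monoI) simp
    from tendsto_of_real[OF filterlim_compose[OF choose_div_power_tendsto this], where 'a = complex]
    show ?thesis by (simp add: b_def)
  qed
  have bbound: "cmod (b k m) \<le> 1" for k m
  proof -
    have "real (N k choose m) \<le> real (N k) ^ m"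
    proof (cases "m \<le> N k")
      case True
      then have "(N k choose m) \<le> N k ^ m" by (rule binomial_le_pow)
      then show ?thesis by (metis of_nat_le_iff of_nat_power)
    qed (simp add: binomial_eq_0)
    then show ?thesis using N0(2)[of k] by (simp add: b_def norm_divide norm_power)
  qed
  obtain K c where K: "\<And>k. K k \<in> carrier_mat p p"
    and MK: "\<forall>\<^sub>F k in sequentially. M k * K k = 1\<^sub>m p \<and> K k * M k = 1\<^sub>m p"
    and Kc: "\<forall>\<^sub>F k in sequentially. \<forall>i<p. \<forall>j<p. cmod (K k $$ (i, j)) \<le> c"
  proof (rule inverse_of_converging[of M p L])
    show "det L \<noteq> 0" unfolding L_def by (rule inverse_factorial_toeplitz_nonsingular)
  qed (auto simp: M_def L_def blim)
  \<comment> \<open>The scaled first \<open>p\<close> coordinates of \<open>J^N e\<^sub>t\<close>, to be cancelled.\<close>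
  define a where "a k = vec p (\<lambda>i. if i \<le> t then b k (t - i) else 0)" for k
  define y where "y k = K k *\<^sub>v a k" for k
  have y: "y k \<in> carrier_vec p" for k
    using mult_mat_vec_carrier[OF K[of k], of "a k"] by (simp add: y_def a_def)
  define c' where "c' = (\<Sum>j<p. c)"
  have ybound: "\<forall>\<^sub>F k in sequentially. \<forall>i<p. cmod (y k $ i) \<le> c'"
    using Kc
  proof (eventually_elim, intro allI impI)
    fix k i assume Kc: "\<forall>i<p. \<forall>j<p. cmod (K k $$ (i, j)) \<le> c" and i: "i < p"
    have "y k $ i = (\<Sum>j<p. K k $$ (i, j) * a k $ j)"
      using K[of k] i by (auto simp: y_def a_def scalar_prod_def lessThan_atLeast0 intro!: sum.cong)
    also have "cmod \<dots> \<le> (\<Sum>j<p. cmod (K k $$ (i, j) * a k $ j))" by (rule norm_sum)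
    also have "\<dots> \<le> c'" unfolding c'_def
    proof (rule sum_mono)
      fix j assume j: "j \<in> {..<p}"
      have "cmod (K k $$ (i, j)) * cmod (a k $ j) \<le> cmod (K k $$ (i, j)) * 1"
        using j bbound by (intro mult_left_mono) (auto simp: a_def)
      also have "\<dots> \<le> c" using Kc i j by simp
      finally show "cmod (K k $$ (i, j) * a k $ j) \<le> c" by (simp add: norm_mult)
    qed
    finally show "cmod (y k $ i) \<le> c'" .
  qed
  define \<mu> where "\<mu> k = ev / of_nat (N k)" for k
  have \<mu>: "cmod (\<mu> k) = 1 / 2 ^ k" for k
    using ev by (simp add: \<mu>_def norm_divide N_def norm_power)
  have ev0: "ev \<noteq> 0" using ev by auto
  define x where "x k = vec (2 * p) (\<lambda>i. if i < p then (if i = t then 1 else 0)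
      else - (\<mu> k ^ (i - t) * y k $ (i - p)))" for k
  have small: "decays (\<lambda>k. \<mu> k ^ Suc m * z k)" if "\<forall>\<^sub>F k in sequentially. cmod (z k) \<le> d" for m z d
  proof -
    have "\<forall>\<^sub>F k in sequentially. norm (\<mu> k ^ Suc m * z k) \<le> d * norm (1 / 2 ^ k :: real)"
      using that
    proof eventually_elim
      case (elim k)
      have "cmod (\<mu> k) ^ Suc m \<le> cmod (\<mu> k) ^ 1"
        by (rule power_decreasing) (auto simp: \<mu>)
      then have "cmod (\<mu> k ^ Suc m) * cmod (z k) \<le> (1 / 2 ^ k) * d"
        using elim by (intro mult_mono) (simp_all only: norm_power \<mu> power_one_right, simp_all)
      then show ?case by (simp add: norm_mult mult.commute)
    qed
    then show ?thesis by (rule decays_dominated[OF decays_inverse_two_power])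
  qed
  have "decays (\<lambda>k. x k $ i - unit_vec (2 * p) t $ i)" if i: "i < 2 * p" for i
  proof (cases "i < p")
    case True
    then show ?thesis using i by (simp add: x_def unit_vec_def)
  next
    case False
    have "x k $ i - unit_vec (2 * p) t $ i = - (\<mu> k ^ Suc (i - t - 1) * y k $ (i - p))" for k
      using i False t by (simp add: x_def Suc_diff_Suc del: power_Suc)
    moreover have "decays (\<lambda>k. \<mu> k ^ Suc (i - t - 1) * y k $ (i - p))"
      using ybound i False by (intro small[of _ c']) (auto elim!: eventually_mono)
    ultimately show ?thesis by simp
  qed
  moreover have "decays (\<lambda>k. (jordan_block (2 * p) ev ^\<^sub>m (2 ^ k) *\<^sub>v x k) $ i)" if i: "i < 2 * p" for i
  proof -
    define J where "J k j = (if i \<le> j then of_nat (N k choose (j - i)) * ev ^ (N k + i - j) else 0)"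
      for k j
    have expand: "(jordan_block (2 * p) ev ^\<^sub>m (2 ^ k) *\<^sub>v x k) $ i
        = J k t - (\<Sum>j<p. J k (p + j) * (\<mu> k ^ (p + j - t) * y k $ j))" for k
    proof -
      have "(jordan_block (2 * p) ev ^\<^sub>m (2 ^ k) *\<^sub>v x k) $ i = (\<Sum>j<2 * p. J k j * x k $ j)"
        unfolding jordan_block_pow using i
        by (auto simp: scalar_prod_def lessThan_atLeast0 J_def N_def x_def intro!: sum.cong)
      also have "{..<2 * p} = {..<p} \<union> {p..<2 * p}" by auto
      also have "(\<Sum>j\<in>{..<p} \<union> {p..<2 * p}. J k j * x k $ j)
          = (\<Sum>j<p. J k j * x k $ j) + (\<Sum>j\<in>{p..<2 * p}. J k j * x k $ j)"
        by (rule sum.union_disjoint) auto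
      also have "(\<Sum>j<p. J k j * x k $ j) = (\<Sum>j<p. if j = t then J k j else 0)"
        by (intro sum.cong) (auto simp: x_def)
      also have "\<dots> = J k t" using t by simp
      also have "(\<Sum>j\<in>{p..<2 * p}. J k j * x k $ j) = (\<Sum>j<p. J k (p + j) * x k $ (p + j))"
        by (rule sum.reindex_bij_witness[of _ "\<lambda>j. p + j" "\<lambda>j. j - p"]) auto
      also have "\<dots> = (\<Sum>j<p. - (J k (p + j) * (\<mu> k ^ (p + j - t) * y k $ j)))"
        by (intro sum.cong) (auto simp: x_def)
      finally show ?thesis by (simp add: sum_negf)
    qed
    \<comment> \<open>Also valid when the binomial coefficient is zero and the exponent on the left is truncated.\<close>
    have Jb: "J k j = ev ^ (N k) * (b k (j - i) * of_nat (N k) ^ (j - i) / ev ^ (j - i))" if "i \<le> j" for j k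
    proof (cases "j - i \<le> N k")
      case True
      then have "ev ^ (N k + i - j) * ev ^ (j - i) = ev ^ N k"
        using that by (simp add: power_add[symmetric])
      then have "ev ^ (N k + i - j) = ev ^ N k / ev ^ (j - i)" using ev0 by (simp add: field_simps)
      then show ?thesis using that N0(1)[of k] by (simp add: J_def b_def)
    next
      case False
      then show ?thesis by (simp add: J_def b_def binomial_eq_0)
    qed
    have \<mu>inv: "of_nat (N k) ^ m / ev ^ m = 1 / \<mu> k ^ m" for k m
      by (simp add: \<mu>_def power_divide)
    have Jb': "J k j = ev ^ (N k) * b k (j - i) / \<mu> k ^ (j - i)" if "i \<le> j" for j k
      unfolding Jb[OF that] times_divide_eq_right[of "b _ _", symmetric] \<mu>inv by simp
    have \<mu>0: "\<mu> k \<noteq> 0" for k using ev0 N0(1) by (simp add: \<mu>_def)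
    show ?thesis
    proof (cases "i < p")
      case True
      have "\<forall>\<^sub>F k in sequentially. (jordan_block (2 * p) ev ^\<^sub>m (2 ^ k) *\<^sub>v x k) $ i = 0"
        using MK
      proof eventually_elim
        case (elim k)
        have "M k *\<^sub>v y k = a k"
          using elim K[of k] assoc_mult_mat_vec[of "M k" p p "K k" p "a k"]
          by (simp add: y_def M_def a_def)
        moreover have "(M k *\<^sub>v y k) $ i = (\<Sum>j<p. b k (p + j - i) * y k $ j)"
          using True y[of k] by (auto simp: M_def scalar_prod_def lessThan_atLeast0 intro!: sum.cong)
        ultimately have sol: "(\<Sum>j<p. b k (p + j - i) * y k $ j) = (if i \<le> t then b k (t - i) else 0)"
          using True by (simp add: a_def)
        define s where "s = ev ^ N k * \<mu> k ^ i / \<mu> k ^ t"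
        have summand: "J k (p + j) * (\<mu> k ^ (p + j - t) * y k $ j) = s * (b k (p + j - i) * y k $ j)" for j
        proof -
          have "\<mu> k ^ (p + j - t) * \<mu> k ^ t = \<mu> k ^ (p + j - i) * \<mu> k ^ i"
            using True t by (simp add: power_add[symmetric])
          then show ?thesis
            using True \<mu>0[of k] by (simp add: Jb' s_def field_simps)
        qed
        have "J k t = s * (if i \<le> t then b k (t - i) else 0)"
        proof (cases "i \<le> t")
          case True
          then have "\<mu> k ^ t = \<mu> k ^ (t - i) * \<mu> k ^ i" by (simp add: power_add[symmetric])
          then show ?thesis using True \<mu>0[of k] by (simp add: Jb' s_def field_simps)
        qed (simp add: J_def)
        then show ?case
          unfolding expand summand sum_distrib_left[symmetric] sol by simp
      qed
      then show ?thesis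
        by (intro decays_dominated[OF decays_zero, of _ 0]) (auto elim!: eventually_mono)
    next
      case False
      have "decays (\<lambda>k. J k (p + j) * (\<mu> k ^ (p + j - t) * y k $ j))" if j: "j < p" for j
      proof (cases "i \<le> p + j")
        case True
        have "J k (p + j) * (\<mu> k ^ (p + j - t) * y k $ j)
            = \<mu> k ^ Suc (i - t - 1) * (ev ^ N k * b k (p + j - i) * y k $ j)" for k
        proof -
          have "p + j - t = (p + j - i) + Suc (i - t - 1)" using True False t by simp
          then have "\<mu> k ^ (p + j - t) = \<mu> k ^ (p + j - i) * \<mu> k ^ Suc (i - t - 1)"
            by (simp only: power_add)
          then show ?thesis using True \<mu>0[of k] by (simp add: Jb' del: power_Suc)
        qed
        moreover have "decays (\<lambda>k. \<mu> k ^ Suc (i - t - 1) * (ev ^ N k * b k (p + j - i) * y k $ j))"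
        proof (rule small)
          show "\<forall>\<^sub>F k in sequentially. cmod (ev ^ N k * b k (p + j - i) * y k $ j) \<le> c'"
            using ybound
          proof eventually_elim
            case (elim k)
            have "cmod (b k (p + j - i)) * cmod (y k $ j) \<le> 1 * c'"
              using elim j bbound by (intro mult_mono) auto
            then show ?case by (simp add: norm_mult norm_power ev)
          qed
        qed
        ultimately show ?thesis by (simp only:)
      qed (simp add: J_def)
      then have "decays (\<lambda>k. - (\<Sum>j<p. J k (p + j) * (\<mu> k ^ (p + j - t) * y k $ j)))"
        unfolding decays_minus_iff by (intro decays_sum) simp
      moreover have "J k t = 0" for k using False t by (simp add: J_def)
      ultimately show ?thesis unfolding expand by simp
    qed
  qed
  ultimately show ?thesis
    unfolding nearly_annihilated_def by (intro exI[of _ x]) (auto simp: x_def)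
qed

section \<open>Square matrices: inverses, conjugates and the ring laws\<close>

lemma minv_inverse:
  assumes A: "A \<in> carrier_mat n n" and inv: "invertible_mat A"
  shows "minv A \<in> carrier_mat n n" "A * minv A = 1\<^sub>m n" "minv A * A = 1\<^sub>m n"
proof -
  obtain B where B: "A * B = 1\<^sub>m (dim_row A)" "B * A = 1\<^sub>m (dim_row B)"
    using inv unfolding invertible_mat_def inverts_mat_def by blast
  have "dim_col B = n" using arg_cong[OF B(1), of dim_col] A by simp
  moreover have "dim_row B = n" using arg_cong[OF B(2), of dim_col] A by simp
  ultimately have "A \<in> Units (ring_mat TYPE(complex) n ())"
    using A B unfolding Units_def ring_mat_def by auto
  then obtain C where "mat_inverse A = Some C"
    using mat_inverse(1)[OF A, of "()"] by (cases "mat_inverse A") auto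
  with mat_inverse(2)[OF A this]
  show "minv A \<in> carrier_mat n n" "A * minv A = 1\<^sub>m n" "minv A * A = 1\<^sub>m n"
    by (auto simp: minv_def)
qed

lemma invertible_matI_det:
  assumes A: "(A :: complex mat) \<in> carrier_mat n n" and nz: "det A \<noteq> 0"
  shows "invertible_mat A"
proof -
  obtain B where B: "B \<in> carrier_mat n n" "B * A = 1\<^sub>m n" "A * B = 1\<^sub>m n"
    using det_non_zero_imp_unit[OF A nz, of "()"] unfolding Units_def ring_mat_def by auto
  then show ?thesis using A unfolding invertible_mat_def inverts_mat_def by auto
qed

lemma mat_inverse_unique:
  fixes A :: "complex mat"
  assumes A: "A \<in> carrier_mat n n" and B: "B \<in> carrier_mat n n" and C: "C \<in> carrier_mat n n"
    and "A * B = 1\<^sub>m n" "C * A = 1\<^sub>m n"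
  shows "B = C"
  using assoc_mult_mat[OF C A B] assms by simp

lemma mat_cnj_mult:
  "A \<in> carrier_mat nr n \<Longrightarrow> B \<in> carrier_mat n nc \<Longrightarrow> mat_cnj (A * B) = mat_cnj A * mat_cnj B"
  by (intro eq_matI) (auto simp: scalar_prod_def)

lemma mat_cnj_add:
  "A \<in> carrier_mat nr nc \<Longrightarrow> B \<in> carrier_mat nr nc \<Longrightarrow> mat_cnj (A + B) = mat_cnj A + mat_cnj B"
  by (intro eq_matI) auto

lemma mat_cnj_minus:
  "A \<in> carrier_mat nr nc \<Longrightarrow> B \<in> carrier_mat nr nc \<Longrightarrow> mat_cnj (A - B) = mat_cnj A - mat_cnj B"
  by (intro eq_matI) auto

lemma mat_cnj_one: "mat_cnj (1\<^sub>m n) = 1\<^sub>m n"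
  by (intro eq_matI) auto

lemma mat_cnj_smult_real: "mat_cnj (complex_of_real c \<cdot>\<^sub>m A) = complex_of_real c \<cdot>\<^sub>m mat_cnj A"
  by (intro eq_matI) auto

lemma mat_cnj_mat_cnj: "mat_cnj (mat_cnj A) = A"
  by (intro eq_matI) auto

lemma mat_cnj_transpose: "mat_cnj (A\<^sup>T) = (mat_cnj A)\<^sup>T"
  by (intro eq_matI) auto

lemma mat_adjoint_eq: "mat_adjoint A = (mat_cnj A)\<^sup>T"
  by (intro eq_matI) (auto simp: mat_adjoint_def mat_of_rows_def cols_def)

abbreviation (input) sq :: "nat \<Rightarrow> complex mat \<Rightarrow> bool" where
  "sq n A \<equiv> A \<in> carrier_mat n n"

lemma sq_carrier:
  "sq n A \<Longrightarrow> sq n B \<Longrightarrow> sq n (A * B)" "sq n A \<Longrightarrow> sq n B \<Longrightarrow> sq n (A + B)"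
  "sq n A \<Longrightarrow> sq n (- A)" "sq n A \<Longrightarrow> sq n B \<Longrightarrow> sq n (A - B)" "sq n A \<Longrightarrow> sq n (c \<cdot>\<^sub>m A)"
  "sq n (1\<^sub>m n)" "sq n (0\<^sub>m n n)" "sq n A \<Longrightarrow> sq n (mat_cnj A)" "sq n A \<Longrightarrow> sq n (A\<^sup>T)"
  by auto

text \<open>All side conditions mention one fixed size. Instantiated with this size, these equations let the simplifier normalise
  expressions in the ring of square matrices.\<close>

lemma sq_ring:
  "sq n A \<Longrightarrow> sq n B \<Longrightarrow> sq n C \<Longrightarrow> (A * B) * C = A * (B * C)"
  "sq n A \<Longrightarrow> sq n B \<Longrightarrow> sq n C \<Longrightarrow> (A + B) * C = A * C + B * C"
  "sq n A \<Longrightarrow> sq n B \<Longrightarrow> sq n C \<Longrightarrow> A * (B + C) = A * B + A * C"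
  "sq n A \<Longrightarrow> sq n B \<Longrightarrow> (A + B) = B + A"
  "sq n A \<Longrightarrow> sq n B \<Longrightarrow> sq n C \<Longrightarrow> (A + B) + C = A + (B + C)"
  "sq n A \<Longrightarrow> sq n B \<Longrightarrow> sq n C \<Longrightarrow> B + (A + C) = A + (B + C)"
  "sq n A \<Longrightarrow> sq n B \<Longrightarrow> A - B = A + (- B)"
  "sq n A \<Longrightarrow> sq n B \<Longrightarrow> - A * B = - (A * B)"
  "sq n A \<Longrightarrow> sq n B \<Longrightarrow> A * (- B) = - (A * B)"
  "sq n A \<Longrightarrow> sq n B \<Longrightarrow> - (A + B) = - A + - B"
  "sq n A \<Longrightarrow> - (- A) = A"
  "sq n A \<Longrightarrow> A + - A = 0\<^sub>m n n"
  "sq n A \<Longrightarrow> - A + A = 0\<^sub>m n n"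
  "sq n A \<Longrightarrow> sq n B \<Longrightarrow> A + (- A + B) = B"
  "sq n A \<Longrightarrow> sq n B \<Longrightarrow> - A + (A + B) = B"
  "sq n A \<Longrightarrow> A + 0\<^sub>m n n = A"
  "sq n A \<Longrightarrow> 0\<^sub>m n n + A = A"
  "sq n A \<Longrightarrow> 1\<^sub>m n * A = A"
  "sq n A \<Longrightarrow> A * 1\<^sub>m n = A"
  "sq n A \<Longrightarrow> sq n B \<Longrightarrow> (c \<cdot>\<^sub>m A) * B = c \<cdot>\<^sub>m (A * B)"
  "sq n A \<Longrightarrow> sq n B \<Longrightarrow> A * (c \<cdot>\<^sub>m B) = c \<cdot>\<^sub>m (A * B)"
  "sq n A \<Longrightarrow> sq n B \<Longrightarrow> c \<cdot>\<^sub>m (A + B) = c \<cdot>\<^sub>m A + c \<cdot>\<^sub>m B"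
  "sq n A \<Longrightarrow> c \<cdot>\<^sub>m (- A) = - (c \<cdot>\<^sub>m A)"
  by (auto simp: add_mult_distrib_mat[of _ n n] mult_add_distrib_mat[of _ n n]
      add_smult_distrib_left_mat intro!: eq_matI)

lemma sq_cnj:
  "sq n A \<Longrightarrow> sq n B \<Longrightarrow> mat_cnj (A * B) = mat_cnj A * mat_cnj B"
  "sq n A \<Longrightarrow> sq n B \<Longrightarrow> mat_cnj (A + B) = mat_cnj A + mat_cnj B"
  "sq n A \<Longrightarrow> sq n B \<Longrightarrow> mat_cnj (A - B) = mat_cnj A - mat_cnj B"
  "mat_cnj (1\<^sub>m n) = 1\<^sub>m n"
  by (simp_all only: mat_cnj_mult mat_cnj_add mat_cnj_minus mat_cnj_one)

lemma sq_transpose: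
  "sq n A \<Longrightarrow> sq n B \<Longrightarrow> (A * B)\<^sup>T = B\<^sup>T * A\<^sup>T"
  "sq n A \<Longrightarrow> sq n B \<Longrightarrow> (A + B)\<^sup>T = A\<^sup>T + B\<^sup>T"
  "sq n A \<Longrightarrow> sq n B \<Longrightarrow> (A - B)\<^sup>T = A\<^sup>T - B\<^sup>T"
  "(1\<^sub>m n :: complex mat)\<^sup>T = 1\<^sub>m n"
  "sq n A \<Longrightarrow> (c \<cdot>\<^sub>m A)\<^sup>T = c \<cdot>\<^sub>m A\<^sup>T"
  "sq n A \<Longrightarrow> (A\<^sup>T)\<^sup>T = A"
  by (auto intro!: transpose_mult eq_matI)

section \<open>The doubling step\<close>

text \<open>If \<open>K = (I - XY)\<^sup>-\<^sup>1\<close> and \<open>K' = (I - YX)\<^sup>-\<^sup>1\<close>, both identities follow from \<open>X (I - YX) = (I - XY) X\<close>. They carry all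
  the algebra of the iteration: with \<open>X = bar F\<close> and \<open>Y = F\<close>, the inverses of \<open>I - bar F F\<close> and \<open>I - F bar F\<close> are
  conjugates of each other.\<close>

lemma push_through:
  assumes X: "sq n X" and Y: "sq n Y" and K: "sq n K" and K': "sq n K'"
    and KI: "K * (1\<^sub>m n - X * Y) = 1\<^sub>m n" and K'I: "(1\<^sub>m n - Y * X) * K' = 1\<^sub>m n"
  shows "K * X = X * K'" and "K = 1\<^sub>m n + X * (K' * Y)"
proof -
  note [simp] = X Y K K'
  note sc = sq_carrier[where n = n] and sr = sq_ring[where n = n]
  have "K * X = K * (X * ((1\<^sub>m n - Y * X) * K'))" by (simp add: K'I sr)
  also have "\<dots> = K * ((1\<^sub>m n - X * Y) * (X * K'))" by (simp add: sc sr)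
  also have "\<dots> = X * K'" using sr(1)[of K "1\<^sub>m n - X * Y" "X * K'"] by (simp add: KI sc sr(18))
  finally show KX: "K * X = X * K'" .
  have "K = K * (1\<^sub>m n - X * Y) + K * X * Y"
    using sr(3)[of K "1\<^sub>m n" "- (X * Y)"] by (simp add: sc sr)
  then show "K = 1\<^sub>m n + X * (K' * Y)" unfolding KI KX by (simp add: sc sr)
qed

text \<open>The hypotheses are the relation for \<open>(E, F)\<close>, once for a step from \<open>U\<close> to \<open>V\<close> and once for a step from \<open>V\<close> to \<open>W\<close>;
  eliminating \<open>V\<close> gives the relation for the doubled pair and the step from \<open>U\<close> to \<open>W\<close>. The matrices \<open>Ec\<close>, \<open>Fc\<close>, \<open>Kc\<close>
  stand for the conjugates of \<open>E\<close>, \<open>F\<close>, \<open>K\<close>, but the elimination is pure ring algebra.\<close>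

lemma doubling_step:
  assumes c: "sq n E" "sq n F" "sq n Ec" "sq n Fc" "sq n K" "sq n Kc"
      "sq n U1" "sq n U2" "sq n V1" "sq n V2" "sq n W1" "sq n W2"
    and K: "K * (1\<^sub>m n - Fc * F) = 1\<^sub>m n" and K': "(1\<^sub>m n - Fc * F) * K = 1\<^sub>m n"
    and Kc: "Kc * (1\<^sub>m n - F * Fc) = 1\<^sub>m n" and Kc': "(1\<^sub>m n - F * Fc) * Kc = 1\<^sub>m n"
    and UV: "E * U1 = V1 + Fc * V2" "F * U1 + U2 = Ec * V2"
    and VW: "E * V1 = W1 + Fc * W2" "F * V1 + V2 = Ec * W2"
  shows "(E * K * E) * U1 = W1 + (Fc + E * Fc * Kc * Ec) * W2"
    and "(F + Ec * F * K * E) * U1 + U2 = (Ec * Kc * Ec) * W2"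
proof -
  note [simp] = c
  note sc = sq_carrier[where n = n] and sr = sq_ring[where n = n]
  have KF: "K * Fc = Fc * Kc" by (rule push_through(1)[of Fc n F K Kc]) (simp_all add: K Kc')
  have Kc1: "Kc = 1\<^sub>m n + F * (K * Fc)" by (rule push_through(2)[of F n Fc Kc K]) (simp_all add: Kc K')
  have V2: "V2 = Ec * W2 - F * V1" by (simp add: VW(2)[symmetric] sc sr)
  have "E * U1 = (1\<^sub>m n - Fc * F) * V1 + Fc * (Ec * W2)"
    unfolding UV(1) V2 by (simp add: sc sr)
  then have "K * (E * U1) = K * ((1\<^sub>m n - Fc * F) * V1 + Fc * (Ec * W2))" by simp
  also have "\<dots> = K * ((1\<^sub>m n - Fc * F) * V1) + (K * Fc) * (Ec * W2)"
    using sr(3)[of K "(1\<^sub>m n - Fc * F) * V1" "Fc * (Ec * W2)"] sr(1)[of K Fc "Ec * W2"]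
    by (simp add: sc)
  also have "K * ((1\<^sub>m n - Fc * F) * V1) = V1"
    using sr(1)[of K "1\<^sub>m n - Fc * F" V1] by (simp add: K sc sr(18))
  finally have KEU: "K * (E * U1) = V1 + (K * Fc) * (Ec * W2)" .
  have "(E * K * E) * U1 = E * (K * (E * U1))" by (simp add: sc sr)
  also have "\<dots> = E * V1 + E * (Fc * Kc * (Ec * W2))" unfolding KEU KF by (simp add: sc sr)
  also have "\<dots> = W1 + (Fc + E * Fc * Kc * Ec) * W2" unfolding VW(1) by (simp add: sc sr)
  finally show "(E * K * E) * U1 = W1 + (Fc + E * Fc * Kc * Ec) * W2" .
  have "(F + Ec * F * K * E) * U1 + U2 = (F * U1 + U2) + Ec * (F * (K * (E * U1)))"
    by (simp add: sc sr)
  also have "\<dots> = Ec * (V2 + F * V1 + F * (K * Fc * (Ec * W2)))"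
    unfolding UV(2) KEU by (simp add: sc sr)
  also have "V2 + F * V1 = Ec * W2" unfolding VW(2)[symmetric] by (simp add: sc sr)
  also have "Ec * (Ec * W2 + F * (K * Fc * (Ec * W2))) = Ec * ((1\<^sub>m n + F * (K * Fc)) * (Ec * W2))"
    by (simp add: sc sr)
  also have "\<dots> = (Ec * Kc * Ec) * W2" unfolding Kc1[symmetric] by (simp add: sc sr)
  finally show "(F + Ec * F * K * E) * U1 + U2 = (Ec * Kc * Ec) * W2" .
qed

section \<open>Stacked matrices and the Cayley transform\<close>

lemma minv_eqI:
  assumes "sq n A" "sq n B" "A * B = 1\<^sub>m n" "B * A = 1\<^sub>m n"
  shows "minv A = B"
proof -
  have "invertible_mat A"
    using assms unfolding invertible_mat_def inverts_mat_def by auto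
  from minv_inverse[OF assms(1) this] show ?thesis
    using mat_inverse_unique[OF assms(1) _ assms(2)] assms by auto
qed

lemma append_rows_index:
  assumes "A \<in> carrier_mat n c" "B \<in> carrier_mat n' c" "i < n + n'" "j < c"
  shows "(A @\<^sub>r B) $$ (i, j) = (if i < n then A $$ (i, j) else B $$ (i - n, j))"
  using assms by (auto simp: append_rows_def)

lemma append_rows_inject:
  assumes "U1 \<in> carrier_mat n c" "V1 \<in> carrier_mat n c" "U2 \<in> carrier_mat n' c" "V2 \<in> carrier_mat n' c"
    and eq: "U1 @\<^sub>r U2 = V1 @\<^sub>r V2"
  shows "U1 = V1" "U2 = V2"
proof -
  have ix: "(U1 @\<^sub>r U2) $$ (i, j) = (V1 @\<^sub>r V2) $$ (i, j)" for i j by (simp add: eq)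
  show "U1 = V1"
  proof (rule eq_matI)
    fix i j assume "i < dim_row V1" "j < dim_col V1"
    then show "U1 $$ (i, j) = V1 $$ (i, j)"
      using assms ix[of i j] append_rows_index[of U1 n c U2 n' i j] append_rows_index[of V1 n c V2 n' i j] by auto
  qed (use assms in auto)
  show "U2 = V2"
  proof (rule eq_matI)
    fix i j assume "i < dim_row V2" "j < dim_col V2"
    then show "U2 $$ (i, j) = V2 $$ (i, j)"
      using assms ix[of "n + i" j] append_rows_index[of U1 n c U2 n' "n + i" j]
        append_rows_index[of V1 n c V2 n' "n + i" j] by auto
  qed (use assms in auto)
qed

lemma append_rows_split:
  assumes "U \<in> carrier_mat (n + n') c"
  obtains U1 U2 where "U1 \<in> carrier_mat n c" "U2 \<in> carrier_mat n' c" "U = U1 @\<^sub>r U2"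
proof
  let ?U1 = "mat n c (\<lambda>(i, j). U $$ (i, j))" and ?U2 = "mat n' c (\<lambda>(i, j). U $$ (n + i, j))"
  show "U = ?U1 @\<^sub>r ?U2" using assms by (intro eq_matI) (auto simp: append_rows_def)
qed auto

lemma four_block_mult_append_rows:
  assumes "a \<in> carrier_mat n n" "b \<in> carrier_mat n n'" "c \<in> carrier_mat n' n" "d \<in> carrier_mat n' n'"
    and "U1 \<in> carrier_mat n m" "U2 \<in> carrier_mat n' m"
  shows "four_block_mat a b c d * (U1 @\<^sub>r U2) = (a * U1 + b * U2) @\<^sub>r (c * U1 + d * U2)"
proof -
  have *: "four_block_mat a b c d * four_block_mat U1 (0\<^sub>m n 0) U2 (0\<^sub>m n' 0)
      = four_block_mat (a * U1 + b * U2) (a * 0\<^sub>m n 0 + b * 0\<^sub>m n' 0)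
         (c * U1 + d * U2) (c * 0\<^sub>m n 0 + d * 0\<^sub>m n' 0)"
    by (rule mult_four_block_mat) (use assms in auto)
  have z: "a * 0\<^sub>m n 0 + b * 0\<^sub>m n' 0 = 0\<^sub>m n 0" "c * 0\<^sub>m n 0 + d * 0\<^sub>m n' 0 = 0\<^sub>m n' 0"
    using assms by (auto intro!: eq_matI)
  have d: "dim_row (a * U1 + b * U2) = n" "dim_row (c * U1 + d * U2) = n'" "dim_row U1 = n" "dim_row U2 = n'"
    using assms by auto
  show ?thesis unfolding append_rows_def d using *[unfolded z] by simp
qed

definition cayley :: "nat \<Rightarrow> real \<Rightarrow> complex mat \<Rightarrow> complex mat" where
  "cayley m \<alpha> M = (M + complex_of_real \<alpha> \<cdot>\<^sub>m 1\<^sub>m m) * minv (M - complex_of_real \<alpha> \<cdot>\<^sub>m 1\<^sub>m m)"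

text \<open>The coefficients of the iteration mix inverses of \<open>cI - M\<close> and of \<open>M - cI\<close>.\<close>

lemma invertible_shift_sign:
  assumes M: "M \<in> carrier_mat m m" and inv: "invertible_mat (c \<cdot>\<^sub>m 1\<^sub>m m - M)"
  shows "minv (M - c \<cdot>\<^sub>m 1\<^sub>m m) \<in> carrier_mat m m"
    "(M - c \<cdot>\<^sub>m 1\<^sub>m m) * minv (M - c \<cdot>\<^sub>m 1\<^sub>m m) = 1\<^sub>m m"
    "minv (M - c \<cdot>\<^sub>m 1\<^sub>m m) * (M - c \<cdot>\<^sub>m 1\<^sub>m m) = 1\<^sub>m m"
    "minv (c \<cdot>\<^sub>m 1\<^sub>m m - M) = - minv (M - c \<cdot>\<^sub>m 1\<^sub>m m)"
proof -
  note sc = sq_carrier[where n = m] and sr = sq_ring[where n = m]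
  let ?N = "minv (c \<cdot>\<^sub>m 1\<^sub>m m - M)"
  have car: "sq m (c \<cdot>\<^sub>m 1\<^sub>m m - M)" using M by auto
  note N = minv_inverse[OF car inv]
  have D: "M - c \<cdot>\<^sub>m 1\<^sub>m m = - (c \<cdot>\<^sub>m 1\<^sub>m m - M)" using M by (auto intro!: eq_matI)
  have 1: "(M - c \<cdot>\<^sub>m 1\<^sub>m m) * (- ?N) = 1\<^sub>m m" "(- ?N) * (M - c \<cdot>\<^sub>m 1\<^sub>m m) = 1\<^sub>m m"
    unfolding D using N sr(8)[OF car, of "- ?N"] sr(9)[OF car N(1)] sr(8)[of ?N "- (c \<cdot>\<^sub>m 1\<^sub>m m - M)"]
      sr(9)[OF N(1) car] sc(3)[OF car] sc(3)[OF N(1)] by auto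
  have "minv (M - c \<cdot>\<^sub>m 1\<^sub>m m) = - ?N"
    by (rule minv_eqI[OF _ _ 1]) (use M N in auto)
  then show "minv (M - c \<cdot>\<^sub>m 1\<^sub>m m) \<in> carrier_mat m m"
    "(M - c \<cdot>\<^sub>m 1\<^sub>m m) * minv (M - c \<cdot>\<^sub>m 1\<^sub>m m) = 1\<^sub>m m"
    "minv (M - c \<cdot>\<^sub>m 1\<^sub>m m) * (M - c \<cdot>\<^sub>m 1\<^sub>m m) = 1\<^sub>m m"
    "?N = - minv (M - c \<cdot>\<^sub>m 1\<^sub>m m)"
    using 1 N by auto
qed

section \<open>The relation between the doubling pair and the Cayley transform\<close>

text \<open>The identity \<open>[E, 0; F, I] = [I, bar F; 0, bar E] P\<close>, expressed by the action on stacked pairs of square matrices.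
  In this form it involves only \<open>n \<times> n\<close> matrices and never the blocks of \<open>P\<close>.\<close>

definition pencil_relation :: "nat \<Rightarrow> complex mat \<Rightarrow> complex mat \<Rightarrow> complex mat \<Rightarrow> bool" where
  "pencil_relation n P E F \<longleftrightarrow> (\<forall>U1 U2 V1 V2. sq n U1 \<longrightarrow> sq n U2 \<longrightarrow> sq n V1 \<longrightarrow> sq n V2 \<longrightarrow>
      P * (U1 @\<^sub>r U2) = V1 @\<^sub>r V2 \<longrightarrow>
      E * U1 = V1 + mat_cnj F * V2 \<and> F * U1 + U2 = mat_cnj E * V2)"

lemma pencil_relationD:
  assumes "pencil_relation n P E F" "sq n U1" "sq n U2" "sq n V1" "sq n V2"
    "P * (U1 @\<^sub>r U2) = V1 @\<^sub>r V2"
  shows "E * U1 = V1 + mat_cnj F * V2" "F * U1 + U2 = mat_cnj E * V2"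
  using assms unfolding pencil_relation_def by blast+

text \<open>Put \<open>D = A - \<alpha>I\<close> and \<open>s = 2\<alpha>\<close>. The relation for the Cayley transform amounts to four identities that express \<open>E D\<close>, \<open>E B\<close>,
  \<open>F B\<close>, \<open>F D\<close> by the conjugates of \<open>E\<close> and \<open>F\<close>. The first two are \<open>push_through\<close> for the inverse of
  \<open>bar R = I - D\<^sup>-\<^sup>1 B (bar D)\<^sup>-\<^sup>1 bar B\<close>, and the other two are their conjugates. The symmetries of \<open>E\<close> and \<open>F\<close> are again instances
  of \<open>push_through\<close>, because transposition sends \<open>D\<^sup>-\<^sup>1\<close> to its conjugate and fixes \<open>B\<close>.\<close>

lemma initial_pair:
  assumes A: "sq n A" and B: "sq n B" and At: "A\<^sup>T = mat_cnj A" and Bt: "B\<^sup>T = B"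
    and invA: "invertible_mat (complex_of_real \<alpha> \<cdot>\<^sub>m 1\<^sub>m n - A)"
    and invR: "invertible_mat (R_mat n A B \<alpha>)"
    and invH: "invertible_mat (complex_of_real \<alpha> \<cdot>\<^sub>m 1\<^sub>m (n + n) - H_mat A B)"
  shows "sq n (E_alpha n A B \<alpha>)" "sq n (F_alpha n A B \<alpha>)"
    "(E_alpha n A B \<alpha>)\<^sup>T = mat_cnj (E_alpha n A B \<alpha>)"
    "(F_alpha n A B \<alpha>)\<^sup>T = F_alpha n A B \<alpha>"
    "pencil_relation n (cayley (n + n) \<alpha> (H_mat A B)) (E_alpha n A B \<alpha>) (F_alpha n A B \<alpha>)"
proof -
  note sc = sq_carrier[where n = n] and sr = sq_ring[where n = n]
    and cn = sq_cnj[where n = n] mat_cnj_smult_real mat_cnj_mat_cnj and tr = sq_transpose[where n = n]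
  let ?a = "complex_of_real \<alpha>"
  define s where "s = complex_of_real (2 * \<alpha>)"
  define D where "D = A - ?a \<cdot>\<^sub>m 1\<^sub>m n"
  define P where "P = minv D"
  define Dc where "Dc = mat_cnj D"
  define Pc where "Pc = mat_cnj P"
  define Bc where "Bc = mat_cnj B"
  have [simp]: "sq n D" "sq n P" "sq n Dc" "sq n Pc" "sq n Bc" "sq n A" "sq n B"
    using invertible_shift_sign(1)[OF A invA] A B unfolding D_def P_def Dc_def Pc_def Bc_def by auto
  have DP: "D * P = 1\<^sub>m n" and PD: "P * D = 1\<^sub>m n"
    using invertible_shift_sign(2,3)[OF A invA] unfolding D_def P_def by auto
  have DPc: "Dc * Pc = 1\<^sub>m n" and PDc: "Pc * Dc = 1\<^sub>m n"
    unfolding Dc_def Pc_def using DP PD cn(1)[of D P] cn(1)[of P D] cn(4) by auto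
  have Dc: "mat_cnj A - ?a \<cdot>\<^sub>m 1\<^sub>m n = Dc"
    unfolding Dc_def D_def by (simp add: cn sc)
  have Pc: "minv Dc = Pc" by (rule minv_eqI[of _ n]) (simp_all add: DPc PDc)
  have "invertible_mat (?a \<cdot>\<^sub>m 1\<^sub>m n - mat_cnj A)"
  proof -
    have "?a \<cdot>\<^sub>m 1\<^sub>m n - mat_cnj A = - Dc" unfolding Dc[symmetric] using carrier_matD[OF A] by (auto intro!: eq_matI)
    moreover have "(- Dc) * (- Pc) = 1\<^sub>m n" "(- Pc) * (- Dc) = 1\<^sub>m n" by (simp_all add: sr sc DPc PDc)
    moreover have "sq n (- Dc)" "sq n (- Pc)" by (simp_all add: sc)
    ultimately show ?thesis unfolding invertible_mat_def inverts_mat_def by (metis carrier_matD square_mat.simps)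
  qed
  from invertible_shift_sign(4)[OF _ this] have Nc: "minv (?a \<cdot>\<^sub>m 1\<^sub>m n - mat_cnj A) = - Pc"
    unfolding Dc Pc by (simp add: sc)
  have N: "minv (?a \<cdot>\<^sub>m 1\<^sub>m n - A) = - P"
    using invertible_shift_sign(4)[OF A invA] unfolding P_def D_def .
  define R where "R = R_mat n A B \<alpha>"
  have R: "R = 1\<^sub>m n - (Pc * Bc) * (P * B)"
    unfolding R_def R_mat_def N Nc Bc_def[symmetric] by (simp add: sr sc)
  have [simp]: "sq n R" unfolding R by (simp add: sc)
  define K where "K = minv R"
  define Kc where "Kc = mat_cnj K"
  note minvR = minv_inverse[OF \<open>sq n R\<close> invR[folded R_def], folded K_def]
  have [simp]: "sq n K" "sq n Kc" unfolding Kc_def using minvR(1) by auto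
  have Rc: "mat_cnj R = 1\<^sub>m n - (P * B) * (Pc * Bc)"
    unfolding R Pc_def Bc_def by (simp add: sc cn)
  have KcR: "Kc * mat_cnj R = 1\<^sub>m n" and RKc: "mat_cnj R * Kc = 1\<^sub>m n"
    unfolding Kc_def using minvR(2,3) cn(1)[of R K] cn(1)[of K R] cn(4) by auto
  have mKc: "minv (mat_cnj R) = Kc" by (rule minv_eqI[of _ n]) (simp_all add: KcR RKc sc)
  define E where "E = E_alpha n A B \<alpha>"
  define F where "F = F_alpha n A B \<alpha>"
  have E: "E = 1\<^sub>m n + s \<cdot>\<^sub>m (Kc * P)"
    unfolding E_def E_alpha_def R_def[symmetric] mKc D_def[symmetric] P_def s_def ..
  have F: "F = - (s \<cdot>\<^sub>m (Pc * (Bc * (Kc * P))))"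
  proof -
    have "F = (- s) \<cdot>\<^sub>m (Pc * Bc * Kc * P)"
      unfolding F_def F_alpha_def R_def[symmetric] mKc D_def[symmetric] Dc Pc P_def Bc_def s_def by simp
    also have "\<dots> = - (s \<cdot>\<^sub>m (Pc * (Bc * (Kc * P))))" by (simp add: sr sc) (auto intro!: eq_matI)
    finally show ?thesis .
  qed
  have [simp]: "sq n E" "sq n F" unfolding E F by (simp_all add: sc)
  show "sq n (E_alpha n A B \<alpha>)" "sq n (F_alpha n A B \<alpha>)" using E_def F_def \<open>sq n E\<close> \<open>sq n F\<close> by auto
  have scnj: "mat_cnj (s \<cdot>\<^sub>m M) = s \<cdot>\<^sub>m mat_cnj M" for M unfolding s_def by (rule mat_cnj_smult_real)
  have KcK: "Kc * (P * B) = (P * B) * K" and Kc1: "Kc = 1\<^sub>m n + (P * B) * (K * (Pc * Bc))"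
    using push_through[of "P * B" n "Pc * Bc" Kc K] KcR[unfolded Rc] minvR(2)[unfolded R] by (simp_all add: sc)
  have cc: "mat_cnj Kc = K" "mat_cnj P = Pc" "mat_cnj Pc = P" "mat_cnj B = Bc" "mat_cnj Bc = B"
      "mat_cnj D = Dc" "mat_cnj Dc = D"
    unfolding Kc_def Pc_def Bc_def Dc_def by (simp_all add: cn)
  have Ec: "mat_cnj E = 1\<^sub>m n + s \<cdot>\<^sub>m (K * Pc)" unfolding E by (simp add: cn sc scnj cc)
  have ncnj: "mat_cnj (- M) = - mat_cnj M" for M by (auto intro!: eq_matI)
  have Fc: "mat_cnj F = - (s \<cdot>\<^sub>m (P * (B * (K * Pc))))" unfolding F by (simp add: cn sc scnj cc ncnj)
  have Dt: "D\<^sup>T = Dc" unfolding Dc_def D_def by (simp add: tr cn sc At)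
  have Bct: "Bc\<^sup>T = Bc" unfolding Bc_def using Bt mat_cnj_transpose[of B] by simp
  have Pt: "P\<^sup>T = Pc"
    by (rule mat_inverse_unique[of Dc n]) (use tr(1)[of D P] tr(1)[of P D] DP PDc Dt PD tr(4) in \<open>auto simp: sc\<close>)
  have Pct: "Pc\<^sup>T = P" using Pt tr(6)[of P] by simp
  have KctR: "Kc\<^sup>T * (1\<^sub>m n - Bc * (P * B * Pc)) = 1\<^sub>m n" "(1\<^sub>m n - Bc * (P * B * Pc)) * Kc\<^sup>T = 1\<^sub>m n"
  proof -
    have "(mat_cnj R)\<^sup>T = 1\<^sub>m n - Bc * (P * B * Pc)"
      unfolding Rc by (simp add: tr sc Pt Pct Bct Bt sr(1))
    then show "Kc\<^sup>T * (1\<^sub>m n - Bc * (P * B * Pc)) = 1\<^sub>m n" "(1\<^sub>m n - Bc * (P * B * Pc)) * Kc\<^sup>T = 1\<^sub>m n"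
      using tr(1)[of "mat_cnj R" Kc] tr(1)[of Kc "mat_cnj R"] KcR RKc tr(4) by (auto simp: sc)
  qed
  have "K * Pc = Pc * Kc\<^sup>T"
  proof (rule push_through(1)[of Pc n "Bc * (P * B)"])
    show "K * (1\<^sub>m n - Pc * (Bc * (P * B))) = 1\<^sub>m n" using minvR(3) unfolding R by (simp add: sr(1) sc)
    show "(1\<^sub>m n - Bc * (P * B) * Pc) * Kc\<^sup>T = 1\<^sub>m n" using KctR(2) by (simp add: sr(1) sc)
  qed (simp_all add: sc)
  then show "(E_alpha n A B \<alpha>)\<^sup>T = mat_cnj (E_alpha n A B \<alpha>)"
    unfolding E_def[symmetric] Ec unfolding E by (simp add: tr sc Pt)
  have "Kc\<^sup>T * Bc = Bc * Kc"
  proof (rule push_through(1)[of Bc n "P * B * Pc"])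
    show "(1\<^sub>m n - P * B * Pc * Bc) * Kc = 1\<^sub>m n" using RKc unfolding Rc by (simp add: sr(1) sc)
  qed (simp_all add: sc KctR)
  then have "Pc * (Kc\<^sup>T * Bc * P) = Pc * (Bc * (Kc * P))" by (simp add: sr(1) sc)
  moreover have ntr: "(- M)\<^sup>T = - M\<^sup>T" for M :: "complex mat" by (auto intro!: eq_matI)
  ultimately show "(F_alpha n A B \<alpha>)\<^sup>T = F_alpha n A B \<alpha>"
    unfolding F_def[symmetric] F by (simp add: tr sc Pt Pct Bct sr(1))
  have ED: "E * D = D + s \<cdot>\<^sub>m 1\<^sub>m n - mat_cnj F * Bc"
  proof -
    have "E * D = D + s \<cdot>\<^sub>m Kc" unfolding E by (simp add: sr sc PD)
    also have "\<dots> = D + s \<cdot>\<^sub>m 1\<^sub>m n - mat_cnj F * Bc"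
      by (subst Kc1) (simp add: Fc sr sc)
    finally show ?thesis .
  qed
  have EB: "E * B = B - mat_cnj F * Dc"
  proof -
    have "E * B = B + s \<cdot>\<^sub>m (Kc * (P * B))" unfolding E by (simp add: sr sc)
    also have "\<dots> = B - mat_cnj F * Dc" unfolding KcK Fc by (simp add: sr sc PDc)
    finally show ?thesis .
  qed
  have FB: "F * B = Dc + s \<cdot>\<^sub>m 1\<^sub>m n - mat_cnj E * Dc"
  proof -
    have "mat_cnj (E * D) = mat_cnj (D + s \<cdot>\<^sub>m 1\<^sub>m n - mat_cnj F * Bc)" by (simp only: ED)
    then have "mat_cnj E * Dc = Dc + s \<cdot>\<^sub>m 1\<^sub>m n - F * B" by (simp add: cn sc cc scnj)
    then show ?thesis by (simp add: sr sc)
  qed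
  have FD: "F * D = Bc - mat_cnj E * Bc"
  proof -
    have "mat_cnj (E * B) = mat_cnj (B - mat_cnj F * Dc)" by (simp only: EB)
    then have "mat_cnj E * Bc = Bc - F * D" by (simp add: cn sc cc)
    then show ?thesis by (simp add: sr sc)
  qed
  define H where "H = H_mat A B"
  have Hc: "H \<in> carrier_mat (n + n) (n + n)" unfolding H_def H_mat_def by (simp add: sc)
  have Hm: "H - ?a \<cdot>\<^sub>m 1\<^sub>m (n + n) = four_block_mat D B (- Bc) (- Dc - s \<cdot>\<^sub>m 1\<^sub>m n)"
    using carrier_matD[OF A] carrier_matD[OF B] unfolding H_def H_mat_def D_def Bc_def Dc_def s_def by (intro eq_matI) auto
  have Hp: "H + ?a \<cdot>\<^sub>m 1\<^sub>m (n + n) = four_block_mat (D + s \<cdot>\<^sub>m 1\<^sub>m n) B (- Bc) (- Dc)"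
    using carrier_matD[OF A] carrier_matD[OF B] unfolding H_def H_mat_def D_def Bc_def Dc_def s_def by (intro eq_matI) auto
  have shift: "H - ?a \<cdot>\<^sub>m 1\<^sub>m (n + n) \<in> carrier_mat (n + n) (n + n)"
      "H + ?a \<cdot>\<^sub>m 1\<^sub>m (n + n) \<in> carrier_mat (n + n) (n + n)"
    using Hc by auto
  note mH = invertible_shift_sign[OF Hc invH[folded H_def]]
  show "pencil_relation n (cayley (n + n) \<alpha> (H_mat A B)) (E_alpha n A B \<alpha>) (F_alpha n A B \<alpha>)"
    unfolding pencil_relation_def E_def[symmetric] F_def[symmetric] H_def[symmetric]
  proof (intro allI impI)
    fix U1 U2 V1 V2
    assume [simp]: "sq n U1" "sq n U2" "sq n V1" "sq n V2"
      and CU: "cayley (n + n) \<alpha> H * (U1 @\<^sub>r U2) = V1 @\<^sub>r V2"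
    let ?U = "U1 @\<^sub>r U2"
    have Uc: "?U \<in> carrier_mat (n + n) n" by auto
    define Y where "Y = minv (H - ?a \<cdot>\<^sub>m 1\<^sub>m (n + n)) * ?U"
    have Yc: "Y \<in> carrier_mat (n + n) n" unfolding Y_def using mH(1) Uc by (rule mult_carrier_mat)
    have U: "(H - ?a \<cdot>\<^sub>m 1\<^sub>m (n + n)) * Y = ?U"
      unfolding Y_def using assoc_mult_mat[OF shift(1) mH(1) Uc] mH(2) Uc by simp
    have V: "(H + ?a \<cdot>\<^sub>m 1\<^sub>m (n + n)) * Y = V1 @\<^sub>r V2"
      unfolding CU[symmetric] Y_def cayley_def
      using assoc_mult_mat[OF shift(2) mH(1) Uc] by simp
    obtain Y1 Y2 where [simp]: "sq n Y1" "sq n Y2" and Y: "Y = Y1 @\<^sub>r Y2"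
      using append_rows_split[OF Yc] by metis
    have "(D * Y1 + B * Y2) @\<^sub>r (- Bc * Y1 + (- Dc - s \<cdot>\<^sub>m 1\<^sub>m n) * Y2) = U1 @\<^sub>r U2"
      using U unfolding Y Hm by (subst (asm) four_block_mult_append_rows[of _ n _ n _ _ _ n]) (simp_all add: sc)
    from append_rows_inject[OF _ _ _ _ this, of n n n, symmetric]
    have U12: "U1 = D * Y1 + B * Y2" "U2 = - Bc * Y1 + (- Dc - s \<cdot>\<^sub>m 1\<^sub>m n) * Y2"
      by (simp_all add: sc)
    have "((D + s \<cdot>\<^sub>m 1\<^sub>m n) * Y1 + B * Y2) @\<^sub>r (- Bc * Y1 + (- Dc) * Y2) = V1 @\<^sub>r V2"
      using V unfolding Y Hp by (subst (asm) four_block_mult_append_rows[of _ n _ n _ _ _ n]) (simp_all add: sc)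
    from append_rows_inject[OF _ _ _ _ this, of n n n, symmetric]
    have V12: "V1 = (D + s \<cdot>\<^sub>m 1\<^sub>m n) * Y1 + B * Y2" "V2 = - Bc * Y1 + (- Dc) * Y2"
      by (simp_all add: sc)
    have "E * U1 = (E * D) * Y1 + (E * B) * Y2" unfolding U12 by (simp add: sr sc)
    also have "\<dots> = V1 + mat_cnj F * V2" unfolding ED EB V12 by (simp add: sr sc)
    finally have 1: "E * U1 = V1 + mat_cnj F * V2" .
    have "F * U1 + U2 = (F * D) * Y1 + (F * B) * Y2 + U2" unfolding U12(1) by (simp add: sr sc)
    also have "\<dots> = mat_cnj E * V2"
    proof -
      have cancel: "x + (y + (z + (- x + (- y + (- z + w))))) = w"
        if "sq n x" "sq n y" "sq n z" "sq n w" for x y z w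
        using that by (auto intro!: eq_matI)
      show ?thesis unfolding FD FB U12(2) V12(2) by (simp add: sr sc cancel)
    qed
    finally show "E * U1 = V1 + mat_cnj F * V2 \<and> F * U1 + U2 = mat_cnj E * V2" using 1 by blast
  qed
qed

text \<open>For symmetric \<open>F\<close>, the conjugate is the adjoint, so \<open>bar F F\<close> is the matrix whose eigenvalues are the squares of
  the singular values.\<close>

lemma nonsingular_of_one_not_singular_value:
  assumes F: "sq n F" and Ft: "F\<^sup>T = F" and sv: "1 \<notin> singular_values F"
  shows "det (1\<^sub>m n - mat_cnj F * F) \<noteq> 0"
proof
  have FF: "sq n (mat_cnj F * F)" using F by auto
  assume "det (1\<^sub>m n - mat_cnj F * F) = 0"
  then obtain v where v: "v \<in> carrier_vec n" "v \<noteq> 0\<^sub>v n" "(1\<^sub>m n - mat_cnj F * F) *\<^sub>v v = 0\<^sub>v n"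
    using det_0_iff_vec_prod_zero_field[of "1\<^sub>m n - mat_cnj F * F" n] minus_carrier_mat[OF FF] by auto
  have adj: "mat_adjoint F = mat_cnj F" unfolding mat_adjoint_eq mat_cnj_transpose[symmetric] Ft ..
  have "v - (mat_cnj F * F) *\<^sub>v v = 0\<^sub>v n"
    using v minus_mult_distrib_mat_vec[OF one_carrier_mat[of n] FF v(1)] by simp
  then have eq: "(mat_cnj F * F) *\<^sub>v v = v"
    using v(1) mult_mat_vec_carrier[OF FF v(1)]
    by (intro eq_vecI) (auto simp: vec_eq_iff)
  have "eigenvalue (mat_cnj F * F) 1"
    unfolding eigenvalue_def eigenvector_def using v eq F by (intro exI[of _ v]) auto
  with sv show False unfolding singular_values_def adj by simp
qed

lemma pow_mat_add:
  assumes C: "C \<in> carrier_mat m m"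
  shows "C ^\<^sub>m (a + b) = C ^\<^sub>m a * C ^\<^sub>m b"
proof (induction b)
  case 0
  have "C ^\<^sub>m a \<in> carrier_mat m m" using C by auto
  then show ?case using C by simp
next
  case (Suc b)
  have "C ^\<^sub>m a \<in> carrier_mat m m" "C ^\<^sub>m b \<in> carrier_mat m m" using C by auto
  from assoc_mult_mat[OF this C] show ?case using Suc by simp
qed

lemma pow_mat_two_power_Suc:
  assumes "C \<in> carrier_mat m m"
  shows "C ^\<^sub>m (2 ^ Suc k) = C ^\<^sub>m (2 ^ k) * C ^\<^sub>m (2 ^ k)"
  using pow_mat_add[OF assms, of "2 ^ k" "2 ^ k"] by (simp add: mult_2)

text \<open>The symmetries are part of the induction hypothesis: symmetry of \<open>F\<close> yields the invertibility that the next step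
  needs, and \<open>F\<close> stays symmetric because \<open>E\<close> is Hermitian.\<close>

lemma doubling_pair:
  assumes A: "sq n A" and B: "sq n B" and At: "A\<^sup>T = mat_cnj A" and Bt: "B\<^sup>T = B"
    and invA: "invertible_mat (complex_of_real \<alpha> \<cdot>\<^sub>m 1\<^sub>m n - A)"
    and invR: "invertible_mat (R_mat n A B \<alpha>)"
    and invH: "invertible_mat (complex_of_real \<alpha> \<cdot>\<^sub>m 1\<^sub>m (n + n) - H_mat A B)"
    and sv: "\<forall>k. 1 \<notin> singular_values (doubling_F n A B \<alpha> k)"
  shows "sq n (doubling_E n A B \<alpha> k) \<and> sq n (doubling_F n A B \<alpha> k)
    \<and> (doubling_E n A B \<alpha> k)\<^sup>T = mat_cnj (doubling_E n A B \<alpha> k)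
    \<and> (doubling_F n A B \<alpha> k)\<^sup>T = doubling_F n A B \<alpha> k
    \<and> pencil_relation n (cayley (n + n) \<alpha> (H_mat A B) ^\<^sub>m (2 ^ k))
        (doubling_E n A B \<alpha> k) (doubling_F n A B \<alpha> k)"
proof (induction k)
  let ?C = "cayley (n + n) \<alpha> (H_mat A B)"
  have Hc: "H_mat A B \<in> carrier_mat (n + n) (n + n)" unfolding H_mat_def using A by auto
  have Cc: "?C \<in> carrier_mat (n + n) (n + n)"
    using Hc invertible_shift_sign(1)[OF Hc invH] unfolding cayley_def by (intro mult_carrier_mat) auto
  {
    case 0
    then show ?case
      using initial_pair[OF A B At Bt invA invR invH] Cc by (simp add: doubling_E_def doubling_F_def)
  next
    case (Suc k)
    note sc = sq_carrier[where n = n] and sr = sq_ring[where n = n]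
      and cn = sq_cnj[where n = n] mat_cnj_mat_cnj and tr = sq_transpose[where n = n]
    define E where "E = doubling_E n A B \<alpha> k"
    define F where "F = doubling_F n A B \<alpha> k"
    define P where "P = ?C ^\<^sub>m (2 ^ k)"
    have E: "sq n E" and F: "sq n F" and Et: "E\<^sup>T = mat_cnj E" and Ft: "F\<^sup>T = F"
      and rel: "pencil_relation n P E F"
      using Suc unfolding E_def F_def P_def by auto
    define Ec where "Ec = mat_cnj E"
    define Fc where "Fc = mat_cnj F"
    have [simp]: "sq n E" "sq n F" "sq n Ec" "sq n Fc" using E F unfolding Ec_def Fc_def by auto
    define D where "D = 1\<^sub>m n - Fc * F"
    have [simp]: "sq n D" unfolding D_def by (simp add: sc)
    have "1 \<notin> singular_values F" using sv unfolding F_def by blast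
    then have "det D \<noteq> 0"
      using nonsingular_of_one_not_singular_value[OF F Ft] unfolding D_def Fc_def by blast
    note inv = minv_inverse[OF \<open>sq n D\<close> invertible_matI_det[OF \<open>sq n D\<close> this]]
    define K where "K = minv D"
    define Kc where "Kc = mat_cnj K"
    have [simp]: "sq n K" "sq n Kc" using inv(1) unfolding K_def Kc_def by auto
    have K: "K * (1\<^sub>m n - Fc * F) = 1\<^sub>m n" "(1\<^sub>m n - Fc * F) * K = 1\<^sub>m n"
      using inv(2,3) unfolding K_def D_def by auto
    have Dc: "mat_cnj D = 1\<^sub>m n - F * Fc" unfolding D_def Fc_def by (simp add: cn sc)
    have Kc: "Kc * (1\<^sub>m n - F * Fc) = 1\<^sub>m n" "(1\<^sub>m n - F * Fc) * Kc = 1\<^sub>m n"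
      using inv(2,3)[folded K_def] cn(1)[OF \<open>sq n D\<close> \<open>sq n K\<close>] cn(1)[OF \<open>sq n K\<close> \<open>sq n D\<close>] cn(4)
      unfolding Dc[symmetric] Kc_def by auto
    have Fct: "Fc\<^sup>T = Fc" unfolding Fc_def mat_cnj_transpose[symmetric] Ft ..
    have Ect: "Ec\<^sup>T = E" unfolding Ec_def Et[symmetric] by simp
    have Dt: "D\<^sup>T = 1\<^sub>m n - F * Fc" unfolding D_def by (simp add: tr sc Ft Fct)
    have Kt: "K\<^sup>T = Kc"
    proof (rule mat_inverse_unique[of "1\<^sub>m n - F * Fc" n])
      show "(1\<^sub>m n - F * Fc) * K\<^sup>T = 1\<^sub>m n"
        using tr(1)[OF \<open>sq n K\<close> \<open>sq n D\<close>] inv(3) tr(4) unfolding Dt[symmetric] K_def by simp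
    qed (simp_all add: sc Kc)
    have E': "doubling_E n A B \<alpha> (Suc k) = E * K * E"
      and F': "doubling_F n A B \<alpha> (Suc k) = F + Ec * F * K * E"
      unfolding doubling_E_def doubling_F_def E_def F_def Ec_def K_def D_def Fc_def
      by (simp_all add: Let_def split_beta)
    have FK: "Kc * F = F * K"
      by (rule push_through(1)[of F n Fc]) (simp_all add: K Kc)
    have Ec': "mat_cnj (E * K * E) = Ec * Kc * Ec"
      unfolding Ec_def Kc_def by (simp add: cn sc)
    have Fc': "mat_cnj (F + Ec * F * K * E) = Fc + E * Fc * Kc * Ec"
      unfolding Ec_def Kc_def Fc_def by (simp add: cn sc)
    have 1: "(E * K * E)\<^sup>T = mat_cnj (E * K * E)"
      unfolding Ec' by (simp add: tr sc Et[folded Ec_def] Kt sr(1))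
    have "(Ec * F * K * E)\<^sup>T = Ec * ((Kc * F) * E)"
      by (simp add: tr sc Et[folded Ec_def] Kt sr(1) Ft Ect)
    also have "\<dots> = Ec * F * K * E" unfolding FK by (simp add: sr(1) sc)
    finally have 2: "(F + Ec * F * K * E)\<^sup>T = F + Ec * F * K * E"
      by (simp add: tr(2) sc Ft)
    have Pc: "P \<in> carrier_mat (n + n) (n + n)" unfolding P_def using Cc by auto
    have 3: "pencil_relation n (?C ^\<^sub>m (2 ^ Suc k)) (E * K * E) (F + Ec * F * K * E)"
      unfolding pencil_relation_def pow_mat_two_power_Suc[OF Cc] P_def[symmetric]
    proof (intro allI impI)
      fix U1 U2 W1 W2
      assume [simp]: "sq n U1" "sq n U2" "sq n W1" "sq n W2"
        and PP: "P * P * (U1 @\<^sub>r U2) = W1 @\<^sub>r W2"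
      have Uc: "U1 @\<^sub>r U2 \<in> carrier_mat (n + n) n" by auto
      obtain V1 V2 where [simp]: "sq n V1" "sq n V2" and V: "P * (U1 @\<^sub>r U2) = V1 @\<^sub>r V2"
        using append_rows_split[OF mult_carrier_mat[OF Pc Uc]] by metis
      have W: "P * (V1 @\<^sub>r V2) = W1 @\<^sub>r W2"
        using PP assoc_mult_mat[OF Pc Pc Uc] V by simp
      note UV = pencil_relationD[OF rel _ _ _ _ V, folded Ec_def Fc_def, simplified]
      note VW = pencil_relationD[OF rel _ _ _ _ W, folded Ec_def Fc_def, simplified]
      show "E * K * E * U1 = W1 + mat_cnj (F + Ec * F * K * E) * W2
          \<and> (F + Ec * F * K * E) * U1 + U2 = mat_cnj (E * K * E) * W2"
        unfolding Ec' Fc'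
        by (intro conjI doubling_step[OF _ _ _ _ _ _ _ _ _ _ _ _ K Kc UV VW]) simp_all
    qed
    show ?case unfolding E' F' using 1 2 3 by (simp add: sc)
  }
qed

section \<open>From nearly annihilated columns to convergence\<close>

text \<open>A submultiplicative norm for which the passage from entries to matrices and back is immediate. It dominates the
  Frobenius norm.\<close>

definition entry_norm :: "complex mat \<Rightarrow> real" where
  "entry_norm M = (\<Sum>i<dim_row M. \<Sum>j<dim_col M. cmod (M $$ (i, j)))"

lemma entry_norm_nonneg: "0 \<le> entry_norm M"
  unfolding entry_norm_def by (intro sum_nonneg) auto

lemma entry_norm_add:
  assumes "M \<in> carrier_mat nr nc" "N \<in> carrier_mat nr nc"
  shows "entry_norm (M + N) \<le> entry_norm M + entry_norm N"
proof -
  have "entry_norm (M + N) = (\<Sum>i<nr. \<Sum>j<nc. cmod (M $$ (i, j) + N $$ (i, j)))"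
    using assms unfolding entry_norm_def by (auto intro!: sum.cong)
  also have "\<dots> \<le> (\<Sum>i<nr. \<Sum>j<nc. cmod (M $$ (i, j)) + cmod (N $$ (i, j)))"
    by (intro sum_mono norm_triangle_ineq)
  also have "\<dots> = entry_norm M + entry_norm N"
    using assms unfolding entry_norm_def sum.distrib by simp
  finally show ?thesis .
qed

lemma entry_norm_uminus: "entry_norm (- M) = entry_norm M"
  unfolding entry_norm_def by simp

lemma entry_norm_cnj: "entry_norm (mat_cnj M) = entry_norm M"
  unfolding entry_norm_def by simp

lemma entry_le_entry_norm:
  assumes "i < dim_row M" "j < dim_col M"
  shows "cmod (M $$ (i, j)) \<le> entry_norm M"
proof -
  have "cmod (M $$ (i, j)) \<le> (\<Sum>j<dim_col M. cmod (M $$ (i, j)))"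
    using assms by (intro member_le_sum) auto
  also have "\<dots> \<le> entry_norm M"
    unfolding entry_norm_def using assms
    by (intro member_le_sum[of i "{..<dim_row M}" "\<lambda>i. \<Sum>j<dim_col M. cmod (M $$ (i, j))"])
       (auto intro: sum_nonneg)
  finally show ?thesis .
qed

lemma entry_norm_mult:
  assumes M: "M \<in> carrier_mat nr n" and N: "N \<in> carrier_mat n nc"
  shows "entry_norm (M * N) \<le> entry_norm M * entry_norm N"
proof -
  let ?m = "\<lambda>i l. cmod (M $$ (i, l))" and ?n = "\<lambda>l j. cmod (N $$ (l, j))"
  have entry: "(M * N) $$ (i, j) = (\<Sum>l<n. M $$ (i, l) * N $$ (l, j))" if "i < nr" "j < nc" for i j
    using assms that by (auto simp: scalar_prod_def lessThan_atLeast0)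
  have "entry_norm (M * N) = (\<Sum>i<nr. \<Sum>j<nc. cmod (\<Sum>l<n. M $$ (i, l) * N $$ (l, j)))"
    using assms entry unfolding entry_norm_def by (auto intro!: sum.cong)
  also have "\<dots> \<le> (\<Sum>i<nr. \<Sum>j<nc. \<Sum>l<n. ?m i l * ?n l j)"
    by (intro sum_mono order_trans[OF norm_sum]) (simp add: norm_mult)
  also have "\<dots> = (\<Sum>i<nr. \<Sum>l<n. ?m i l * (\<Sum>j<nc. ?n l j))"
    by (rule sum.cong[OF refl], subst sum.swap) (simp add: sum_distrib_left)
  also have "\<dots> \<le> (\<Sum>i<nr. \<Sum>l<n. ?m i l * entry_norm N)"
  proof (intro sum_mono mult_left_mono)
    fix i l assume "l \<in> {..<n}"
    then show "(\<Sum>j<nc. ?n l j) \<le> entry_norm N"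
      unfolding entry_norm_def using N
      by (auto intro!: member_le_sum[of l "{..<n}" "\<lambda>l. \<Sum>j<nc. ?n l j"] sum_nonneg)
  qed auto
  also have "\<dots> = entry_norm M * entry_norm N"
    using M unfolding entry_norm_def[of M] by (simp add: sum_distrib_right)
  finally show ?thesis .
qed

lemma frob_norm_le_entry_norm: "frob_norm M \<le> entry_norm M"
proof -
  have sq: "(\<Sum>i\<in>I. (f i)\<^sup>2) \<le> (\<Sum>i\<in>I. f i)\<^sup>2" if "finite I" "\<And>i. i \<in> I \<Longrightarrow> 0 \<le> f i"
    for I :: "nat set" and f :: "nat \<Rightarrow> real"
  proof -
    have "(\<Sum>i\<in>I. (f i)\<^sup>2) \<le> (\<Sum>i\<in>I. f i * (\<Sum>i\<in>I. f i))"
      unfolding power2_eq_square using that by (intro sum_mono mult_left_mono member_le_sum) auto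
    then show ?thesis by (simp add: sum_distrib_right power2_eq_square)
  qed
  have "(\<Sum>i<dim_row M. \<Sum>j<dim_col M. (cmod (M $$ (i, j)))\<^sup>2)
      \<le> (\<Sum>i<dim_row M. (\<Sum>j<dim_col M. cmod (M $$ (i, j)))\<^sup>2)"
    by (intro sum_mono sq) auto
  also have "\<dots> \<le> (entry_norm M)\<^sup>2"
    unfolding entry_norm_def by (intro sq sum_nonneg) auto
  finally show ?thesis
    unfolding frob_norm_def using entry_norm_nonneg real_le_lsqrt by blast
qed

lemma decays_entry_norm:
  assumes M: "\<And>k. M k \<in> carrier_mat nr nc"
    and dec: "\<And>i j. i < nr \<Longrightarrow> j < nc \<Longrightarrow> decays (\<lambda>k. M k $$ (i, j))"
  shows "decays (\<lambda>k. entry_norm (M k))"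
proof -
  have "entry_norm (M k) = (\<Sum>i<nr. \<Sum>j<nc. cmod (M k $$ (i, j)))" for k
    using M[of k] unfolding entry_norm_def by auto
  moreover have "decays (\<lambda>k. \<Sum>i<nr. \<Sum>j<nc. cmod (M k $$ (i, j)))"
    using dec by (intro decays_sum) (auto simp: decays_norm_iff)
  ultimately show ?thesis by simp
qed

lemma converges_linearlyI:
  assumes M: "\<And>k. M k \<in> carrier_mat nr nc" and L: "L \<in> carrier_mat nr nc"
    and dec: "decays (\<lambda>k. entry_norm (M k - L))"
  shows "converges_linearly M L"
proof -
  have "(\<lambda>k. M k $$ (i, j)) \<longlonglongrightarrow> L $$ (i, j)" if ij: "i < nr" "j < nc" for i j
  proof -
    have "cmod (M k $$ (i, j) - L $$ (i, j)) \<le> entry_norm (M k - L)" for k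
      using entry_le_entry_norm[of i "M k - L" j] M[of k] L ij by auto
    then have "decays (\<lambda>k. M k $$ (i, j) - L $$ (i, j))"
      using entry_norm_nonneg by (intro decays_dominated[OF dec, of _ 1]) auto
    from decays_tendsto_zero[OF this] show ?thesis by (simp add: LIM_zero_iff)
  qed
  then have "mat_tendsto M L" using M L unfolding mat_tendsto_def by auto
  moreover obtain C r where "0 < C" "0 < r" "r < 1" "\<And>k. norm (entry_norm (M k - L)) \<le> C * r ^ k"
    using decays_bound[OF dec] by blast
  then have "\<exists>C \<rho>. 0 < C \<and> 0 < \<rho> \<and> \<rho> < 1 \<and> (\<forall>k. frob_norm (M k - L) \<le> C * \<rho> ^ k)"
    using order_trans[OF frob_norm_le_entry_norm] entry_norm_nonneg
    by (intro exI[of _ C] exI[of _ r]) auto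
  ultimately show ?thesis unfolding converges_linearly_def by blast
qed

text \<open>Inserting the second inequality into the first absorbs the term \<open>\<epsilon>\<^sup>2 a\<close> on the left, once \<open>\<epsilon> < 1/2\<close>.\<close>

lemma coupled_bounds_decay:
  fixes a b \<epsilon> :: "nat \<Rightarrow> real"
  assumes a: "\<And>k. 0 \<le> a k" and b: "\<And>k. 0 \<le> b k" and \<epsilon>: "\<And>k. 0 \<le> \<epsilon> k" "decays \<epsilon>" and c: "0 \<le> c"
    and ab: "\<forall>\<^sub>F k in sequentially. a k \<le> \<epsilon> k + \<epsilon> k * b k \<and> b k \<le> c + \<epsilon> k * a k"
  shows "decays a"
proof -
  have "\<forall>\<^sub>F k in sequentially. \<epsilon> k < 1 / 2"
    using order_tendstoD(2)[OF decays_tendsto_zero[OF \<epsilon>(2)], of "1/2"] by simp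
  with ab have "\<forall>\<^sub>F k in sequentially. norm (a k) \<le> (2 + 2 * c) * norm (\<epsilon> k)"
  proof eventually_elim
    case (elim k)
    have "\<epsilon> k * b k \<le> \<epsilon> k * (c + \<epsilon> k * a k)" using elim \<epsilon>(1) by (intro mult_left_mono) auto
    moreover have "\<epsilon> k * (\<epsilon> k * a k) \<le> 1 / 2 * (1 * a k)"
    proof (rule mult_mono)
      show "\<epsilon> k * a k \<le> 1 * a k" using elim a[of k] by (intro mult_right_mono) linarith+
      show "\<epsilon> k \<le> 1 / 2" using elim by linarith
      show "0 \<le> \<epsilon> k * a k" using \<epsilon>(1)[of k] a[of k] by (rule mult_nonneg_nonneg)
    qed simp
    ultimately have "a k \<le> \<epsilon> k + \<epsilon> k * c + a k / 2" using elim by (simp add: algebra_simps)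
    then show ?case using a[of k] \<epsilon>(1)[of k] by (simp add: algebra_simps)
  qed
  then show ?thesis by (rule decays_dominated[OF \<epsilon>(2)])
qed

text \<open>Multiplying the two equations of the relation by \<open>K = X\<^sub>1\<^sup>-\<^sup>1\<close> from the right gives
  \<open>E = Z\<^sub>1 K + bar F Z\<^sub>2 K\<close> and \<open>F = bar E Z\<^sub>2 K - X\<^sub>2 K\<close>. The first statement is \<open>coupled_bounds_decay\<close>. For the second one,
  \<open>F + U\<^sub>2 V\<close> is split as \<open>bar E Z\<^sub>2 K - (X\<^sub>2 - U\<^sub>2) K + U\<^sub>2 (V - K)\<close>, where \<open>V - K = K (X\<^sub>1 - U\<^sub>1) V\<close>.\<close>

lemma pencil_relation_limit:
  assumes E: "\<And>k. sq n (E k)" and F: "\<And>k. sq n (F k)"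
    and rel: "\<And>k. pencil_relation n (P k) (E k) (F k)"
    and X: "\<And>k. sq n (X1 k)" "\<And>k. sq n (X2 k)" and Z: "\<And>k. sq n (Z1 k)" "\<And>k. sq n (Z2 k)"
    and U: "sq n U1" "sq n U2"
    and PX: "\<And>k. P k * (X1 k @\<^sub>r X2 k) = Z1 k @\<^sub>r Z2 k"
    and X1: "decays (\<lambda>k. entry_norm (X1 k - U1))" and X2: "decays (\<lambda>k. entry_norm (X2 k - U2))"
    and Z1: "decays (\<lambda>k. entry_norm (Z1 k))" and Z2: "decays (\<lambda>k. entry_norm (Z2 k))"
    and V: "sq n V" "U1 * V = 1\<^sub>m n"
  shows "decays (\<lambda>k. entry_norm (E k))" and "decays (\<lambda>k. entry_norm (F k + U2 * V))"
proof -
  note sc = sq_carrier[where n = n] and sr = sq_ring[where n = n]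
  note mult = entry_norm_mult[where nr = n and n = n and nc = n]
    and add = entry_norm_add[where nr = n and nc = n]
  have det: "det U1 \<noteq> 0"
    using det_mult[OF U(1) V(1)] unfolding V(2) by auto
  have X1lim: "(\<lambda>k. X1 k $$ (i, j)) \<longlonglongrightarrow> U1 $$ (i, j)" if ij: "i < n" "j < n" for i j
  proof -
    have "cmod (X1 k $$ (i, j) - U1 $$ (i, j)) \<le> entry_norm (X1 k - U1)" for k
      using entry_le_entry_norm[of i "X1 k - U1" j] X(1)[of k] U ij by auto
    then have "decays (\<lambda>k. X1 k $$ (i, j) - U1 $$ (i, j))"
      using entry_norm_nonneg by (intro decays_dominated[OF X1, of _ 1]) auto
    from decays_tendsto_zero[OF this] show ?thesis by (simp add: LIM_zero_iff)
  qed
  obtain K c0 where K: "\<And>k. sq n (K k)"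
    and XK: "\<forall>\<^sub>F k in sequentially. X1 k * K k = 1\<^sub>m n \<and> K k * X1 k = 1\<^sub>m n"
    and c0: "\<forall>\<^sub>F k in sequentially. \<forall>i<n. \<forall>j<n. cmod (K k $$ (i, j)) \<le> c0"
    by (rule inverse_of_converging[OF X(1) U(1) X1lim det]) blast+
  define \<kappa> where "\<kappa> = \<bar>(\<Sum>i<n. \<Sum>j<n. c0)\<bar>"
  have \<kappa>: "\<forall>\<^sub>F k in sequentially. entry_norm (K k) \<le> \<kappa>"
    using c0
  proof eventually_elim
    case (elim k)
    have "entry_norm (K k) = (\<Sum>i<n. \<Sum>j<n. cmod (K k $$ (i, j)))"
      using K[of k] unfolding entry_norm_def by auto
    also have "\<dots> \<le> (\<Sum>i<n. \<Sum>j<n. c0)"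
      by (intro sum_mono) (use elim in auto)
    finally have "entry_norm (K k) \<le> (\<Sum>i<n. \<Sum>j<n. c0)" .
    then show ?case unfolding \<kappa>_def by linarith
  qed
  define u where "u = entry_norm U2 + 1"
  have u: "\<forall>\<^sub>F k in sequentially. entry_norm (X2 k) \<le> u"
  proof -
    have "\<forall>\<^sub>F k in sequentially. entry_norm (X2 k - U2) < 1"
      using order_tendstoD(2)[OF decays_tendsto_zero[OF X2], of 1] by simp
    then show ?thesis
    proof eventually_elim
      case (elim k)
      have "X2 k = (X2 k - U2) + U2" using X(2)[of k] U by (auto intro!: eq_matI)
      then have "entry_norm (X2 k) \<le> entry_norm (X2 k - U2) + entry_norm U2"
        using add[of "X2 k - U2" U2] X(2)[of k] U(2) by (metis minus_carrier_mat)
      then show ?case using elim unfolding u_def by linarith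
    qed
  qed
  have rels: "E k * X1 k = Z1 k + mat_cnj (F k) * Z2 k" "F k * X1 k + X2 k = mat_cnj (E k) * Z2 k" for k
    by (rule pencil_relationD[OF rel X Z PX])+
  have EF: "\<forall>\<^sub>F k in sequentially. E k = Z1 k * K k + mat_cnj (F k) * (Z2 k * K k)
      \<and> F k = mat_cnj (E k) * (Z2 k * K k) - X2 k * K k"
    using XK
  proof eventually_elim
    case (elim k)
    note [simp] = E[of k] F[of k] K[of k] X[of k] Z[of k] U
    have "E k = (E k * X1 k) * K k" using elim by (simp add: sr sc)
    also have "\<dots> = Z1 k * K k + mat_cnj (F k) * (Z2 k * K k)"
      unfolding rels by (simp add: sr sc)
    finally have 1: "E k = Z1 k * K k + mat_cnj (F k) * (Z2 k * K k)" .
    have "F k = (F k * X1 k) * K k" using elim by (simp add: sr sc)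
    also have "F k * X1 k = mat_cnj (E k) * Z2 k - X2 k"
      unfolding rels(2)[symmetric] by (auto intro!: eq_matI simp: carrier_matD[OF F[of k]] carrier_matD[OF X(1)[of k]] carrier_matD[OF X(2)[of k]])
    also have "\<dots> * K k = mat_cnj (E k) * (Z2 k * K k) - X2 k * K k" by (simp add: sr sc)
    finally show ?case using 1 by blast
  qed
  define \<epsilon> where "\<epsilon> k = \<kappa> * (entry_norm (Z1 k) + entry_norm (Z2 k))" for k
  have \<kappa>0: "0 \<le> \<kappa>" unfolding \<kappa>_def by simp
  have \<epsilon>0: "0 \<le> \<epsilon> k" for k unfolding \<epsilon>_def using \<kappa>0 entry_norm_nonneg by simp
  have \<epsilon>d: "decays \<epsilon>" unfolding \<epsilon>_def by (intro decays_cmult decays_add Z1 Z2)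
  have ZK: "entry_norm (Z1 k * K k) \<le> \<epsilon> k" "entry_norm (Z2 k * K k) \<le> \<epsilon> k" if "entry_norm (K k) \<le> \<kappa>" for k
  proof -
    have "entry_norm (Z1 k) * entry_norm (K k) \<le> entry_norm (Z1 k) * \<kappa>"
      "entry_norm (Z2 k) * entry_norm (K k) \<le> entry_norm (Z2 k) * \<kappa>"
      using that entry_norm_nonneg by (auto intro!: mult_left_mono)
    moreover have "0 \<le> \<kappa> * entry_norm (Z1 k)" "0 \<le> \<kappa> * entry_norm (Z2 k)"
      using \<kappa>0 entry_norm_nonneg by auto
    ultimately show "entry_norm (Z1 k * K k) \<le> \<epsilon> k" "entry_norm (Z2 k * K k) \<le> \<epsilon> k"
      using mult[OF Z(1) K, of k k] mult[OF Z(2) K, of k k] unfolding \<epsilon>_def by (auto simp: algebra_simps)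
  qed
  show decE: "decays (\<lambda>k. entry_norm (E k))"
  proof (rule coupled_bounds_decay[where b = "\<lambda>k. entry_norm (F k)" and c = "u * \<kappa>"])
    show "\<forall>\<^sub>F k in sequentially. entry_norm (E k) \<le> \<epsilon> k + \<epsilon> k * entry_norm (F k)
        \<and> entry_norm (F k) \<le> u * \<kappa> + \<epsilon> k * entry_norm (E k)"
      using EF \<kappa> u
    proof eventually_elim
      case (elim k)
      have Ek: "E k = Z1 k * K k + mat_cnj (F k) * (Z2 k * K k)"
        and Fk: "F k = mat_cnj (E k) * (Z2 k * K k) - X2 k * K k" using elim by blast+
      have Kk: "entry_norm (K k) \<le> \<kappa>" and Xk: "entry_norm (X2 k) \<le> u" using elim by blast+
      note [simp] = E[of k] F[of k] K[of k] X[of k] Z[of k] U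
      have "entry_norm (E k) = entry_norm (Z1 k * K k + mat_cnj (F k) * (Z2 k * K k))"
        by (rule arg_cong[OF Ek])
      also have "\<dots> \<le> entry_norm (Z1 k * K k) + entry_norm (mat_cnj (F k) * (Z2 k * K k))"
        using add[of "Z1 k * K k" "mat_cnj (F k) * (Z2 k * K k)"] by (simp add: sc)
      also have "entry_norm (mat_cnj (F k) * (Z2 k * K k)) \<le> entry_norm (F k) * entry_norm (Z2 k * K k)"
        using mult[of "mat_cnj (F k)" "Z2 k * K k"] by (simp add: sc entry_norm_cnj)
      also have "\<dots> \<le> entry_norm (F k) * \<epsilon> k"
        using ZK(2)[OF Kk] entry_norm_nonneg by (rule mult_left_mono)
      finally have 1: "entry_norm (E k) \<le> \<epsilon> k + \<epsilon> k * entry_norm (F k)"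
        using ZK(1)[OF Kk] by (simp add: mult.commute)
      have "entry_norm (F k) = entry_norm (mat_cnj (E k) * (Z2 k * K k) + - (X2 k * K k))"
        by (subst Fk) (simp add: sr(7) sc)
      also have "\<dots> \<le> entry_norm (mat_cnj (E k) * (Z2 k * K k)) + entry_norm (X2 k * K k)"
        using add[of "mat_cnj (E k) * (Z2 k * K k)" "- (X2 k * K k)"] by (simp add: sc entry_norm_uminus)
      also have "entry_norm (mat_cnj (E k) * (Z2 k * K k)) \<le> entry_norm (E k) * entry_norm (Z2 k * K k)"
        using mult[of "mat_cnj (E k)" "Z2 k * K k"] by (simp add: sc entry_norm_cnj)
      also have "\<dots> \<le> entry_norm (E k) * \<epsilon> k"
        using ZK(2)[OF Kk] entry_norm_nonneg by (rule mult_left_mono)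
      also have "entry_norm (X2 k * K k) \<le> entry_norm (X2 k) * entry_norm (K k)"
        using mult[of "X2 k" "K k"] by simp
      also have "\<dots> \<le> u * \<kappa>"
        using Xk Kk entry_norm_nonneg by (intro mult_mono) (auto simp: u_def)
      finally show ?case using 1 by (simp add: mult.commute)
    qed
  qed (use entry_norm_nonneg \<epsilon>0 \<epsilon>d \<kappa>0 in \<open>auto simp: u_def\<close>)
  define \<nu> where "\<nu> = entry_norm U2"
  define v where "v = entry_norm V"
  have dec: "decays (\<lambda>k. entry_norm (E k) * \<epsilon> k + entry_norm (X2 k - U2) * \<kappa>
      + \<nu> * (\<kappa> * (entry_norm (X1 k - U1) * v)))"
  proof (intro decays_add)
    have "\<forall>\<^sub>F k in sequentially. norm (entry_norm (E k)) \<le> 1"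
      using order_tendstoD(2)[OF decays_tendsto_zero[OF decE], of 1] entry_norm_nonneg
      by (auto elim: eventually_mono)
    then show "decays (\<lambda>k. entry_norm (E k) * \<epsilon> k)" by (rule decays_mult_bounded[OF \<epsilon>d])
    show "decays (\<lambda>k. entry_norm (X2 k - U2) * \<kappa>)" using decays_cmult[OF X2, of \<kappa>] by (simp add: mult.commute)
    show "decays (\<lambda>k. \<nu> * (\<kappa> * (entry_norm (X1 k - U1) * v)))"
      using decays_cmult[OF X1, of "\<nu> * \<kappa> * v"] by (simp add: mult_ac)
  qed
  have "\<forall>\<^sub>F k in sequentially. norm (entry_norm (F k + U2 * V)) \<le> 1 * norm (entry_norm (E k) * \<epsilon> k
      + entry_norm (X2 k - U2) * \<kappa> + \<nu> * (\<kappa> * (entry_norm (X1 k - U1) * v)))"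
    using EF \<kappa> XK
  proof eventually_elim
    case (elim k)
    have Fk: "F k = mat_cnj (E k) * (Z2 k * K k) - X2 k * K k" and Kk: "entry_norm (K k) \<le> \<kappa>"
      and KX: "K k * X1 k = 1\<^sub>m n"
      using elim by blast+
    note [simp] = E[of k] F[of k] K[of k] X[of k] Z[of k] U V(1)
    let ?dX1 = "X1 k - U1" and ?dX2 = "X2 k - U2"
    have [simp]: "sq n ?dX1" "sq n ?dX2" by (simp_all add: sc)
    have "K k * (?dX1 * V) = K k * (X1 k * V) - K k * (U1 * V)" by (simp add: sr sc)
    also have "K k * (X1 k * V) = (K k * X1 k) * V" by (simp add: sr sc)
    also have "\<dots> - K k * (U1 * V) = V - K k" by (simp add: KX V(2) sr sc)
    finally have KV: "K k * (?dX1 * V) = V - K k" .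
    have "F k + U2 * V = mat_cnj (E k) * (Z2 k * K k) + (- (?dX2 * K k) + U2 * (K k * (?dX1 * V)))"
    proof -
      have "mat_cnj (E k) * (Z2 k * K k) + (- (?dX2 * K k) + U2 * (K k * (?dX1 * V)))
          = mat_cnj (E k) * (Z2 k * K k) - X2 k * K k + U2 * V"
        unfolding KV by (simp add: sr sc)
      then show ?thesis unfolding Fk[symmetric] by simp
    qed
    also have "entry_norm \<dots> \<le> entry_norm (mat_cnj (E k) * (Z2 k * K k))
        + (entry_norm (?dX2 * K k) + entry_norm (U2 * (K k * (?dX1 * V))))"
      using add[of "mat_cnj (E k) * (Z2 k * K k)" "- (?dX2 * K k) + U2 * (K k * (?dX1 * V))"]
        add[of "- (?dX2 * K k)" "U2 * (K k * (?dX1 * V))"]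
      by (simp add: sc entry_norm_uminus)
    also have "entry_norm (mat_cnj (E k) * (Z2 k * K k)) \<le> entry_norm (E k) * entry_norm (Z2 k * K k)"
      using mult[of "mat_cnj (E k)" "Z2 k * K k"] by (simp add: sc entry_norm_cnj)
    also have "\<dots> \<le> entry_norm (E k) * \<epsilon> k"
      using ZK(2)[OF Kk] entry_norm_nonneg by (rule mult_left_mono)
    also have "entry_norm (?dX2 * K k) \<le> entry_norm ?dX2 * entry_norm (K k)"
      using mult[of ?dX2 "K k"] by simp
    also have "\<dots> \<le> entry_norm ?dX2 * \<kappa>"
      using Kk entry_norm_nonneg by (rule mult_left_mono)
    also have "entry_norm (U2 * (K k * (?dX1 * V))) \<le> \<nu> * (\<kappa> * (entry_norm ?dX1 * v))"
    proof -
      have "entry_norm (K k * (?dX1 * V)) \<le> entry_norm (K k) * entry_norm (?dX1 * V)"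
        using mult[of "K k" "?dX1 * V"] by (simp add: sc)
      also have "\<dots> \<le> \<kappa> * (entry_norm ?dX1 * v)"
        using Kk mult[of ?dX1 V] entry_norm_nonneg \<kappa>0 unfolding v_def by (intro mult_mono) auto
      finally have "\<nu> * entry_norm (K k * (?dX1 * V)) \<le> \<nu> * (\<kappa> * (entry_norm ?dX1 * v))"
        using entry_norm_nonneg unfolding \<nu>_def by (intro mult_left_mono) auto
      then show ?thesis using mult[of U2 "K k * (?dX1 * V)"] unfolding \<nu>_def by (simp add: sc)
    qed
    finally show ?case using entry_norm_nonneg[of "F k + U2 * V"] by simp
  qed
  then show "decays (\<lambda>k. entry_norm (F k + U2 * V))" by (rule decays_dominated[OF dec])
qed

section \<open>The Cayley transform on invariant subspaces\<close>

lemma cayley_carrier: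
  assumes M: "M \<in> carrier_mat m m" and inv: "invertible_mat (complex_of_real \<alpha> \<cdot>\<^sub>m 1\<^sub>m m - M)"
  shows "cayley m \<alpha> M \<in> carrier_mat m m"
  unfolding cayley_def using M by (intro mult_carrier_mat[OF _ invertible_shift_sign(1)[OF M inv]]) auto

lemma cayley_intertwine:
  assumes H: "H \<in> carrier_mat N N" and U: "U \<in> carrier_mat N c" and S: "S \<in> carrier_mat c c"
    and HU: "H * U = U * S"
    and invH: "invertible_mat (complex_of_real \<alpha> \<cdot>\<^sub>m 1\<^sub>m N - H)"
    and invS: "invertible_mat (complex_of_real \<alpha> \<cdot>\<^sub>m 1\<^sub>m c - S)"
  shows "cayley N \<alpha> H * U = U * cayley c \<alpha> S"
proof -
  let ?a = "complex_of_real \<alpha>"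
  let ?Hm = "H - ?a \<cdot>\<^sub>m 1\<^sub>m N" and ?Hp = "H + ?a \<cdot>\<^sub>m 1\<^sub>m N"
  let ?Sm = "S - ?a \<cdot>\<^sub>m 1\<^sub>m c" and ?Sp = "S + ?a \<cdot>\<^sub>m 1\<^sub>m c"
  have car: "?Hm \<in> carrier_mat N N" "?Hp \<in> carrier_mat N N" "?Sm \<in> carrier_mat c c" "?Sp \<in> carrier_mat c c"
    using H S by auto
  note iH = invertible_shift_sign[OF H invH] and iS = invertible_shift_sign[OF S invS]
  have aU: "(?a \<cdot>\<^sub>m 1\<^sub>m N) * U = U * (?a \<cdot>\<^sub>m 1\<^sub>m c)"
    using mult_smult_distrib[OF U one_carrier_mat, of ?a] mult_smult_assoc_mat[OF one_carrier_mat U, of ?a] U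
    by simp
  have m: "?Hm * U = U * ?Sm"
    using minus_mult_distrib_mat[OF H _ U, of "?a \<cdot>\<^sub>m 1\<^sub>m N"] mult_minus_distrib_mat[OF U S, of "?a \<cdot>\<^sub>m 1\<^sub>m c"]
    by (simp add: HU aU)
  have p: "?Hp * U = U * ?Sp"
    using add_mult_distrib_mat[OF H _ U, of "?a \<cdot>\<^sub>m 1\<^sub>m N"] mult_add_distrib_mat[OF U S, of "?a \<cdot>\<^sub>m 1\<^sub>m c"]
    by (simp add: HU aU)
  have "minv ?Hm * U = minv ?Hm * (U * (?Sm * minv ?Sm))" using U iS(2) by simp
  also have "\<dots> = minv ?Hm * (?Hm * U * minv ?Sm)"
    unfolding m using assoc_mult_mat[OF U car(3) iS(1)] by simp
  also have "\<dots> = (minv ?Hm * ?Hm) * (U * minv ?Sm)"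
    using assoc_mult_mat[OF car(1) U iS(1)]
      assoc_mult_mat[OF iH(1) car(1) mult_carrier_mat[OF U iS(1)]] by simp
  also have "\<dots> = U * minv ?Sm"
    using iH(3) left_mult_one_mat[OF mult_carrier_mat[OF U iS(1)]] by simp
  finally have inv: "minv ?Hm * U = U * minv ?Sm" .
  have "cayley N \<alpha> H * U = ?Hp * (minv ?Hm * U)"
    unfolding cayley_def by (rule assoc_mult_mat[OF car(2) iH(1) U])
  also have "\<dots> = U * ?Sp * minv ?Sm"
    unfolding inv using assoc_mult_mat[OF car(2) U iS(1)] p by simp
  also have "\<dots> = U * cayley c \<alpha> S"
    unfolding cayley_def by (rule assoc_mult_mat[OF U car(4) iS(1)])
  finally show ?thesis .
qed

lemma smult_one_mult_vec:
  assumes "v \<in> carrier_vec c"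
  shows "(a \<cdot>\<^sub>m 1\<^sub>m c) *\<^sub>v v = (a :: complex) \<cdot>\<^sub>v v"
proof (rule eq_vecI)
  fix i assume "i < dim_vec (a \<cdot>\<^sub>v v)"
  then have i: "i < c" using assms by simp
  have "((a \<cdot>\<^sub>m 1\<^sub>m c) *\<^sub>v v) $ i = (\<Sum>j<c. if j = i then a * v $ j else 0)"
    unfolding lessThan_atLeast0 using i assms
    by (simp add: scalar_prod_def del: sum.delta) (rule sum.cong, auto)
  also have "\<dots> = (a \<cdot>\<^sub>v v) $ i" using i assms by simp
  finally show "((a \<cdot>\<^sub>m 1\<^sub>m c) *\<^sub>v v) $ i = (a \<cdot>\<^sub>v v) $ i" .
qed (use assms in simp)

lemma cayley_maps_left_half_plane_to_disc:
  assumes "0 < \<alpha>" "Re \<sigma> < 0"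
  shows "cmod (\<sigma> + complex_of_real \<alpha>) < cmod (\<sigma> - complex_of_real \<alpha>)"
proof -
  have "(cmod (\<sigma> + complex_of_real \<alpha>))\<^sup>2 - (cmod (\<sigma> - complex_of_real \<alpha>))\<^sup>2 = 4 * (Re \<sigma> * \<alpha>)"
    unfolding cmod_power2 by (simp add: power2_eq_square algebra_simps)
  moreover have "Re \<sigma> * \<alpha> < 0" using assms by (simp add: mult_neg_pos)
  ultimately have "(cmod (\<sigma> + complex_of_real \<alpha>))\<^sup>2 < (cmod (\<sigma> - complex_of_real \<alpha>))\<^sup>2" by linarith
  then show ?thesis by (rule power2_less_imp_less) simp
qed

lemma shift_invertible_of_stable:
  assumes S: "S \<in> carrier_mat c c" and st: "\<And>\<mu>. eigenvalue S \<mu> \<Longrightarrow> Re \<mu> < 0" and \<alpha>: "0 < \<alpha>"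
  shows "invertible_mat (complex_of_real \<alpha> \<cdot>\<^sub>m 1\<^sub>m c - S)"
proof (rule invertible_matI_det)
  let ?M = "complex_of_real \<alpha> \<cdot>\<^sub>m 1\<^sub>m c - S"
  show M: "?M \<in> carrier_mat c c" using S by auto
  show "det ?M \<noteq> 0"
  proof
    assume "det ?M = 0"
    then obtain v where v: "v \<in> carrier_vec c" "v \<noteq> 0\<^sub>v c" "?M *\<^sub>v v = 0\<^sub>v c"
      using det_0_iff_vec_prod_zero_field[OF M] by auto
    have "complex_of_real \<alpha> \<cdot>\<^sub>v v - S *\<^sub>v v = 0\<^sub>v c"
      using v minus_mult_distrib_mat_vec[of "complex_of_real \<alpha> \<cdot>\<^sub>m 1\<^sub>m c" c c S v] S
      by (simp add: smult_one_mult_vec)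
    then have "S *\<^sub>v v = complex_of_real \<alpha> \<cdot>\<^sub>v v"
      using v(1) S by (auto simp: vec_eq_iff)
    then have "eigenvalue S (complex_of_real \<alpha>)"
      unfolding eigenvalue_def eigenvector_def using v S by (intro exI[of _ v]) auto
    from st[OF this] show False using \<alpha> by simp
  qed
qed

text \<open>An eigenvector of the Cayley transform for \<open>\<tau>\<close> yields one of \<open>S\<close> for \<open>\<sigma>\<close> with \<open>\<tau> = (\<sigma> + \<alpha>)/(\<sigma> - \<alpha>)\<close>.\<close>

lemma cayley_stable:
  assumes S: "S \<in> carrier_mat c c" and st: "\<And>\<mu>. eigenvalue S \<mu> \<Longrightarrow> Re \<mu> < 0" and \<alpha>: "0 < \<alpha>"
    and ev: "eigenvalue (cayley c \<alpha> S) \<tau>"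
  shows "cmod \<tau> < 1"
proof -
  let ?a = "complex_of_real \<alpha>"
  let ?Sm = "S - ?a \<cdot>\<^sub>m 1\<^sub>m c" and ?Sp = "S + ?a \<cdot>\<^sub>m 1\<^sub>m c"
  have car: "?Sm \<in> carrier_mat c c" "?Sp \<in> carrier_mat c c" using S by auto
  note inv = shift_invertible_of_stable[OF S st \<alpha>]
  note iS = invertible_shift_sign[OF S inv]
  obtain v where v: "v \<in> carrier_vec c" "v \<noteq> 0\<^sub>v c" "cayley c \<alpha> S *\<^sub>v v = \<tau> \<cdot>\<^sub>v v"
    using ev cayley_carrier[OF S inv] unfolding eigenvalue_def eigenvector_def by auto
  define w where "w = minv ?Sm *\<^sub>v v"
  have w: "w \<in> carrier_vec c" unfolding w_def using iS(1) v(1) by (rule mult_mat_vec_carrier)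
  have Smw: "?Sm *\<^sub>v w = v"
    unfolding w_def using assoc_mult_mat_vec[OF car(1) iS(1) v(1)] iS(2) v(1) by simp
  have Spw: "?Sp *\<^sub>v w = \<tau> \<cdot>\<^sub>v v"
    unfolding w_def using assoc_mult_mat_vec[OF car(2) iS(1) v(1)] v(3) unfolding cayley_def by simp
  have w0: "w \<noteq> 0\<^sub>v c" using Smw v(2) car(1) by auto
  have Sm: "?Sm *\<^sub>v w = S *\<^sub>v w - ?a \<cdot>\<^sub>v w" and Sp: "?Sp *\<^sub>v w = S *\<^sub>v w + ?a \<cdot>\<^sub>v w"
    using minus_mult_distrib_mat_vec[of S c c "?a \<cdot>\<^sub>m 1\<^sub>m c" w] add_mult_distrib_mat_vec[of S c c "?a \<cdot>\<^sub>m 1\<^sub>m c" w] S w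
    by (simp_all add: smult_one_mult_vec)
  have Sw: "S *\<^sub>v w \<in> carrier_vec c" using S w by simp
  have entry: "(S *\<^sub>v w) $ i + ?a * w $ i = \<tau> * ((S *\<^sub>v w) $ i - ?a * w $ i)" if "i < c" for i
  proof -
    have "(?Sp *\<^sub>v w) $ i = \<tau> * (?Sm *\<^sub>v w) $ i" using Spw Smw v(1) that by simp
    then show ?thesis unfolding Sm Sp using Sw w that by simp
  qed
  have "\<tau> \<noteq> 1"
  proof
    assume "\<tau> = 1"
    then have "w $ i = 0" if "i < c" for i using entry[OF that] \<alpha> by simp
    then show False using w0 w by (auto simp: vec_eq_iff)
  qed
  \<comment> \<open>The inverse of the Cayley transform, applied to \<open>\<tau>\<close>.\<close>
  define \<sigma> where "\<sigma> = - ?a * (1 + \<tau>) / (1 - \<tau>)"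
  have \<sigma>: "\<sigma> * (1 - \<tau>) = - ?a * (1 + \<tau>)" using \<open>\<tau> \<noteq> 1\<close> unfolding \<sigma>_def by simp
  have "(S *\<^sub>v w) $ i = \<sigma> * w $ i" if "i < c" for i
  proof -
    have "(1 - \<tau>) * (S *\<^sub>v w) $ i = (- ?a * (1 + \<tau>)) * w $ i" using entry[OF that] by (simp add: algebra_simps)
    also have "\<dots> = (1 - \<tau>) * (\<sigma> * w $ i)" unfolding \<sigma>[symmetric] by simp
    finally show ?thesis using \<open>\<tau> \<noteq> 1\<close> by simp
  qed
  then have "S *\<^sub>v w = \<sigma> \<cdot>\<^sub>v w" using w S by (intro eq_vecI) auto
  then have "eigenvalue S \<sigma>"
    unfolding eigenvalue_def eigenvector_def using w w0 S by (intro exI[of _ w]) auto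
  from cayley_maps_left_half_plane_to_disc[OF \<alpha> st[OF this]]
  have lt: "cmod (\<sigma> + ?a) < cmod (\<sigma> - ?a)" .
  have "\<sigma> + ?a = \<tau> * (\<sigma> - ?a)" using \<sigma> by (simp add: algebra_simps)
  then have "cmod \<tau> * cmod (\<sigma> - ?a) < 1 * cmod (\<sigma> - ?a)" using lt by (simp add: norm_mult)
  then show ?thesis by (meson mult_right_less_imp_less norm_ge_zero)
qed

lemma cayley_jordan_block:
  "cayley m \<alpha> (jordan_block m a)
    = jordan_block m (a + complex_of_real \<alpha>) * minv (jordan_block m (a - complex_of_real \<alpha>))"
proof -
  have "jordan_block m a + complex_of_real \<alpha> \<cdot>\<^sub>m 1\<^sub>m m = jordan_block m (a + complex_of_real \<alpha>)"
    "jordan_block m a - complex_of_real \<alpha> \<cdot>\<^sub>m 1\<^sub>m m = jordan_block m (a - complex_of_real \<alpha>)"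
    by (auto intro!: eq_matI simp: jordan_block_def)
  then show ?thesis unfolding cayley_def by simp
qed

lemma shift_jordan_block_invertible:
  assumes "b \<noteq> (a :: complex)"
  shows "invertible_mat (b \<cdot>\<^sub>m 1\<^sub>m m - jordan_block m a)"
proof (rule invertible_matI_det)
  let ?M = "b \<cdot>\<^sub>m 1\<^sub>m m - jordan_block m a"
  show M: "?M \<in> carrier_mat m m" by auto
  have "det ?M = prod_list (diag_mat ?M)"
    by (rule det_upper_triangular[OF _ M]) (auto simp: jordan_block_def)
  also have "\<dots> \<noteq> 0" using assms by (auto simp: diag_mat_def jordan_block_def prod_list_zero_iff)
  finally show "det ?M \<noteq> 0" .
qed

lemma mult_unit_vec_col:
  assumes "(U :: complex mat) \<in> carrier_mat N c" "t < c"
  shows "U *\<^sub>v unit_vec c t = col U t"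
  using assms by (intro eq_vecI) auto

lemma stable_invariant_subspace_nearly_annihilated:
  assumes H: "H \<in> carrier_mat N N" and X: "X \<in> carrier_mat N c" and S: "S \<in> carrier_mat c c"
    and HX: "H * X = X * S" and st: "\<And>\<mu>. eigenvalue S \<mu> \<Longrightarrow> Re \<mu> < 0" and \<alpha>: "0 < \<alpha>"
    and invH: "invertible_mat (complex_of_real \<alpha> \<cdot>\<^sub>m 1\<^sub>m N - H)" and t: "t < c"
  shows "nearly_annihilated (cayley N \<alpha> H) (col X t)"
proof -
  note inv = shift_invertible_of_stable[OF S st \<alpha>]
  have T: "cayley c \<alpha> S \<in> carrier_mat c c" by (rule cayley_carrier[OF S inv])
  have "nearly_annihilated (cayley c \<alpha> S) (unit_vec c t)"
    by (rule stable_nearly_annihilated[OF T]) (auto intro: cayley_stable[OF S st \<alpha>])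
  from nearly_annihilated_intertwine[OF cayley_carrier[OF H invH] X T cayley_intertwine[OF H X S HX invH inv] _ this]
  show ?thesis using mult_unit_vec_col[OF X t] by simp
qed

text \<open>The columns of \<open>U Q\<close> are a Jordan chain of the Cayley transform, for an eigenvalue on the unit circle. The first half of
  this chain is nearly annihilated.\<close>

lemma jordan_chain_nearly_annihilated:
  assumes H: "H \<in> carrier_mat N N" and U: "U \<in> carrier_mat N (2 * p)"
    and HU: "H * U = U * jordan_block (2 * p) (\<i> * complex_of_real \<omega>)" and \<alpha>: "0 < \<alpha>"
    and invH: "invertible_mat (complex_of_real \<alpha> \<cdot>\<^sub>m 1\<^sub>m N - H)"
    and Q: "Q \<in> carrier_mat (2 * p) (2 * p)" "invertible_mat Q" and ev: "cmod ev = 1"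
    and JQ: "jordan_block (2 * p) (\<i> * complex_of_real \<omega> + complex_of_real \<alpha>)
        * minv (jordan_block (2 * p) (\<i> * complex_of_real \<omega> - complex_of_real \<alpha>))
      = Q * jordan_block (2 * p) ev * minv Q"
    and t: "t < p"
  shows "nearly_annihilated (cayley N \<alpha> H) (col (U * Q) t)"
proof -
  let ?J = "jordan_block (2 * p) (\<i> * complex_of_real \<omega>)" and ?L = "jordan_block (2 * p) ev"
  let ?T = "cayley (2 * p) \<alpha> ?J" and ?C = "cayley N \<alpha> H"
  have "complex_of_real \<alpha> \<noteq> \<i> * complex_of_real \<omega>" using \<alpha> by (auto simp: complex_eq_iff)
  then have inv: "invertible_mat (complex_of_real \<alpha> \<cdot>\<^sub>m 1\<^sub>m (2 * p) - ?J)"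
    by (rule shift_jordan_block_invertible)
  have J: "?J \<in> carrier_mat (2 * p) (2 * p)" and L: "?L \<in> carrier_mat (2 * p) (2 * p)" by auto
  have T: "?T \<in> carrier_mat (2 * p) (2 * p)" by (rule cayley_carrier[OF J inv])
  have C: "?C \<in> carrier_mat N N" by (rule cayley_carrier[OF H invH])
  note CU = cayley_intertwine[OF H U J HU invH inv]
  note iQ = minv_inverse[OF Q]
  have QL: "Q * ?L \<in> carrier_mat (2 * p) (2 * p)" and UQ: "U * Q \<in> carrier_mat N (2 * p)"
    using Q L U by auto
  have TQ: "?T * Q = Q * ?L"
    unfolding cayley_jordan_block JQ
    using assoc_mult_mat[OF QL iQ(1) Q(1)] iQ(3) QL by simp
  have "?C * (U * Q) = ?C * U * Q" using assoc_mult_mat[OF C U Q(1)] by simp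
  also have "\<dots> = U * (?T * Q)" unfolding CU by (rule assoc_mult_mat[OF U T Q(1)])
  also have "\<dots> = U * Q * ?L" unfolding TQ using assoc_mult_mat[OF U Q(1) L] by simp
  finally have CUQ: "?C * (U * Q) = U * Q * ?L" .
  have "nearly_annihilated ?C ((U * Q) *\<^sub>v unit_vec (2 * p) t)"
    by (rule nearly_annihilated_intertwine[OF C UQ L CUQ _ jordan_block_nearly_annihilated[OF ev t]]) simp
  moreover have "t < 2 * p" using t by simp
  ultimately show ?thesis using mult_unit_vec_col[OF UQ, of t] by simp
qed

section \<open>Block assembly of invariant subspaces\<close>

lemma cols_hconcat:
  assumes "\<And>M. M \<in> set Ms \<Longrightarrow> dim_row M = N"
  shows "cols (hconcat N Ms) = concat (map cols Ms)"
proof -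
  have "set (cols M) \<subseteq> carrier_vec N" if "M \<in> set Ms" for M
    using cols_dim[of M] assms[OF that] by simp
  then show ?thesis unfolding hconcat_def by (intro cols_mat_of_cols) auto
qed

lemma hconcat_dim_row [simp]: "dim_row (hconcat N Ms) = N"
  unfolding hconcat_def by simp

lemma hconcat_dim_col: "dim_col (hconcat N Ms) = sum_list (map dim_col Ms)"
  unfolding hconcat_def by (induction Ms) auto

lemma hconcat_Nil: "hconcat N [] = 0\<^sub>m N 0"
  unfolding hconcat_def by (intro eq_matI) auto

text \<open>The lower blocks have no rows: concatenation becomes a case of block matrices, whose product and sum are known.\<close>

lemma hconcat_Cons:
  assumes M: "dim_row M = N"
  shows "hconcat N (M # Ms) = four_block_mat M (hconcat N Ms) (0\<^sub>m 0 (dim_col M)) (0\<^sub>m 0 (dim_col (hconcat N Ms)))"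
    (is "_ = ?R")
proof (rule eq_matI)
  fix i j assume ij: "i < dim_row ?R" "j < dim_col ?R"
  let ?rest = "concat (map cols Ms)"
  have len: "length ?rest = dim_col (hconcat N Ms)" unfolding hconcat_def by simp
  have i: "i < N" and j: "j < dim_col M + length ?rest"
    using ij M unfolding len by auto
  have rest: "hconcat N Ms $$ (i, j') = ?rest ! j' $ i" if "j' < length ?rest" for j'
    unfolding hconcat_def using i that by (rule mat_of_cols_index)
  have "hconcat N (M # Ms) $$ (i, j) = ((cols M @ ?rest) ! j) $ i"
    unfolding hconcat_def using i j by (simp add: mat_of_cols_index)
  also have "\<dots> = (if j < dim_col M then M $$ (i, j) else hconcat N Ms $$ (i, j - dim_col M))"
  proof (cases "j < dim_col M")
    case True
    then show ?thesis using i M by (simp add: nth_append)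
  next
    case False
    then have "j - dim_col M < length ?rest" using j by linarith
    from rest[OF this] False show ?thesis by (simp add: nth_append)
  qed
  also have "\<dots> = ?R $$ (i, j)"
    using i j M unfolding len by simp
  finally show "hconcat N (M # Ms) $$ (i, j) = ?R $$ (i, j)" .
qed (use M in \<open>auto simp: hconcat_dim_col\<close>)

lemma hconcat_mult_diag:
  assumes "\<And>x. x \<in> set xs \<Longrightarrow> W x \<in> carrier_mat N (d x)"
    and "\<And>x. x \<in> set xs \<Longrightarrow> Q x \<in> carrier_mat (d x) (e x)"
  shows "hconcat N (map W xs) * diag_block_mat (map Q xs) = hconcat N (map (\<lambda>x. W x * Q x) xs)"
  using assms
proof (induction xs)
  case Nil
  then show ?case by (simp add: hconcat_Nil)
next
  case (Cons x xs)
  let ?H = "hconcat N (map W xs)" and ?D = "diag_block_mat (map Q xs)"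
  let ?d = "sum_list (map d xs)" and ?e = "sum_list (map e xs)"
  have dW: "map (dim_col \<circ> W) xs = map d xs" and dQ: "map (dim_row \<circ> Q) xs = map d xs"
      "map (dim_col \<circ> Q) xs = map e xs"
    using Cons.prems by auto
  have Wx: "W x \<in> carrier_mat N (d x)" and Qx: "Q x \<in> carrier_mat (d x) (e x)" using Cons.prems by auto
  have H: "?H \<in> carrier_mat N ?d" by (intro carrier_matI) (simp_all add: hconcat_dim_col dW)
  have D: "?D \<in> carrier_mat ?d ?e" by (intro carrier_matI) (simp_all add: dim_diag_block_mat dQ)
  have IH: "?H * ?D = hconcat N (map (\<lambda>x. W x * Q x) xs)" using Cons by auto
  have "hconcat N (map W (x # xs)) * diag_block_mat (map Q (x # xs))
      = four_block_mat (W x) ?H (0\<^sub>m 0 (d x)) (0\<^sub>m 0 ?d)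
        * four_block_mat (Q x) (0\<^sub>m (d x) ?e) (0\<^sub>m ?d (e x)) ?D"
    using Wx Qx H D by (simp add: hconcat_Cons Let_def)
  also have "\<dots> = four_block_mat (W x * Q x + ?H * 0\<^sub>m ?d (e x)) (W x * 0\<^sub>m (d x) ?e + ?H * ?D)
      (0\<^sub>m 0 (d x) * Q x + 0\<^sub>m 0 ?d * 0\<^sub>m ?d (e x)) (0\<^sub>m 0 (d x) * 0\<^sub>m (d x) ?e + 0\<^sub>m 0 ?d * ?D)"
    by (rule mult_four_block_mat[OF Wx H _ _ Qx _ _ D]) auto
  also have "W x * Q x + ?H * 0\<^sub>m ?d (e x) = W x * Q x" using Wx Qx H by (auto intro!: eq_matI)
  also have "W x * 0\<^sub>m (d x) ?e + ?H * ?D = ?H * ?D" using Wx H D by (auto intro!: eq_matI)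
  also have "0\<^sub>m 0 (d x) * Q x + 0\<^sub>m 0 ?d * 0\<^sub>m ?d (e x) = 0\<^sub>m 0 (dim_col (W x * Q x))"
    using Wx Qx by (auto intro!: eq_matI)
  also have "0\<^sub>m 0 (d x) * 0\<^sub>m (d x) ?e + 0\<^sub>m 0 ?d * ?D = 0\<^sub>m 0 (dim_col (?H * ?D))"
    using D by (auto intro!: eq_matI)
  also have "four_block_mat (W x * Q x) (?H * ?D) (0\<^sub>m 0 (dim_col (W x * Q x))) (0\<^sub>m 0 (dim_col (?H * ?D)))
      = hconcat N (map (\<lambda>x. W x * Q x) (x # xs))"
    unfolding IH using Wx by (simp add: hconcat_Cons)
  finally show ?case .
qed

lemma hconcat_add:
  assumes "\<And>x. x \<in> set xs \<Longrightarrow> f x \<in> carrier_mat N (d x)"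
    and "\<And>x. x \<in> set xs \<Longrightarrow> g x \<in> carrier_mat N (d x)"
  shows "hconcat N (map f xs) + hconcat N (map g xs) = hconcat N (map (\<lambda>x. f x + g x) xs)"
  using assms
proof (induction xs)
  case Nil
  then show ?case by (simp add: hconcat_Nil)
next
  case (Cons x xs)
  let ?F = "hconcat N (map f xs)" and ?G = "hconcat N (map g xs)"
  let ?d = "sum_list (map d xs)"
  have "sum_list (map (dim_col \<circ> f) xs) = ?d" "sum_list (map (dim_col \<circ> g) xs) = ?d"
    by (rule arg_cong[of _ _ sum_list], use Cons.prems in auto)+
  then have F: "?F \<in> carrier_mat N ?d" and G: "?G \<in> carrier_mat N ?d"
    by (auto intro!: carrier_matI simp: hconcat_dim_col)
  have fx: "f x \<in> carrier_mat N (d x)" and gx: "g x \<in> carrier_mat N (d x)" using Cons.prems by auto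
  have IH: "?F + ?G = hconcat N (map (\<lambda>x. f x + g x) xs)" using Cons by auto
  have "hconcat N (map f (x # xs)) + hconcat N (map g (x # xs))
      = four_block_mat (f x) ?F (0\<^sub>m 0 (d x)) (0\<^sub>m 0 ?d) + four_block_mat (g x) ?G (0\<^sub>m 0 (d x)) (0\<^sub>m 0 ?d)"
    using fx gx F G by (simp add: hconcat_Cons)
  also have "\<dots> = four_block_mat (f x + g x) (?F + ?G) (0\<^sub>m 0 (d x) + 0\<^sub>m 0 (d x)) (0\<^sub>m 0 ?d + 0\<^sub>m 0 ?d)"
    by (rule add_four_block_mat[OF fx F _ _ gx G]) auto
  also have "\<dots> = hconcat N (map (\<lambda>x. f x + g x) (x # xs))"
    using fx gx F G unfolding IH[symmetric] by (simp add: hconcat_Cons IH[symmetric])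
  finally show ?case .
qed

text \<open>Indexing by a list of pairs reduces the doubly indexed families to plain lists.\<close>

lemma block_list_conv_map: "block_list q l f = map (\<lambda>(r, j). f r j) (block_list q l Pair)"
  unfolding block_list_def by (simp add: map_concat comp_def)

lemma set_block_list: "set (block_list q l Pair) = {(r, j). j \<in> {1..q} \<and> r \<in> {1..l j}}"
proof -
  have "set (block_list q l Pair) = (\<Union>j\<in>{1..q}. (\<lambda>r. (r, j)) ` {1..l j})"
    unfolding block_list_def by (simp add: atLeastLessThanSuc_atLeastAtMost del: upt_Suc)
  then show ?thesis by blast
qed

text \<open>Only the first block column of \<open>Q\<close> enters the first \<open>p\<close> columns; these are the columns that build up \<open>\<Psi>\<close>.\<close>

lemma hconcat_pair_mult_four_block_col:
  assumes W: "W \<in> carrier_mat N p" and Z: "Z \<in> carrier_mat N p"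
    and Q: "Q \<in> carrier_mat (2 * p) (2 * p)" and sp: "split_block Q p p = (Q11, Q12, Q21, Q22)"
    and t: "t < p"
  shows "col (hconcat N [W, Z] * Q) t = col (W * Q11 + Z * Q21) t"
proof -
  have dims: "dim_row Q = p + p" "dim_col Q = p + p" using Q by auto
  note sb = split_block[OF sp dims]
  have WZ: "hconcat N [W, Z] = four_block_mat W Z (0\<^sub>m 0 p) (0\<^sub>m 0 p)"
  proof -
    have "hconcat N [Z] = Z" using Z by (auto simp: hconcat_Cons hconcat_Nil intro!: eq_matI)
    then show ?thesis using W Z by (simp add: hconcat_Cons)
  qed
  have "hconcat N [W, Z] * Q = four_block_mat (W * Q11 + Z * Q21) (W * Q12 + Z * Q22)
      (0\<^sub>m 0 p * Q11 + 0\<^sub>m 0 p * Q21) (0\<^sub>m 0 p * Q12 + 0\<^sub>m 0 p * Q22)"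
    unfolding WZ by (subst sb(5), rule mult_four_block_mat) (use W Z sb in auto)
  then show ?thesis using W Z sb(1-4) t by (intro eq_vecI) auto
qed

lemma append_rows_mult:
  assumes "A \<in> carrier_mat n m" "B \<in> carrier_mat n' m" "Q \<in> carrier_mat m c"
  shows "(A @\<^sub>r B) * Q = (A * Q) @\<^sub>r (B * Q)"
proof (rule eq_matI)
  fix i j assume ij: "i < dim_row ((A * Q) @\<^sub>r (B * Q))" "j < dim_col ((A * Q) @\<^sub>r (B * Q))"
  then have i: "i < n + n'" and j: "j < c" using assms by (auto simp: append_rows_def)
  have AB: "A @\<^sub>r B \<in> carrier_mat (n + n') m" using assms by auto
  have "row (A @\<^sub>r B) i = (if i < n then row A i else row B (i - n))"
    using assms i carrier_matD[OF AB] by (intro eq_vecI) (auto simp: append_rows_index[of A n m B n'])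
  then show "((A @\<^sub>r B) * Q) $$ (i, j) = ((A * Q) @\<^sub>r (B * Q)) $$ (i, j)"
    using assms i j carrier_matD[OF AB] append_rows_index[of "A * Q" n c "B * Q" n' i j] by auto
qed (use assms in \<open>auto simp: append_rows_def\<close>)

lemma append_rows_add:
  assumes "A \<in> carrier_mat n m" "B \<in> carrier_mat n' m" "C \<in> carrier_mat n m" "D \<in> carrier_mat n' m"
  shows "(A @\<^sub>r B) + (C @\<^sub>r D) = (A + C) @\<^sub>r (B + D)"
  using assms by (intro eq_matI) (auto simp: append_rows_def)

lemma hconcat_pair_append_rows:
  assumes "A \<in> carrier_mat n m" "B \<in> carrier_mat n' m" "C \<in> carrier_mat n m'" "D \<in> carrier_mat n' m'"
  shows "hconcat (n + n') [A @\<^sub>r B, C @\<^sub>r D] = hconcat n [A, C] @\<^sub>r hconcat n' [B, D]"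
proof -
  have dims: "dim_row (A @\<^sub>r B) = n + n'" "dim_row (C @\<^sub>r D) = n + n'"
    "dim_col (A @\<^sub>r B) = m" "dim_col (C @\<^sub>r D) = m'" using assms by (auto simp: append_rows_def)
  show ?thesis
    using assms dims
    by (intro eq_matI) (auto simp: append_rows_def hconcat_Cons hconcat_Nil)
qed

text \<open>Chooses an approximating sequence for each column and collects these sequences into matrices.\<close>

lemma nearly_annihilated_columns:
  assumes C: "C \<in> carrier_mat (n + n) (n + n)" and U: "sq n U1" "sq n U2"
    and nearly_annihilated: "\<And>c. c < n \<Longrightarrow> nearly_annihilated C (col (U1 @\<^sub>r U2) c)"
  obtains X1 X2 Z1 Z2 where
    "\<And>k. sq n (X1 k)" "\<And>k. sq n (X2 k)" "\<And>k. sq n (Z1 k)" "\<And>k. sq n (Z2 k)"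
    "\<And>k. C ^\<^sub>m (2 ^ k) * (X1 k @\<^sub>r X2 k) = Z1 k @\<^sub>r Z2 k"
    "decays (\<lambda>k. entry_norm (X1 k - U1))" "decays (\<lambda>k. entry_norm (X2 k - U2))"
    "decays (\<lambda>k. entry_norm (Z1 k))" "decays (\<lambda>k. entry_norm (Z2 k))"
proof -
  have Uc: "U1 @\<^sub>r U2 \<in> carrier_mat (n + n) n" using U by auto
  \<comment> \<open>The guard \<open>c < n\<close> is inside the existential quantifier so that one choice function serves all columns.\<close>
  have "\<forall>c. \<exists>x. c < n \<longrightarrow> (\<forall>k. x k \<in> carrier_vec (n + n))
      \<and> (\<forall>i<n + n. decays (\<lambda>k. x k $ i - (U1 @\<^sub>r U2) $$ (i, c)))
      \<and> (\<forall>i<n + n. decays (\<lambda>k. (C ^\<^sub>m (2 ^ k) *\<^sub>v x k) $ i))"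
  proof
    fix c
    show "\<exists>x. c < n \<longrightarrow> (\<forall>k. x k \<in> carrier_vec (n + n))
      \<and> (\<forall>i<n + n. decays (\<lambda>k. x k $ i - (U1 @\<^sub>r U2) $$ (i, c)))
      \<and> (\<forall>i<n + n. decays (\<lambda>k. (C ^\<^sub>m (2 ^ k) *\<^sub>v x k) $ i))"
    proof (cases "c < n")
      case True
      have d: "dim_vec (col (U1 @\<^sub>r U2) c) = n + n" using Uc by simp
      obtain x where "\<forall>k. x k \<in> carrier_vec (n + n)"
        "\<forall>i<n + n. decays (\<lambda>k. x k $ i - col (U1 @\<^sub>r U2) c $ i)"
        "\<forall>i<n + n. decays (\<lambda>k. (C ^\<^sub>m (2 ^ k) *\<^sub>v x k) $ i)"
        using nearly_annihilated[OF True] unfolding nearly_annihilated_def d by blast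
      then show ?thesis using Uc True by (intro exI[of _ x]) auto
    qed auto
  qed
  from choice[OF this] obtain x where all: "\<forall>c. c < n \<longrightarrow> (\<forall>k. x c k \<in> carrier_vec (n + n))
      \<and> (\<forall>i<n + n. decays (\<lambda>k. x c k $ i - (U1 @\<^sub>r U2) $$ (i, c)))
      \<and> (\<forall>i<n + n. decays (\<lambda>k. (C ^\<^sub>m (2 ^ k) *\<^sub>v x c k) $ i))" ..
  have x: "x c k \<in> carrier_vec (n + n)" if "c < n" for c k
    using all that by blast
  have x_lim: "decays (\<lambda>k. x c k $ i - (U1 @\<^sub>r U2) $$ (i, c))" if "c < n" "i < n + n" for c i
    using all that by blast
  have x_dec: "decays (\<lambda>k. (C ^\<^sub>m (2 ^ k) *\<^sub>v x c k) $ i)" if "c < n" "i < n + n" for c i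
    using all that by blast
  define X1 where "X1 k = mat n n (\<lambda>(i, j). x j k $ i)" for k
  define X2 where "X2 k = mat n n (\<lambda>(i, j). x j k $ (n + i))" for k
  define Z1 where "Z1 k = mat n n (\<lambda>(i, j). (C ^\<^sub>m (2 ^ k) *\<^sub>v x j k) $ i)" for k
  define Z2 where "Z2 k = mat n n (\<lambda>(i, j). (C ^\<^sub>m (2 ^ k) *\<^sub>v x j k) $ (n + i))" for k
  have c: "sq n (X1 k)" "sq n (X2 k)" "sq n (Z1 k)" "sq n (Z2 k)" for k
    unfolding X1_def X2_def Z1_def Z2_def by auto
  have PX: "C ^\<^sub>m (2 ^ k) * (X1 k @\<^sub>r X2 k) = Z1 k @\<^sub>r Z2 k" for k
  proof (rule eq_matI)
    have Ck: "C ^\<^sub>m (2 ^ k) \<in> carrier_mat (n + n) (n + n)" using C by auto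
    have Xk: "X1 k @\<^sub>r X2 k \<in> carrier_mat (n + n) n" using c by auto
    have Zk: "Z1 k @\<^sub>r Z2 k \<in> carrier_mat (n + n) n" using c by auto
    show "dim_row (C ^\<^sub>m (2 ^ k) * (X1 k @\<^sub>r X2 k)) = dim_row (Z1 k @\<^sub>r Z2 k)"
      "dim_col (C ^\<^sub>m (2 ^ k) * (X1 k @\<^sub>r X2 k)) = dim_col (Z1 k @\<^sub>r Z2 k)"
      using carrier_matD[OF Ck] carrier_matD[OF Xk] carrier_matD[OF Zk] by simp_all
    fix i j assume "i < dim_row (Z1 k @\<^sub>r Z2 k)" "j < dim_col (Z1 k @\<^sub>r Z2 k)"
    then have i: "i < n + n" and j: "j < n" using Zk by auto
    have "(X1 k @\<^sub>r X2 k) $$ (i', j) = x j k $ i'" if i': "i' < n + n" for i'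
      using append_rows_index[OF c(1,2) i' j, of k k] i' j by (auto simp: X1_def X2_def)
    then have colX: "col (X1 k @\<^sub>r X2 k) j = x j k"
      using carrier_matD[OF Xk] x[OF j, of k] j by (intro eq_vecI) auto
    have "(C ^\<^sub>m (2 ^ k) * (X1 k @\<^sub>r X2 k)) $$ (i, j) = (C ^\<^sub>m (2 ^ k) *\<^sub>v x j k) $ i"
      using carrier_matD[OF Ck] carrier_matD[OF Xk] i j by (simp add: colX)
    also have "\<dots> = (Z1 k @\<^sub>r Z2 k) $$ (i, j)"
      using i j append_rows_index[OF c(3,4) i j] by (auto simp: Z1_def Z2_def)
    finally show "(C ^\<^sub>m (2 ^ k) * (X1 k @\<^sub>r X2 k)) $$ (i, j) = (Z1 k @\<^sub>r Z2 k) $$ (i, j)" .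
  qed
  have "decays (\<lambda>k. entry_norm (X1 k - U1))"
  proof (rule decays_entry_norm[of _ n n])
    fix i j assume ij: "i < n" "j < n"
    show "decays (\<lambda>k. (X1 k - U1) $$ (i, j))"
      using x_lim[of j i] append_rows_index[OF U, of i j] U ij by (simp add: X1_def)
  qed (use U in \<open>auto simp: X1_def\<close>)
  moreover have "decays (\<lambda>k. entry_norm (X2 k - U2))"
  proof (rule decays_entry_norm[of _ n n])
    fix i j assume ij: "i < n" "j < n"
    show "decays (\<lambda>k. (X2 k - U2) $$ (i, j))"
      using x_lim[of j "n + i"] append_rows_index[OF U, of "n + i" j] U ij by (simp add: X2_def)
  qed (use U in \<open>auto simp: X2_def\<close>)
  moreover have "decays (\<lambda>k. entry_norm (Z1 k))" "decays (\<lambda>k. entry_norm (Z2 k))"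
    by (rule decays_entry_norm[of _ n n], use x_dec in \<open>auto simp: Z1_def Z2_def\<close>)+
  ultimately show thesis using that[OF c PX] by blast
qed

section \<open>Convergence of the doubling iteration\<close>

text \<open>Every column of \<open>[X, \<Psi>]\<close> is nearly annihilated by the Cayley transform of \<open>H\<close>: the columns of \<open>X\<close> since \<open>S\<close> is stable,
  and those of \<open>\<Psi>\<close> since each of them is a column of \<open>W\<^sub>r\<^sub>j Q\<^sub>1\<^sub>1 + Z\<^sub>r\<^sub>j Q\<^sub>2\<^sub>1\<close> for a single Jordan chain. There are \<open>n\<close> of them, so
  they form the two square blocks that \<open>pencil_relation_limit\<close> requires.\<close>

theorem theorem3p9:
  fixes n n1 m q :: nat
    and l :: "nat \<Rightarrow> nat" and p :: "nat \<Rightarrow> nat \<Rightarrow> nat"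
    and \<alpha> :: real and \<omega> \<theta> :: "nat \<Rightarrow> real"
    and A B H S X X1 X2 :: "complex mat"
    and W\<omega> Z\<omega> W1\<omega> W2\<omega> Z1\<omega> Z2\<omega> J\<omega> \<Omega>\<omega> \<Psi>11 \<Psi>21 :: "complex mat"
    and W Z Q Q11 Q12 Q21 Q22 :: "nat \<Rightarrow> nat \<Rightarrow> complex mat"
    and other_blocks :: "(nat \<times> complex) list"
  assumes "0 < n"
    and "A \<in> carrier_mat n n" and "B \<in> carrier_mat n n"
    and "mat_adjoint A = A" and "transpose_mat B = B"
    and "H = H_mat A B"
    and "0 < \<alpha>"
    and "invertible_mat (complex_of_real \<alpha> \<cdot>\<^sub>m 1\<^sub>m (2 * n) - H)"
    and "invertible_mat (complex_of_real \<alpha> \<cdot>\<^sub>m 1\<^sub>m n - A)"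
    and "invertible_mat (R_mat n A B \<alpha>)"
    and "invertible_mat (E_alpha n A B \<alpha>)"
    and "\<forall>k. 1 \<notin> singular_values (doubling_F n A B \<alpha> k)"
    \<comment> \<open>all partial multiplicities for purely imaginary eigenvalues are even\<close>
    and "\<forall>js d \<mu>. jordan_nf H js \<longrightarrow> (d, \<mu>) \<in> set js \<longrightarrow> Re \<mu> = 0 \<longrightarrow> even d"
    \<comment> \<open>purely imaginary eigenvalues and their Jordan blocks\<close>
    and "inj_on \<omega> {1..q}"
    and "{\<mu>. eigenvalue H \<mu> \<and> Re \<mu> = 0} = (\<lambda>j. \<i> * complex_of_real (\<omega> j)) ` {1..q}"
    and "\<forall>j\<in>{1..q}. 1 \<le> l j"
    and "\<forall>j\<in>{1..q}. \<forall>r\<in>{1..l j}. 1 \<le> p r j"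
    and "jordan_nf H (block_list q l (\<lambda>r j. (2 * p r j, \<i> * complex_of_real (\<omega> j))) @ other_blocks)"
    and "\<forall>(d, \<mu>)\<in>set other_blocks. Re \<mu> \<noteq> 0"
    \<comment> \<open>Jordan bases for the purely imaginary eigenvalues\<close>
    and "\<forall>j\<in>{1..q}. \<forall>r\<in>{1..l j}.
           W r j \<in> carrier_mat (2 * n) (p r j) \<and> Z r j \<in> carrier_mat (2 * n) (p r j)
           \<and> H * hconcat (2 * n) [W r j, Z r j]
             = hconcat (2 * n) [W r j, Z r j]
               * jordan_block (2 * p r j) (\<i> * complex_of_real (\<omega> j))"
    and "cols_form_basis
           (hconcat (2 * n) (block_list q l (\<lambda>r j. hconcat (2 * n) [W r j, Z r j])))
           (spectral_subspace H {\<mu>. Re \<mu> = 0})"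
    and "W\<omega> = hconcat (2 * n) (block_list q l W)"
    and "Z\<omega> = hconcat (2 * n) (block_list q l Z)"
    \<comment> \<open>invariant subspace for the eigenvalues with negative real part\<close>
    and "X \<in> carrier_mat (2 * n) n1" and "S \<in> carrier_mat n1 n1"
    and "H * X = X * S"
    and "vec_space.col_space (2 * n) X = spectral_subspace H {\<mu>. Re \<mu> < 0}"
    and "\<forall>\<mu>\<in>spectrum S. Re \<mu> < 0"
    and "m = (\<Sum>j = 1..q. \<Sum>r = 1..l j. p r j)" and "n1 + m = n"
    \<comment> \<open>the eigen-decomposition\<close>
    and "invertible_mat (hconcat (2 * n) [X, W\<omega>, Pi_mat n * mat_cnj X, Z\<omega>])"
    and "J\<omega> = diag_block_mat
           (block_list q l (\<lambda>r j. jordan_block (p r j) (\<i> * complex_of_real (\<omega> j))))"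
    and "\<Omega>\<omega> = diag_block_mat (block_list q l (\<lambda>r j. corner_mat (p r j)))"
    and "H * hconcat (2 * n) [X, W\<omega>, Pi_mat n * mat_cnj X, Z\<omega>]
         = hconcat (2 * n) [X, W\<omega>, Pi_mat n * mat_cnj X, Z\<omega>] * S_tilde S J\<omega> \<Omega>\<omega>"
    \<comment> \<open>Jordan decompositions of the Cayley transformed blocks\<close>
    and "\<forall>j\<in>{1..q}. exp (\<i> * complex_of_real (\<theta> j))
           = (\<i> * complex_of_real (\<omega> j) + complex_of_real \<alpha>)
             / (\<i> * complex_of_real (\<omega> j) - complex_of_real \<alpha>)"
    and "\<forall>j\<in>{1..q}. \<forall>r\<in>{1..l j}.
           Q r j \<in> carrier_mat (2 * p r j) (2 * p r j) \<and> invertible_mat (Q r j)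
           \<and> jordan_block (2 * p r j) (\<i> * complex_of_real (\<omega> j) + complex_of_real \<alpha>)
               * minv (jordan_block (2 * p r j) (\<i> * complex_of_real (\<omega> j) - complex_of_real \<alpha>))
             = Q r j * jordan_block (2 * p r j) (exp (\<i> * complex_of_real (\<theta> j))) * minv (Q r j)
           \<and> split_block (Q r j) (p r j) (p r j) = (Q11 r j, Q12 r j, Q21 r j, Q22 r j)"
    \<comment> \<open>the block rows of \<open>X\<close>, \<open>W\<omega>\<close>, \<open>Z\<omega>\<close> and the matrices \<open>\<Psi>11\<close>, \<open>\<Psi>21\<close>\<close>
    and "X1 \<in> carrier_mat n n1" and "X2 \<in> carrier_mat n n1" and "X = X1 @\<^sub>r X2"
    and "W1\<omega> \<in> carrier_mat n m" and "W2\<omega> \<in> carrier_mat n m" and "W\<omega> = W1\<omega> @\<^sub>r W2\<omega>"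
    and "Z1\<omega> \<in> carrier_mat n m" and "Z2\<omega> \<in> carrier_mat n m" and "Z\<omega> = Z1\<omega> @\<^sub>r Z2\<omega>"
    and "\<Psi>11 = W1\<omega> * diag_block_mat (block_list q l Q11) + Z1\<omega> * diag_block_mat (block_list q l Q21)"
    and "\<Psi>21 = W2\<omega> * diag_block_mat (block_list q l Q11) + Z2\<omega> * diag_block_mat (block_list q l Q21)"
    and "invertible_mat (hconcat n [X1, \<Psi>11])"
  shows "converges_linearly (doubling_E n A B \<alpha>) (0\<^sub>m n n)
       \<and> converges_linearly (doubling_F n A B \<alpha>)
           (- (hconcat n [X2, \<Psi>21] * minv (hconcat n [X1, \<Psi>11])))"
proof -
  let ?C = "cayley (n + n) \<alpha> H"
  let ?ps = "block_list q l Pair"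
  note H_def = assms(6) and \<alpha> = assms(7)
  note A = assms(2) and B = assms(3)
  have At: "A\<^sup>T = mat_cnj A"
    using arg_cong[OF assms(4)[unfolded mat_adjoint_eq], of transpose_mat] by simp
  have nn: "2 * n = n + n" by simp
  have H: "H \<in> carrier_mat (n + n) (n + n)" unfolding H_def H_mat_def using A by auto
  note invH = assms(8)[unfolded nn]
  have C: "?C \<in> carrier_mat (n + n) (n + n)" by (rule cayley_carrier[OF H invH])
  note pair = doubling_pair[OF A B At assms(5) assms(9) assms(10) invH[unfolded H_def] assms(12),
      folded H_def]
  note X = assms(24)[unfolded nn] and S = assms(25) and HX = assms(26)
  have st: "\<And>\<mu>. eigenvalue S \<mu> \<Longrightarrow> Re \<mu> < 0" using assms(28) unfolding spectrum_def by auto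
  have n1m: "n1 + m = n" by fact
  have blk: "p r j \<ge> 1" "W r j \<in> carrier_mat (n + n) (p r j)" "Z r j \<in> carrier_mat (n + n) (p r j)"
      "H * hconcat (n + n) [W r j, Z r j]
        = hconcat (n + n) [W r j, Z r j] * jordan_block (2 * p r j) (\<i> * complex_of_real (\<omega> j))"
    if "(r, j) \<in> set ?ps" for r j
    using assms(17) assms(20) that unfolding set_block_list nn by auto
  have cay: "Q r j \<in> carrier_mat (2 * p r j) (2 * p r j)" "invertible_mat (Q r j)"
      "jordan_block (2 * p r j) (\<i> * complex_of_real (\<omega> j) + complex_of_real \<alpha>)
         * minv (jordan_block (2 * p r j) (\<i> * complex_of_real (\<omega> j) - complex_of_real \<alpha>))
       = Q r j * jordan_block (2 * p r j) (exp (\<i> * complex_of_real (\<theta> j))) * minv (Q r j)"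
      "split_block (Q r j) (p r j) (p r j) = (Q11 r j, Q12 r j, Q21 r j, Q22 r j)"
    if "(r, j) \<in> set ?ps" for r j
    using assms(36) that unfolding set_block_list by auto
  have Qb: "Q11 r j \<in> carrier_mat (p r j) (p r j)" "Q21 r j \<in> carrier_mat (p r j) (p r j)"
    if "(r, j) \<in> set ?ps" for r j
  proof -
    have "dim_row (Q r j) = p r j + p r j" "dim_col (Q r j) = p r j + p r j"
      using cay(1)[OF that] by auto
    from split_block[OF cay(4)[OF that] this]
    show "Q11 r j \<in> carrier_mat (p r j) (p r j)" "Q21 r j \<in> carrier_mat (p r j) (p r j)" by auto
  qed
  have WQ: "W r j * Q11 r j \<in> carrier_mat (n + n) (p r j)" and ZQ: "Z r j * Q21 r j \<in> carrier_mat (n + n) (p r j)"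
    if "(r, j) \<in> set ?ps" for r j
    using mult_carrier_mat[OF blk(2) Qb(1)] mult_carrier_mat[OF blk(3) Qb(2)] that by blast+
  define D11 where "D11 = diag_block_mat (block_list q l Q11)"
  define D21 where "D21 = diag_block_mat (block_list q l Q21)"
  note W1 = assms(40) and W2 = assms(41) and Wr = assms(42)
  note Z1 = assms(43) and Z2 = assms(44) and Zr = assms(45)
  have W\<omega>: "W\<omega> = hconcat (n + n) (map (\<lambda>(r, j). W r j) ?ps)"
    and Z\<omega>: "Z\<omega> = hconcat (n + n) (map (\<lambda>(r, j). Z r j) ?ps)"
    using assms(22,23) unfolding nn block_list_conv_map[of q l W] block_list_conv_map[of q l Z] by auto
  have D11: "D11 = diag_block_mat (map (\<lambda>(r, j). Q11 r j) ?ps)"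
    and D21: "D21 = diag_block_mat (map (\<lambda>(r, j). Q21 r j) ?ps)"
    unfolding D11_def D21_def block_list_conv_map[of q l Q11] block_list_conv_map[of q l Q21] by auto
  have Wm: "W\<omega> \<in> carrier_mat (n + n) m" unfolding Wr using W1 W2 by (rule carrier_append_rows)
  have sumW: "sum_list (map (dim_col \<circ> (\<lambda>(r, j). W r j)) ?ps) = m"
    using carrier_matD(2)[OF Wm] unfolding W\<omega> hconcat_dim_col by simp
  have dims: "sum_list (map (f \<circ> g) ?ps) = m"
    if "\<And>r j. (r, j) \<in> set ?ps \<Longrightarrow> f (g (r, j)) = p r j" for f :: "complex mat \<Rightarrow> nat" and g
  proof -
    have "map (f \<circ> g) ?ps = map (dim_col \<circ> (\<lambda>(r, j). W r j)) ?ps"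
      using that carrier_matD(2)[OF blk(2)] by (intro map_cong refl) auto
    then show ?thesis using sumW by (simp only:)
  qed
  have D11c: "D11 \<in> carrier_mat m m" and D21c: "D21 \<in> carrier_mat m m"
    unfolding D11 D21 using carrier_matD[OF Qb(1)] carrier_matD[OF Qb(2)]
    by (auto intro!: carrier_matI dims simp: dim_diag_block_mat)
  define \<Psi> where "\<Psi> = W\<omega> * D11 + Z\<omega> * D21"
  have \<Psi>11: "\<Psi>11 = W1\<omega> * D11 + Z1\<omega> * D21" and \<Psi>21: "\<Psi>21 = W2\<omega> * D11 + Z2\<omega> * D21"
    using assms(46,47) unfolding D11_def D21_def .
  have \<Psi>c: "\<Psi>11 \<in> carrier_mat n m" "\<Psi>21 \<in> carrier_mat n m"
    unfolding \<Psi>11 \<Psi>21 using W1 W2 Z1 Z2 D11c D21c by auto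
  have \<Psi>: "\<Psi> = \<Psi>11 @\<^sub>r \<Psi>21"
    unfolding \<Psi>_def Wr Zr append_rows_mult[OF W1 W2 D11c] append_rows_mult[OF Z1 Z2 D21c] \<Psi>11 \<Psi>21
    by (rule append_rows_add) (use W1 W2 Z1 Z2 D11c D21c in auto)
  let ?B = "\<lambda>(r, j). W r j * Q11 r j + Z r j * Q21 r j"
  have "\<Psi> = hconcat (n + n) (map ?B ?ps)"
  proof -
    have "W\<omega> * D11 = hconcat (n + n) (map (\<lambda>x. (\<lambda>(r, j). W r j) x * (\<lambda>(r, j). Q11 r j) x) ?ps)"
      unfolding W\<omega> D11
      by (rule hconcat_mult_diag[where d = "\<lambda>(r, j). p r j" and e = "\<lambda>(r, j). p r j"])
         (use blk(2) Qb(1) in auto)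
    moreover have "Z\<omega> * D21 = hconcat (n + n) (map (\<lambda>x. (\<lambda>(r, j). Z r j) x * (\<lambda>(r, j). Q21 r j) x) ?ps)"
      unfolding Z\<omega> D21
      by (rule hconcat_mult_diag[where d = "\<lambda>(r, j). p r j" and e = "\<lambda>(r, j). p r j"])
         (use blk(3) Qb(2) in auto)
    ultimately have "\<Psi> = hconcat (n + n) (map (\<lambda>x. (\<lambda>(r, j). W r j) x * (\<lambda>(r, j). Q11 r j) x
        + (\<lambda>(r, j). Z r j) x * (\<lambda>(r, j). Q21 r j) x) ?ps)"
      unfolding \<Psi>_def
      by (simp only:) (rule hconcat_add[where d = "\<lambda>(r, j). p r j"], use WQ ZQ in auto)
    also have "map (\<lambda>x. (\<lambda>(r, j). W r j) x * (\<lambda>(r, j). Q11 r j) x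
        + (\<lambda>(r, j). Z r j) x * (\<lambda>(r, j). Q21 r j) x) ?ps = map ?B ?ps"
      by (intro map_cong refl) auto
    finally show ?thesis .
  qed
  moreover have "\<And>M. M \<in> set (map ?B ?ps) \<Longrightarrow> dim_row M = n + n"
    using blk(2,3) Qb by fastforce
  ultimately have cols\<Psi>: "set (cols \<Psi>) = (\<Union>M\<in>set (map ?B ?ps). set (cols M))"
    using cols_hconcat[of "map ?B ?ps" "n + n"] by simp
  have tame\<Psi>: "nearly_annihilated ?C v" if v_mem: "v \<in> set (cols \<Psi>)" for v
  proof -
    obtain r j where rj: "(r, j) \<in> set ?ps" and v: "v \<in> set (cols (W r j * Q11 r j + Z r j * Q21 r j))"
      using v_mem unfolding cols\<Psi> by auto
    note b = blk[OF rj] and c = cay[OF rj]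
    have "dim_col (W r j * Q11 r j + Z r j * Q21 r j) = p r j" using Qb[OF rj] by simp
    then obtain t where t: "t < p r j" and vt: "v = col (W r j * Q11 r j + Z r j * Q21 r j) t"
      using v by (auto simp: cols_def)
    have U: "hconcat (n + n) [W r j, Z r j] \<in> carrier_mat (n + n) (2 * p r j)"
      using b by (intro carrier_matI) (auto simp: hconcat_dim_col)
    have "nearly_annihilated ?C (col (hconcat (n + n) [W r j, Z r j] * Q r j) t)"
      by (rule jordan_chain_nearly_annihilated[OF H U b(4) \<alpha> invH c(1,2) _ c(3) t]) simp
    then show ?thesis
      unfolding vt hconcat_pair_mult_four_block_col[OF b(2,3) c(1,4) t] .
  qed
  define U1 where "U1 = hconcat n [X1, \<Psi>11]"
  define U2 where "U2 = hconcat n [X2, \<Psi>21]"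
  note X12 = assms(37,38) and Xr = assms(39)
  have U: "hconcat (n + n) [X, \<Psi>] = U1 @\<^sub>r U2"
    unfolding Xr \<Psi> U1_def U2_def by (rule hconcat_pair_append_rows[OF X12 \<Psi>c])
  have Uc: "sq n U1" "sq n U2"
    unfolding U1_def U2_def using X12 \<Psi>c n1m by (auto intro!: carrier_matI simp: hconcat_dim_col)
  have tameU: "nearly_annihilated ?C (col (U1 @\<^sub>r U2) c)" if c: "c < n" for c
  proof -
    have \<Psi>carr: "\<Psi> \<in> carrier_mat (n + n) m" unfolding \<Psi> using \<Psi>c by (rule carrier_append_rows)
    have cols: "cols (U1 @\<^sub>r U2) = cols X @ cols \<Psi>"
      unfolding U[symmetric] using X \<Psi>carr by (subst cols_hconcat) auto
    have "dim_col (U1 @\<^sub>r U2) = n" using carrier_matD(2)[OF carrier_append_rows[OF Uc]] .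
    then have "col (U1 @\<^sub>r U2) c \<in> set (cols (U1 @\<^sub>r U2))"
      using c unfolding cols_def by auto
    then consider "col (U1 @\<^sub>r U2) c \<in> set (cols X)" | "col (U1 @\<^sub>r U2) c \<in> set (cols \<Psi>)"
      unfolding cols by auto
    then show ?thesis
    proof cases
      case 1
      then obtain t where "t < n1" "col (U1 @\<^sub>r U2) c = col X t"
        using X unfolding cols_def by auto
      then show ?thesis
        using stable_invariant_subspace_nearly_annihilated[OF H X S HX st \<alpha> invH] by simp
    next
      case 2
      then show ?thesis by (rule tame\<Psi>)
    qed
  qed
  have invU1: "invertible_mat U1" unfolding U1_def by fact
  note V = minv_inverse[OF Uc(1) invU1]
  obtain Y1 Y2 T1 T2 where
    Y: "\<And>k. sq n (Y1 k)" "\<And>k. sq n (Y2 k)" and T: "\<And>k. sq n (T1 k)" "\<And>k. sq n (T2 k)"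
    and CY: "\<And>k. ?C ^\<^sub>m (2 ^ k) * (Y1 k @\<^sub>r Y2 k) = T1 k @\<^sub>r T2 k"
    and dec: "decays (\<lambda>k. entry_norm (Y1 k - U1))" "decays (\<lambda>k. entry_norm (Y2 k - U2))"
      "decays (\<lambda>k. entry_norm (T1 k))" "decays (\<lambda>k. entry_norm (T2 k))"
    using nearly_annihilated_columns[OF C Uc tameU] by blast
  have E: "\<And>k. sq n (doubling_E n A B \<alpha> k)" and F: "\<And>k. sq n (doubling_F n A B \<alpha> k)"
    and rel: "\<And>k. pencil_relation n (?C ^\<^sub>m (2 ^ k)) (doubling_E n A B \<alpha> k) (doubling_F n A B \<alpha> k)"
    using pair by blast+
  note lim = pencil_relation_limit[OF E F rel Y T Uc CY dec V(1,2)]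
  have "converges_linearly (doubling_E n A B \<alpha>) (0\<^sub>m n n)"
  proof (rule converges_linearlyI[OF E])
    have "doubling_E n A B \<alpha> k - 0\<^sub>m n n = doubling_E n A B \<alpha> k" for k
      using E[of k] by (intro eq_matI) auto
    then show "decays (\<lambda>k. entry_norm (doubling_E n A B \<alpha> k - 0\<^sub>m n n))" using lim(1) by simp
  qed simp
  moreover have "converges_linearly (doubling_F n A B \<alpha>) (- (U2 * minv U1))"
  proof (rule converges_linearlyI[OF F])
    have "doubling_F n A B \<alpha> k - - (U2 * minv U1) = doubling_F n A B \<alpha> k + U2 * minv U1" for k
      using F[of k] Uc V(1) by (intro eq_matI) auto
    then show "decays (\<lambda>k. entry_norm (doubling_F n A B \<alpha> k - - (U2 * minv U1)))" using lim(2) by simp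
  qed (use Uc V(1) in auto)
  ultimately show ?thesis unfolding U1_def U2_def by blast
qed

end
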